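(* There exists a polynomial time algorithm which determines, for a given digraph $D=(V,A)$ with at least 3 vertices and a natural number $k$, whether one can add arcs to $D$ so that the resulting digraph has no parallel arcs and contains $k$ pairwise arc-disjoint antistrong spanning subdigraphs; and in the case that this is possible, the algorithm returns a minimum cardinality set $A'$ of new arcs such that $D'=(V,A\cup A')$ has no parallel arcs and contains $k$ pairwise arc-disjoint antistrong spanning subdigraphs.
   Context: Digraphs are finite and loopless. In a walk (in the underlying graph) an arc $vw$ is forward if traversed from $v$ to $w$ and backward if traversed from $w$ to $v$. An antidirected trail is a walk with no repeated arc whose arcs alternate between forward and backward; it is a forward antidirected trail if it begins and ends with a forward arc. A digraph is antistrong if it has at least three vertices and contains a forward antidirected $(x,y)$-trail for every pair of distinct vertices $x,y$. *)

theory Defs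
  imports
    "Graph_Theory.Graph_Theory"
    "HOL-Computational_Algebra.Polynomial"
    "HOL-Library.Log_Nat"
begin

section \<open>Antistrong digraphs\<close>

text \<open>
  Digraphs are those of the library: arcs have an identity of their own, so that parallel arcs
  are possible. Finite loopless digraphs are given by \<^locale>\<open>fin_digraph\<close> together with
  \<^locale>\<open>loopfree_digraph\<close>; \<^locale>\<open>digraph\<close> excludes parallel arcs in addition (two
  oppositely directed arcs between the same vertices are not parallel).

  A walk in the underlying graph is recorded as the list of its steps; \<open>(True, e)\<close> traverses
  the arc \<open>e\<close> forward and \<open>(False, e)\<close> traverses it backward.
\<close>

fun step_from :: "('a, 'b) pre_digraph \<Rightarrow> bool \<times> 'b \<Rightarrow> 'a" where
  "step_from G (fwd, e) = (if fwd then tail G e else head G e)"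

fun step_to :: "('a, 'b) pre_digraph \<Rightarrow> bool \<times> 'b \<Rightarrow> 'a" where
  "step_to G (fwd, e) = (if fwd then head G e else tail G e)"

fun underlying_walk :: "('a, 'b) pre_digraph \<Rightarrow> 'a \<Rightarrow> (bool \<times> 'b) list \<Rightarrow> 'a \<Rightarrow> bool" where
  "underlying_walk G x [] y \<longleftrightarrow> x \<in> verts G \<and> x = y"
| "underlying_walk G x (s # p) y \<longleftrightarrow>
     snd s \<in> arcs G \<and> step_from G s = x \<and> underlying_walk G (step_to G s) p y"

definition antidirected_trail ::
  "('a, 'b) pre_digraph \<Rightarrow> 'a \<Rightarrow> (bool \<times> 'b) list \<Rightarrow> 'a \<Rightarrow> bool" where
  "antidirected_trail G x p y \<longleftrightarrow>
     underlying_walk G x p y \<and> distinct (map snd p) \<and>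
     successively (\<lambda>s s'. fst s \<noteq> fst s') p"

definition forward_antidirected_trail ::
  "('a, 'b) pre_digraph \<Rightarrow> 'a \<Rightarrow> (bool \<times> 'b) list \<Rightarrow> 'a \<Rightarrow> bool" where
  "forward_antidirected_trail G x p y \<longleftrightarrow>
     antidirected_trail G x p y \<and> p \<noteq> [] \<and> fst (hd p) \<and> fst (last p)"

definition antistrong :: "('a, 'b) pre_digraph \<Rightarrow> bool" where
  "antistrong G \<longleftrightarrow>
     3 \<le> card (verts G) \<and>
     (\<forall>x \<in> verts G. \<forall>y \<in> verts G. x \<noteq> y \<longrightarrow> (\<exists>p. forward_antidirected_trail G x p y))"

definition has_disjoint_antistrong_spanning :: "nat \<Rightarrow> ('a, 'b) pre_digraph \<Rightarrow> bool" where
  "has_disjoint_antistrong_spanning k G \<longleftrightarrow>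
     (\<exists>H :: nat \<Rightarrow> ('a, 'b) pre_digraph.
        (\<forall>i<k. spanning (H i) G \<and> antistrong (H i)) \<and>
        (\<forall>i<k. \<forall>j<k. i \<noteq> j \<longrightarrow> arcs (H i) \<inter> arcs (H j) = {}))"

text \<open>
  A new arc is identified with its pair of end vertices. This loses nothing, since a set of
  new arcs containing two parallel ones is never admissible. A new arc may still be parallel to
  an old one, which is why the sum type is used and parallel arcs are excluded separately.
\<close>

definition add_new_arcs ::
  "('a, 'b) pre_digraph \<Rightarrow> ('a \<times> 'a) set \<Rightarrow> ('a, 'b + 'a \<times> 'a) pre_digraph" where
  "add_new_arcs D A' =
     \<lparr> verts = verts D, arcs = arcs D <+> A',
       tail = case_sum (tail D) fst, head = case_sum (head D) snd \<rparr>"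

definition admissible_augmentation ::
  "nat \<Rightarrow> ('a, 'b) pre_digraph \<Rightarrow> ('a \<times> 'a) set \<Rightarrow> bool" where
  "admissible_augmentation k D A' \<longleftrightarrow>
     digraph (add_new_arcs D A') \<and> has_disjoint_antistrong_spanning k (add_new_arcs D A')"

definition minimum_augmentation ::
  "nat \<Rightarrow> ('a, 'b) pre_digraph \<Rightarrow> ('a \<times> 'a) set \<Rightarrow> bool" where
  "minimum_augmentation k D A' \<longleftrightarrow>
     admissible_augmentation k D A' \<and>
     (\<forall>B. admissible_augmentation k D B \<longrightarrow> card A' \<le> card B)"


section \<open>Algorithms and their running time\<close>

text \<open>
  The machine model is a random access machine with structured control flow. The memory consists
  of arrays of natural numbers, each unbounded and addressed indirectly; a fixed program
  uses only finitely many of them, and \<open>x\<close> at index 0 serves as a scalar variable.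
  Every elementary operation costs 1. As the only arithmetic is addition and truncated
  subtraction, numbers gain at most one bit per unit of time, so polynomial time in
  this model agrees with polynomial time on Turing machines.
\<close>

type_synonym vname = string
type_synonym state = "vname \<Rightarrow> nat \<Rightarrow> nat"

datatype expr =
    Const nat
  | Elem vname expr
  | Plus expr expr
  | Minus expr expr

datatype com =
    Skip
  | Assign vname expr expr  \<comment> \<open>array, index, new value\<close>
  | Seq com com
  | If expr com com
  | While expr com

fun val :: "expr \<Rightarrow> state \<Rightarrow> nat" where
  "val (Const c) s = c"
| "val (Elem x e) s = s x (val e s)"
| "val (Plus e f) s = val e s + val f s"
| "val (Minus e f) s = val e s - val f s"

fun cost :: "expr \<Rightarrow> nat" where
  "cost (Const c) = 1"
| "cost (Elem x e) = 1 + cost e"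
| "cost (Plus e f) = 1 + cost e + cost f"
| "cost (Minus e f) = 1 + cost e + cost f"

text \<open>\<open>runs c s t s'\<close>: started in \<open>s\<close>, the program \<open>c\<close> halts in \<open>s'\<close> after time \<open>t\<close>.\<close>

inductive runs :: "com \<Rightarrow> state \<Rightarrow> nat \<Rightarrow> state \<Rightarrow> bool" where
  Skip: "runs Skip s 1 s"
| Assign: "runs (Assign x e f) s (1 + cost e + cost f) (s(x := (s x)(val e s := val f s)))"
| Seq: "runs c s t s' \<Longrightarrow> runs d s' t' s'' \<Longrightarrow> runs (Seq c d) s (t + t') s''"
| IfTrue: "val e s \<noteq> 0 \<Longrightarrow> runs c s t s' \<Longrightarrow> runs (If e c d) s (1 + cost e + t) s'"
| IfFalse: "val e s = 0 \<Longrightarrow> runs d s t s' \<Longrightarrow> runs (If e c d) s (1 + cost e + t) s'"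
| WhileFalse: "val e s = 0 \<Longrightarrow> runs (While e c) s (1 + cost e) s"
| WhileTrue: "val e s \<noteq> 0 \<Longrightarrow> runs c s t s' \<Longrightarrow> runs (While e c) s' t' s'' \<Longrightarrow>
    runs (While e c) s (1 + cost e + t + t') s''"

inductive_cases runs_SkipE: "runs Skip s t s'"
inductive_cases runs_AssignE: "runs (Assign x e f) s t s'"
inductive_cases runs_SeqE: "runs (Seq c d) s t s'"
inductive_cases runs_IfE: "runs (If e c d) s t s'"
inductive_cases runs_WhileE: "runs (While e c) s t s'"

lemma runs_deterministic:
  "runs c s t s' \<Longrightarrow> runs c s u s'' \<Longrightarrow> t = u \<and> s' = s''"
proof (induction arbitrary: u s'' rule: runs.induct)
  case Skip then show ?case by (auto elim: runs_SkipE)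
next
  case Assign then show ?case by (auto elim: runs_AssignE)
next
  case (Seq c s t s' d t' r)
  from Seq.prems show ?case
  proof (rule runs_SeqE)
    fix v q v' assume "u = v + v'" "runs c s v q" "runs d q v' s''"
    with Seq.IH(1)[of v q] Seq.IH(2)[of v' s''] show ?thesis by simp
  qed
next
  case (IfTrue e s c t s' d)
  from IfTrue.prems IfTrue.hyps obtain v where "u = 1 + cost e + v" "runs c s v s''"
    by (auto elim: runs_IfE)
  with IfTrue.IH[of v s''] show ?case by simp
next
  case (IfFalse e s d t s' c)
  from IfFalse.prems IfFalse.hyps obtain v where "u = 1 + cost e + v" "runs d s v s''"
    by (auto elim: runs_IfE)
  with IfFalse.IH[of v s''] show ?case by simp
next
  case (WhileFalse e s c)
  from WhileFalse.prems WhileFalse.hyps show ?case by (auto elim: runs_WhileE)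
next
  case (WhileTrue e s c t s' t' r)
  from WhileTrue.prems WhileTrue.hyps obtain v q v'
    where "u = 1 + cost e + v + v'" "runs c s v q" "runs (While e c) q v' s''"
    by (auto elim: runs_WhileE)
  with WhileTrue.IH(1)[of v q] WhileTrue.IH(2)[of v' s''] show ?case by simp
qed


section \<open>Input and output\<close>

text \<open>
  A digraph is presented to an algorithm by its number of vertices and the list of the
  (tail, head) pairs of its arcs, in which repeated entries are parallel arcs.
\<close>

definition digraph_of :: "nat \<Rightarrow> (nat \<times> nat) list \<Rightarrow> (nat, nat) pre_digraph" where
  "digraph_of n es =
     \<lparr> verts = {..<n}, arcs = {..<length es},
       tail = (\<lambda>i. fst (es ! i)), head = (\<lambda>i. snd (es ! i)) \<rparr>"

lemma ex_digraph_of_iso: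
  assumes "fin_digraph D"
  shows "\<exists>n es. fin_digraph (digraph_of n es) \<and> digraph_iso (digraph_of n es) D"
proof -
  interpret fin_digraph D by fact
  obtain vs where vs: "set vs = verts D" "distinct vs"
    using finite_distinct_list[OF finite_verts] by blast
  obtain as where as: "set as = arcs D" "distinct as"
    using finite_distinct_list[OF finite_arcs] by blast
  define idx where "idx v = (SOME i. i < length vs \<and> vs ! i = v)" for v
  have idx: "idx v < length vs \<and> vs ! idx v = v" if "v \<in> verts D" for v
    unfolding idx_def by (rule someI_ex) (metis that vs(1) in_set_conv_nth)
  define es where "es = map (\<lambda>a. (idx (tail D a), idx (head D a))) as"
  define G where "G = digraph_of (length vs) es"
  define f where
    "f = \<lparr> iso_verts = nth vs, iso_arcs = nth as, iso_head = head D, iso_tail = tail D \<rparr>"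
  have mem: "as ! i \<in> arcs D" if "i < length as" for i
    using that as(1) nth_mem by blast
  have len: "length es = length as"
    by (simp add: es_def)
  have ends: "tail G i = idx (tail D (as ! i))" "head G i = idx (head D (as ! i))"
    if "i < length as" for i
    using that by (simp_all add: G_def digraph_of_def es_def)
  have GV: "verts G = {..<length vs}" and GA: "arcs G = {..<length as}"
    by (simp_all add: G_def digraph_of_def len)
  have wf: "wf_digraph G"
    by unfold_locales (use idx mem ends in \<open>auto simp: GV GA\<close>)
  have fin: "fin_digraph G"
    by (rule wf_digraph.fin_digraphI[OF wf]) (auto simp: GV GA)
  have "pre_digraph.digraph_isomorphism G f"
    unfolding pre_digraph.digraph_isomorphism_def
    using wf vs as idx mem ends by (auto simp: f_def GV GA inj_on_nth)
  moreover have "D = app_iso f G"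
    using nth_image[of "length vs" vs] nth_image[of "length as" as] vs(1) as(1)
    by (simp add: app_iso_def f_def GV GA lessThan_atLeast0)
  ultimately show ?thesis
    using fin unfolding digraph_iso_def G_def by blast
qed

definition input_state :: "nat \<Rightarrow> (nat \<times> nat) list \<Rightarrow> nat \<Rightarrow> state" where
  "input_state n es k = (\<lambda>x i.
     if x = ''n'' \<and> i = 0 then n
     else if x = ''m'' \<and> i = 0 then length es
     else if x = ''k'' \<and> i = 0 then k
     else if x = ''tail'' \<and> i < length es then fst (es ! i)
     else if x = ''head'' \<and> i < length es then snd (es ! i)
     else 0)"

text \<open>The size of the instance; \<open>k\<close> counts with its number of binary digits.\<close>

definition input_size :: "nat \<Rightarrow> (nat \<times> nat) list \<Rightarrow> nat \<Rightarrow> nat" where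
  "input_size n es k = n + length es + floorlog 2 k"

definition output_answer :: "state \<Rightarrow> nat" where
  "output_answer s = s ''answer'' 0"

definition output_arcs :: "state \<Rightarrow> (nat \<times> nat) list" where
  "output_arcs s = map (\<lambda>i. (s ''newtail'' i, s ''newhead'' i)) [0..<s ''newcount'' 0]"

end

theory Submission
  imports Defs
begin

text \<open>
  Split every vertex \<open>v\<close> of \<open>D\<close> into a tail copy \<open>v\<close> and a head copy \<open>n + v\<close> and turn every arc \<open>uv\<close>
  into the edge \<open>(u, n + v)\<close>. Forward antidirected trails become paths from tail copies to head copies,
  so a digraph on at least three vertices is antistrong iff this bipartite graph is connected, and
  \<open>k\<close> arc-disjoint antistrong spanning subdigraphs are \<open>k\<close> edge-disjoint connected spanning subgraphs.

  An edge set \<open>F\<close> is sparse if \<open>card (F[X]) \<le> k (card X - 1)\<close> for every nonempty \<open>X\<close>, and \<open>X\<close> is tight if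
  equality holds. A sparse set for which the whole vertex set is tight is a union of \<open>k\<close> disjoint
  spanning trees (Nash-Williams). The algorithm inserts greedily first the arcs of \<open>D\<close>, then all other
  pairs, as long as the set stays sparse; a rejected edge lies inside a tight set. Contracting the
  maximal tight sets shows that no admissible set of new arcs is smaller than the one found.

  Sparsity is tested by the pebble game: the accepted edges are oriented so that each vertex \<open>v\<close> has
  \<open>k - outdegree v\<close> free pebbles, and \<open>uv\<close> may be inserted iff \<open>k + 1\<close> pebbles can be moved to \<open>u\<close> and \<open>v\<close>
  by reversing directed paths that start there.
\<close>

section \<open>Connectivity of relations\<close>

text \<open>Let I be the set of all accepted candidates, J the accepted arcs of \<open>D\<close>,
  and N = 2n. One lower bound is applied twice. With the arcs of \<open>D\<close> as
  \<open>A\<close> it gives k N \<le> |B| + |J| + k for every admissible set B of new arcs. With all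
  pairs as \<open>A\<close> and B empty it shows that an admissible set can exist only if |I| = k (N
  - 1). The free pebbles total k N - |I|, so the decision is whether exactly k pebbles remain, and
  then the |I| - |J| new arcs meet the first bound.

  Two obstacles shape the details. The number k enters the input size only through its binary
  digits, so no loop may run k times; but the two ends of a candidate lack at most one pebble per
  accepted edge, which bounds the number of searches independently of k. Further, connectivity
  yields a walk that may repeat an arc, while a trail may not; at a repetition the walk is cut
  short, and the alternation of directions survives in both possible cases. Since admissible
  digraphs have no parallel arcs, sets of vertex pairs suffice as edge sets.\<close>

definition conn :: "('v \<times> 'v) set \<Rightarrow> ('v \<times> 'v) set" where
  "conn S = (S \<union> S\<inverse>)\<^sup>*"

lemma conn_refl [simp, intro]: "(x, x) \<in> conn S"
  by (simp add: conn_def)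

lemma conn_sym: "(x, y) \<in> conn S \<Longrightarrow> (y, x) \<in> conn S"
  unfolding conn_def by (meson sym_Un_converse sym_rtrancl symD)

lemma conn_trans: "(x, y) \<in> conn S \<Longrightarrow> (y, z) \<in> conn S \<Longrightarrow> (x, z) \<in> conn S"
  unfolding conn_def by (rule rtrancl_trans)

lemma conn_edge: "(x, y) \<in> S \<Longrightarrow> (x, y) \<in> conn S"
  unfolding conn_def by blast

lemma conn_mono: "S \<subseteq> T \<Longrightarrow> conn S \<subseteq> conn T"
  unfolding conn_def by (rule rtrancl_mono) blast

lemma conn_least:
  assumes "S \<subseteq> conn T"
  shows "conn S \<subseteq> conn T"
proof
  fix p assume "p \<in> conn S"
  moreover obtain x y where p: "p = (x, y)" by fastforce
  ultimately have "(x, y) \<in> (S \<union> S\<inverse>)\<^sup>*" by (simp add: conn_def)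
  then have "(x, y) \<in> conn T"
  proof induction
    case (step y z)
    then have "(y, z) \<in> conn T" using assms conn_sym[of z y T] by blast
    with step.IH show ?case by (rule conn_trans)
  qed simp
  with p show "p \<in> conn T" by simp
qed

lemma conn_insert:
  "conn (insert (a, b) S) = conn S \<union>
     {(x, y). (x, a) \<in> conn S \<and> (b, y) \<in> conn S \<or> (x, b) \<in> conn S \<and> (a, y) \<in> conn S}"
    (is "_ = ?R")
proof
  show "conn (insert (a, b) S) \<subseteq> ?R"
  proof
    fix p assume "p \<in> conn (insert (a, b) S)"
    moreover obtain x y where p: "p = (x, y)" by fastforce
    ultimately have "(x, y) \<in> (insert (a, b) S \<union> (insert (a, b) S)\<inverse>)\<^sup>*" by (simp add: conn_def)
    then have "(x, y) \<in> ?R"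
    proof induction
      case (step y z)
      then consider "(y, z) \<in> conn S" | "y = a" "z = b" | "y = b" "z = a"
        using conn_edge conn_sym by fast
      then show ?case
      proof cases
        case 1 then show ?thesis using step.IH conn_trans by fast
      next
        case 2 then show ?thesis using step.IH conn_sym conn_trans by fast
      next
        case 3 then show ?thesis using step.IH conn_sym conn_trans by fast
      qed
    qed simp
    with p show "p \<in> ?R" by simp
  qed
next
  have "conn S \<subseteq> conn (insert (a, b) S)" by (rule conn_mono) blast
  moreover have "(a, b) \<in> conn (insert (a, b) S)" by (simp add: conn_edge)
  ultimately show "?R \<subseteq> conn (insert (a, b) S)"
    using conn_sym conn_trans by (smt (verit, ccfv_SIG) Un_iff case_prodD mem_Collect_eq subrelI subset_iff)
qed

text \<open>The exchange property of the graphic matroid: if adding ab newly joins x and y, then x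
  hangs on one end of ab and y on the other, so that xy joins a and b in turn.\<close>

lemma conn_exchange:
  assumes "(x, y) \<in> conn (insert (a, b) S)" "(x, y) \<notin> conn S"
  shows "(a, b) \<in> conn (insert (x, y) S)"
  using assms conn_sym[of _ _ S] by (simp add: conn_insert) blast

lemma conn_insert_absorb: "(a, b) \<in> conn S \<Longrightarrow> conn (insert (a, b) S) = conn S"
  by (intro antisym conn_least conn_mono) (auto intro: conn_edge)

text \<open>\<open>U\<close> is a union of components of \<open>S\<close>, so a connecting path that
  starts in it never leaves it. This localizes counting arguments to one component.\<close>

lemma conn_closed:
  assumes "(x, y) \<in> conn S" "x \<in> U" "\<And>a b. (a, b) \<in> S \<Longrightarrow> a \<in> U \<longleftrightarrow> b \<in> U"
  shows "y \<in> U" "(x, y) \<in> conn (S \<inter> U \<times> U)"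
proof -
  have "(x, y) \<in> (S \<union> S\<inverse>)\<^sup>*" using assms(1) by (simp add: conn_def)
  then have "y \<in> U \<and> (x, y) \<in> conn (S \<inter> U \<times> U)"
  proof induction
    case (step y z)
    from step consider "(y, z) \<in> S \<inter> U \<times> U" | "(z, y) \<in> S \<inter> U \<times> U"
      using assms(3) by blast
    then have "z \<in> U \<and> (y, z) \<in> conn (S \<inter> U \<times> U)"
      by cases (auto intro: conn_edge conn_sym)
    then show ?case using step.IH conn_trans[of x y _ z] by simp
  qed (use assms(2) in simp)
  then show "y \<in> U" "(x, y) \<in> conn (S \<inter> U \<times> U)" by auto
qed

definition classes :: "('v \<times> 'v) set \<Rightarrow> 'v set \<Rightarrow> 'v set set" where
  "classes S V = (\<lambda>x. conn S `` {x}) ` V"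

lemma class_eq_iff: "conn S `` {x} = conn S `` {y} \<longleftrightarrow> (x, y) \<in> conn S"
  using conn_sym conn_trans by fast

lemma classes_insert_absorb: "(a, b) \<in> conn S \<Longrightarrow> classes (insert (a, b) S) V = classes S V"
  by (simp add: classes_def conn_insert_absorb)

text \<open>Only the classes of \<open>a\<close> and \<open>b\<close> change: their union replaces
  both of them.\<close>

lemma card_classes_insert:
  assumes "finite V" "a \<in> V" "b \<in> V" "(a, b) \<notin> conn S"
  shows "card (classes (insert (a, b) S) V) + 1 = card (classes S V)"
proof -
  let ?A = "conn S `` {a}" and ?B = "conn S `` {b}"
  have new: "conn (insert (a, b) S) `` {x} = (if x \<in> ?A \<union> ?B then ?A \<union> ?B else conn S `` {x})" for x
  proof -
    consider "(a, x) \<in> conn S" | "(b, x) \<in> conn S"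
      | "(a, x) \<notin> conn S" "(b, x) \<notin> conn S" "(x, a) \<notin> conn S" "(x, b) \<notin> conn S"
      using conn_sym by fast
    then show ?thesis
    proof cases
      case 1
      then have "conn S `` {x} = ?A" by (simp add: class_eq_iff conn_sym)
      with 1 show ?thesis by (auto simp: conn_insert intro: conn_sym)
    next
      case 2
      then have "conn S `` {x} = ?B" by (simp add: class_eq_iff conn_sym)
      with 2 show ?thesis by (auto simp: conn_insert intro: conn_sym)
    qed (auto simp: conn_insert)
  qed
  have eq: "classes (insert (a, b) S) V = insert (?A \<union> ?B) (classes S V - {?A, ?B})"
  proof (intro set_eqI iffI)
    fix C assume "C \<in> classes (insert (a, b) S) V"
    then obtain x where x: "x \<in> V" "C = conn (insert (a, b) S) `` {x}" by (auto simp: classes_def)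
    show "C \<in> insert (?A \<union> ?B) (classes S V - {?A, ?B})"
    proof (cases "x \<in> ?A \<union> ?B")
      case False
      then have "(x, a) \<notin> conn S" "(x, b) \<notin> conn S" "C = conn S `` {x}"
        using x new conn_sym[of x _ S] by auto
      then have "C = conn S `` {x}" "C \<noteq> ?A" "C \<noteq> ?B"
        by (simp_all add: class_eq_iff)
      then show ?thesis using x by (auto simp: classes_def)
    qed (use x new in auto)
  next
    fix C assume C: "C \<in> insert (?A \<union> ?B) (classes S V - {?A, ?B})"
    show "C \<in> classes (insert (a, b) S) V"
    proof (cases "C = ?A \<union> ?B")
      case True
      have "conn (insert (a, b) S) `` {a} = ?A \<union> ?B" using new[of a] by simp
      then show ?thesis using True assms(2) by (auto simp: classes_def)
    next
      case False
      then obtain x where x: "x \<in> V" "C = conn S `` {x}" "C \<noteq> ?A" "C \<noteq> ?B"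
        using C by (auto simp: classes_def)
      then have "x \<notin> ?A \<union> ?B" using class_eq_iff[of S] conn_sym[of _ _ S] by auto
      then show ?thesis using x new[of x] by (auto simp: classes_def)
    qed
  qed
  have "?A \<noteq> ?B" using assms(4) by (simp add: class_eq_iff)
  moreover have "?A \<union> ?B \<notin> classes S V - {?A, ?B}"
  proof
    assume "?A \<union> ?B \<in> classes S V - {?A, ?B}"
    then obtain x where "?A \<union> ?B = conn S `` {x}" "conn S `` {x} \<noteq> ?A" by (auto simp: classes_def)
    then show False using class_eq_iff[of S x a] conn_sym[of x a S] by blast
  qed
  moreover have "finite (classes S V)" using assms(1) by (simp add: classes_def)
  moreover have "{?A, ?B} \<subseteq> classes S V" using assms by (auto simp: classes_def)
  moreover have "card {?A, ?B} \<le> card (classes S V)"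
    using calculation by (intro card_mono)
  ultimately show ?thesis by (simp add: eq card_Diff_subset)
qed

lemma card_le_card_classes:
  assumes "finite V" "finite S" "S \<subseteq> V \<times> V"
  shows "card V \<le> card S + card (classes S V)"
  using assms(2,3)
proof (induction)
  case empty
  have "classes {} V = (\<lambda>x. {x}) ` V" by (auto simp: classes_def conn_def)
  then show ?case by (simp add: card_image inj_on_def)
next
  case (insert e S)
  obtain a b where e: "e = (a, b)" by fastforce
  show ?case
  proof (cases "(a, b) \<in> conn S")
    case True
    then show ?thesis using insert classes_insert_absorb[OF True] e by simp
  next
    case False
    then show ?thesis using insert card_classes_insert[of V a b S] assms(1) e by simp
  qed
qed

text \<open>A forest is a set in which no edge is spanned by the others; inserted one by one, each
  of its edges merges two classes. A loop violates the condition because \<open>conn\<close> is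
  reflexive, and so does a pair together with its reversal.\<close>

lemma card_classes_acyclic:
  assumes "finite V" "finite S" "S \<subseteq> V \<times> V" "\<forall>e\<in>S. e \<notin> conn (S - {e})"
  shows "card V = card S + card (classes S V)"
  using assms(2,3,4)
proof (induction)
  case empty
  have "classes {} V = (\<lambda>x. {x}) ` V" by (auto simp: classes_def conn_def)
  then show ?case by (simp add: card_image inj_on_def)
next
  case (insert e S)
  obtain a b where e: "e = (a, b)" by fastforce
  have "(a, b) \<notin> conn S" using insert.hyps insert.prems(2) e by auto
  moreover have "\<forall>f\<in>S. f \<notin> conn (S - {f})"
    using insert.prems(2) conn_mono[of "S - {_}" "insert e S - {_}"] by blast
  ultimately show ?case using insert card_classes_insert[of V a b S] assms(1) e by simp
qed

lemma connected_card:
  assumes "finite U" "finite S" "S \<subseteq> U \<times> U" "U \<times> U \<subseteq> conn S"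
  shows "card U \<le> card S + 1"
proof -
  have "conn S `` {x} = conn S `` {y}" if "x \<in> U" "y \<in> U" for x y
    using that assms(4) class_eq_iff[of S] by blast
  then have "\<forall>C\<in>classes S U. \<forall>D\<in>classes S U. C = D"
    unfolding classes_def by blast
  moreover have "finite (classes S U)" using assms(1) by (simp add: classes_def)
  ultimately have "card (classes S U) \<le> Suc 0"
    by (simp add: card_le_Suc0_iff_eq)
  then show ?thesis using card_le_card_classes[OF assms(1-3)] by linarith
qed

lemma acyclic_connected:
  assumes "finite V" "finite S" "S \<subseteq> V \<times> V" "\<forall>e\<in>S. e \<notin> conn (S - {e})" "card V \<le> card S + 1"
  shows "V \<times> V \<subseteq> conn S"
proof -
  have "card (classes S V) \<le> Suc 0" using card_classes_acyclic[OF assms(1-4)] assms(5) by simp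
  moreover have "finite (classes S V)" using assms(1) by (simp add: classes_def)
  ultimately have "\<forall>C\<in>classes S V. \<forall>D\<in>classes S V. C = D" by (simp add: card_le_Suc0_iff_eq)
  then show ?thesis using class_eq_iff[of S] by (auto simp: classes_def)
qed

lemma acyclic_card:
  assumes "finite V" "finite S" "S \<subseteq> V \<times> V" "\<forall>e\<in>S. e \<notin> conn (S - {e})" "V \<noteq> {}"
  shows "card S + 1 \<le> card V"
proof -
  have "card (classes S V) \<noteq> 0" using assms(1,5) by (simp add: classes_def)
  then show ?thesis using card_classes_acyclic[OF assms(1-4)] by simp
qed

text \<open>A minimal \<open>P\<close> that joins the ends of \<open>e\<close> is a path closing a
  cycle with \<open>e\<close>. By the exchange property each of its edges is spanned by the rest of
  that cycle.\<close>

lemma connecting_subset_redundant: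
  assumes "finite S" "e \<in> conn (S - {e})"
  obtains P where "P \<subseteq> S - {e}" "e \<in> conn P" "\<And>f. f \<in> P \<Longrightarrow> f \<in> conn (insert e S - {f})"
proof -
  define \<P> where "\<P> = {P. P \<subseteq> S - {e} \<and> e \<in> conn P}"
  have "finite \<P>" unfolding \<P>_def using assms(1) by (auto intro: finite_subset[of _ "Pow S"])
  moreover have "S - {e} \<in> \<P>" using assms(2) by (simp add: \<P>_def)
  ultimately obtain P where P: "P \<in> \<P>" "\<And>Q. Q \<in> \<P> \<Longrightarrow> Q \<subseteq> P \<Longrightarrow> P = Q"
    using finite_has_minimal2[of \<P>] by metis
  have "f \<in> conn (insert e S - {f})" if f: "f \<in> P" for f
  proof -
    obtain x y a b where ef: "e = (x, y)" "f = (a, b)" by fastforce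
    have "P - {f} \<noteq> P" using f by blast
    then have "P - {f} \<notin> \<P>" using P(2)[of "P - {f}"] by blast
    moreover have "P - {f} \<subseteq> S - {e}" using P(1) by (auto simp: \<P>_def)
    ultimately have "e \<notin> conn (P - {f})" by (simp add: \<P>_def)
    moreover have "e \<in> conn (insert f (P - {f}))" using P(1) f by (simp add: \<P>_def insert_absorb)
    ultimately have "f \<in> conn (insert e (P - {f}))" unfolding ef by (rule conn_exchange[rotated])
    moreover have "insert e (P - {f}) \<subseteq> insert e S - {f}" using P(1) f by (auto simp: \<P>_def)
    ultimately show ?thesis using conn_mono by blast
  qed
  then show thesis using that[of P] P(1) by (simp add: \<P>_def)
qed

section \<open>Tree packing and sparse graphs\<close>

text \<open>The summand \<open>k\<close> stands on the left because subtraction of naturals is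
  truncated. Applied to singletons, the inequality forbids loops.\<close>

definition sparse :: "nat \<Rightarrow> 'v set \<Rightarrow> ('v \<times> 'v) set \<Rightarrow> bool" where
  "sparse k V F \<longleftrightarrow> F \<subseteq> V \<times> V \<and> (\<forall>X\<subseteq>V. X \<noteq> {} \<longrightarrow> card (F \<inter> X \<times> X) + k \<le> k * card X)"

definition tight :: "nat \<Rightarrow> ('v \<times> 'v) set \<Rightarrow> 'v set \<Rightarrow> bool" where
  "tight k F X \<longleftrightarrow> card (F \<inter> X \<times> X) + k = k * card X"

section \<open>Packing spanning trees by colour exchange\<close>

locale colour_exchange =
  fixes V :: "'v set" and F :: "('v \<times> 'v) set" and k :: nat
  assumes finite_V: "finite V" and F_subset: "F \<subseteq> V \<times> V"
begin

lemma finite_F: "finite F"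
  using finite_V F_subset finite_subset by blast

definition colour_class :: "('v \<times> 'v \<Rightarrow> nat) \<Rightarrow> nat \<Rightarrow> ('v \<times> 'v) set" where
  "colour_class c i = {e \<in> F. c e = i}"

definition colouring :: "('v \<times> 'v \<Rightarrow> nat) \<Rightarrow> bool" where
  "colouring c \<longleftrightarrow> (\<forall>e\<in>F. c e < k)"

text \<open>An optimal colouring joins as many pairs of vertices as possible, counted once for each
  colour. Moving an edge that closes a cycle in its colour loses no pair, and so by maximality gains
  none. For sparse \<open>F\<close> this will force all colours of an optimal colouring to be
  forests.\<close>

definition potential :: "('v \<times> 'v \<Rightarrow> nat) \<Rightarrow> nat" where
  "potential c = (\<Sum>i<k. card (conn (colour_class c i) \<inter> V \<times> V))"

definition optimal :: "('v \<times> 'v \<Rightarrow> nat) \<Rightarrow> bool" where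
  "optimal c \<longleftrightarrow> colouring c \<and> (\<forall>d. colouring d \<longrightarrow> potential d \<le> potential c)"

definition redundant :: "('v \<times> 'v \<Rightarrow> nat) \<Rightarrow> 'v \<times> 'v \<Rightarrow> bool" where
  "redundant c e \<longleftrightarrow> e \<in> F \<and> e \<in> conn (colour_class c (c e) - {e})"

lemma finite_colour_class: "finite (colour_class c i)"
  using finite_F by (simp add: colour_class_def)

lemma ex_optimal:
  assumes "colouring c"
  shows "\<exists>c. optimal c"
proof -
  have "potential d < Suc (k * card (V \<times> V))" for d
  proof -
    have "potential d \<le> (\<Sum>i<k. card (V \<times> V))"
      unfolding potential_def by (intro sum_mono card_mono) (use finite_V in auto)
    then show ?thesis by simp
  qed
  then have "\<exists>c. colouring c \<and> (\<forall>d. colouring d \<longrightarrow> potential d \<le> potential c)"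
    using ex_has_greatest_nat[of colouring c potential] assms by metis
  then show ?thesis by (auto simp: optimal_def)
qed

lemma conn_drop_redundant:
  "redundant c e \<Longrightarrow> conn (colour_class c (c e) - {e}) = conn (colour_class c (c e))"
  using conn_insert_absorb[of "fst e" "snd e" "colour_class c (c e) - {e}"]
  by (simp add: redundant_def colour_class_def insert_absorb)

lemma colour_class_recolour:
  assumes "e \<in> F" "j \<noteq> c e"
  shows "colour_class (c(e := j)) i =
    (if i = j then insert e (colour_class c j) else if i = c e then colour_class c i - {e}
     else colour_class c i)"
  using assms by (auto simp: colour_class_def)

text \<open>No summand of the potential can drop and the total cannot rise, so every summand stays
  the same. In colour \<open>j\<close> this means that the ends of \<open>e\<close> were joined
  before \<open>e\<close> arrived.\<close>

lemma recolour:
  assumes c: "optimal c" and e: "redundant c e" and j: "j < k" "j \<noteq> c e"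
  shows "optimal (c(e := j))" "e \<in> conn (colour_class c j)"
proof -
  let ?d = "c(e := j)"
  have eF: "e \<in> F" using e by (simp add: redundant_def)
  have col: "colouring ?d" using c j(1) by (simp add: optimal_def colouring_def)
  have sub: "conn (colour_class c i) \<subseteq> conn (colour_class ?d i)" for i
    using colour_class_recolour[of e j c i, OF eF j(2)] conn_drop_redundant[OF e]
      conn_mono[of "colour_class c j" "insert e (colour_class c j)"]
    by (auto simp: subset_insertI split: if_splits)
  have le: "card (conn (colour_class c i) \<inter> V \<times> V) \<le> card (conn (colour_class ?d i) \<inter> V \<times> V)" for i
    using sub finite_V by (intro card_mono) auto
  have "potential ?d \<le> potential c" using c col by (simp add: optimal_def)
  moreover have "potential c \<le> potential ?d" unfolding potential_def using le by (rule sum_mono)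
  ultimately have eq: "potential c = potential ?d" by simp
  then show "optimal ?d" using c col by (simp add: optimal_def)
  have "card (conn (colour_class c j) \<inter> V \<times> V) = card (conn (colour_class ?d j) \<inter> V \<times> V)"
    using sum_mono_inv[OF eq[unfolded potential_def] le, of j] j(1) by simp
  then have "conn (colour_class c j) \<inter> V \<times> V = conn (colour_class ?d j) \<inter> V \<times> V"
    using sub[of j] finite_V by (intro card_subset_eq) auto
  moreover have "e \<in> conn (colour_class ?d j)"
    using conn_edge[of "fst e" "snd e"] eF by (simp add: colour_class_def)
  ultimately show "e \<in> conn (colour_class c j)" using eF F_subset by blast
qed

inductive reachable :: "('v \<times> 'v \<Rightarrow> nat) \<Rightarrow> ('v \<times> 'v \<Rightarrow> nat) \<Rightarrow> bool" for c where
  refl: "reachable c c"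
| step: "reachable c d \<Longrightarrow> redundant d e \<Longrightarrow> j < k \<Longrightarrow> reachable c (d(e := j))"

definition exchangeable :: "('v \<times> 'v \<Rightarrow> nat) \<Rightarrow> ('v \<times> 'v) set" where
  "exchangeable c = {e. \<exists>d. reachable c d \<and> redundant d e}"

text \<open>All edges of a cycle through \<open>e\<close> in its colour are redundant as well, hence
  exchangeable by the same sequence of recolourings.\<close>

lemma exchangeable_spanned_same:
  assumes "reachable c d" "redundant d e"
  shows "e \<in> conn (colour_class d (d e) \<inter> exchangeable c - {e})"
proof -
  obtain P where P: "P \<subseteq> colour_class d (d e) - {e}" "e \<in> conn P"
      "\<And>f. f \<in> P \<Longrightarrow> f \<in> conn (insert e (colour_class d (d e)) - {f})"
    using connecting_subset_redundant[OF finite_colour_class, of e d "d e"] assms(2)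
    unfolding redundant_def by metis
  have "redundant d f" if "f \<in> P" for f
  proof -
    have "insert e (colour_class d (d e)) = colour_class d (d e)" "d f = d e" "f \<in> F"
      using assms(2) that P(1) by (auto simp: redundant_def colour_class_def)
    with P(3)[OF that] show ?thesis by (simp add: redundant_def)
  qed
  then have "P \<subseteq> colour_class d (d e) \<inter> exchangeable c - {e}"
    using P(1) assms(1) by (auto simp: exchangeable_def)
  then show ?thesis using P(2) conn_mono by blast
qed

text \<open>Once recoloured to \<open>j\<close>, the edge \<open>e\<close> is redundant there too,
  so the argument for its own colour applies to the new colouring.\<close>

lemma exchangeable_spanned_other:
  assumes "optimal d" "reachable c d" "redundant d e" "j < k" "j \<noteq> d e"
  shows "e \<in> conn (colour_class d j \<inter> exchangeable c)"
proof -
  let ?d = "d(e := j)"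
  have eF: "e \<in> F" using assms(3) by (simp add: redundant_def)
  have new: "colour_class ?d j = insert e (colour_class d j)" "e \<notin> colour_class d j"
    using eF assms(5) by (auto simp: colour_class_recolour colour_class_def)
  then have "redundant ?d e"
    using recolour[OF assms(1,3,4,5)] eF by (simp add: redundant_def)
  moreover have "reachable c ?d" using reachable.step assms by blast
  ultimately have "e \<in> conn (colour_class ?d j \<inter> exchangeable c - {e})"
    using exchangeable_spanned_same[of c ?d e] by simp
  moreover have "colour_class ?d j \<inter> exchangeable c - {e} = colour_class d j \<inter> exchangeable c"
    using new by blast
  ultimately show ?thesis by simp
qed

text \<open>Recolouring \<open>e\<close> removes it from one colour and adds it to another, and in
  both it is spanned by other exchangeable edges. Since the spans therefore never change, the single
  colouring \<open>c\<close> serves for all exchangeable edges at once.\<close>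

lemma reachable_invariant:
  assumes "optimal c" "reachable c d"
  shows "optimal d \<and> (\<forall>i. conn (colour_class d i \<inter> exchangeable c) = conn (colour_class c i \<inter> exchangeable c))"
  using assms(2)
proof induction
  case refl
  then show ?case using assms(1) by simp
next
  case (step d e j)
  let ?R = "exchangeable c"
  show ?case
  proof (cases "j = d e")
    case False
    have eF: "e \<in> F" and eR: "e \<in> ?R" using step.hyps by (auto simp: redundant_def exchangeable_def)
    have drop: "conn (colour_class d (d e) \<inter> ?R - {e}) = conn (colour_class d (d e) \<inter> ?R)"
      using conn_insert_absorb[of "fst e" "snd e" "colour_class d (d e) \<inter> ?R - {e}"]
        exchangeable_spanned_same[OF step.hyps(1,2)] eF eR
      by (simp add: colour_class_def insert_absorb)
    have add: "conn (insert e (colour_class d j \<inter> ?R)) = conn (colour_class d j \<inter> ?R)"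
      using conn_insert_absorb[of "fst e" "snd e"]
        exchangeable_spanned_other[OF _ step.hyps False] step.IH by simp
    have "conn (colour_class (d(e := j)) i \<inter> ?R) = conn (colour_class d i \<inter> ?R)" for i
    proof -
      have "(colour_class d (d e) - {e}) \<inter> ?R = colour_class d (d e) \<inter> ?R - {e}"
        "insert e (colour_class d j) \<inter> ?R = insert e (colour_class d j \<inter> ?R)"
        using eR by auto
      then show ?thesis using drop add by (simp add: colour_class_recolour[of e j d i, OF eF False])
    qed
    then show ?thesis using recolour(1)[OF _ step.hyps(2,3) False] step.IH by (simp del: fun_upd_apply)
  qed (use step in simp)
qed

lemma exchangeable_spanned:
  assumes "optimal c" "j < k"
  shows "exchangeable c \<subseteq> conn (colour_class c j \<inter> exchangeable c)"
proof
  fix e assume "e \<in> exchangeable c"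
  then obtain d where d: "reachable c d" "redundant d e" by (auto simp: exchangeable_def)
  then have inv: "optimal d" "conn (colour_class d j \<inter> exchangeable c) = conn (colour_class c j \<inter> exchangeable c)"
    using reachable_invariant[OF assms(1)] by auto
  have "e \<in> conn (colour_class d j \<inter> exchangeable c)"
  proof (cases "j = d e")
    case True
    then show ?thesis using exchangeable_spanned_same[OF d] conn_mono[of "colour_class d j \<inter> exchangeable c - {e}"]
      by blast
  qed (use exchangeable_spanned_other[OF inv(1) d assms(2)] in simp)
  with inv(2) show "e \<in> conn (colour_class c j \<inter> exchangeable c)" by simp
qed

lemma card_colour_classes:
  assumes "colouring c"
  shows "card (F \<inter> X) = (\<Sum>i<k. card (colour_class c i \<inter> X))"
proof -
  have "F \<inter> X = (\<Union>i<k. colour_class c i \<inter> X)"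
    using assms by (auto simp: colour_class_def colouring_def)
  also have "card \<dots> = (\<Sum>i<k. card (colour_class c i \<inter> X))"
    by (intro card_UN_disjoint) (auto simp: finite_colour_class, auto simp: colour_class_def)
  finally show ?thesis .
qed

text \<open>Let \<open>U\<close> be the component of the exchangeable edges that contains
  \<open>e\<close>. Every colour connects \<open>U\<close> and has at least
  \<open>card U - 1\<close> edges in it; the colour of \<open>e\<close> has one more, because it
  still connects \<open>U\<close> without \<open>e\<close>. The sum exceeds what sparsity allows in
  \<open>U\<close>.\<close>

lemma optimal_no_redundant:
  assumes sparse: "sparse k V F" and c: "optimal c"
  shows "\<not> redundant c e"
proof
  assume e: "redundant c e"
  let ?R = "exchangeable c"
  define U where "U = conn ?R `` {fst e}"
  have col: "colouring c" using c by (simp add: optimal_def)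
  have eF: "e \<in> F" using e by (simp add: redundant_def)
  have eR: "e \<in> ?R" using e reachable.refl by (auto simp: exchangeable_def)
  have "?R \<subseteq> F" by (auto simp: exchangeable_def redundant_def)
  then have RV: "?R \<subseteq> V \<times> V" using F_subset by blast
  have UV: "U \<subseteq> V"
  proof
    fix y assume "y \<in> U"
    then have "(fst e, y) \<in> conn ?R" by (simp add: U_def)
    moreover have "fst e \<in> V" using eF F_subset by auto
    ultimately show "y \<in> V" using RV by (rule_tac conn_closed(1)[of _ _ ?R]) auto
  qed
  have eU: "e \<in> U \<times> U" using eR conn_edge[of "fst e" "snd e" ?R] by (auto simp: U_def mem_Times_iff)
  have closed: "a \<in> U \<longleftrightarrow> b \<in> U" if "(a, b) \<in> ?R" for a b
    using that conn_edge[of a b ?R] conn_sym[of a b ?R] conn_trans[of "fst e" _ ?R] by (auto simp: U_def)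
  have span: "U \<times> U \<subseteq> conn (T \<inter> U \<times> U)" if T: "T \<subseteq> ?R" "?R \<subseteq> conn T" for T
  proof -
    have "(x, y) \<in> conn (T \<inter> U \<times> U)" if "x \<in> U" "y \<in> U" for x y
    proof (rule conn_closed(2)[of _ _ T])
      have "(x, y) \<in> conn ?R"
        using that conn_sym[of "fst e" x ?R] conn_trans[of x "fst e" ?R y] by (simp add: U_def)
      then show "(x, y) \<in> conn T" using conn_least[OF T(2)] by blast
    qed (use that closed T in auto)
    then show ?thesis by auto
  qed
  have finU: "finite U" using UV finite_V finite_subset by blast
  have ge: "card U \<le> card (colour_class c j \<inter> U \<times> U) + 1" if "j < k" for j
  proof -
    let ?T = "colour_class c j \<inter> ?R"
    have "card U \<le> card (?T \<inter> U \<times> U) + 1"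
      using span[of ?T] exchangeable_spanned[OF c that] finite_colour_class finU
      by (intro connected_card) auto
    moreover have "card (?T \<inter> U \<times> U) \<le> card (colour_class c j \<inter> U \<times> U)"
      using finite_colour_class by (intro card_mono) auto
    ultimately show ?thesis by simp
  qed
  have gt: "card U < card (colour_class c (c e) \<inter> U \<times> U) + 1"
  proof -
    let ?T = "colour_class c (c e) \<inter> ?R - {e}"
    have "conn ?T = conn (colour_class c (c e) \<inter> ?R)"
      using conn_insert_absorb[of "fst e" "snd e" ?T] exchangeable_spanned_same[OF reachable.refl e] eF eR
      by (simp add: colour_class_def insert_absorb)
    then have "?R \<subseteq> conn ?T"
      using exchangeable_spanned[OF c, of "c e"] col eF by (simp add: colouring_def)
    then have "card U \<le> card (?T \<inter> U \<times> U) + 1"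
      using span[of ?T] finite_colour_class finU by (intro connected_card) auto
    also have "?T \<inter> U \<times> U \<subset> colour_class c (c e) \<inter> U \<times> U"
      using eU eF by (auto simp: colour_class_def)
    then have "card (?T \<inter> U \<times> U) < card (colour_class c (c e) \<inter> U \<times> U)"
      using finite_colour_class by (intro psubset_card_mono) auto
    finally show ?thesis by simp
  qed
  have "(\<Sum>i<k. card U) < (\<Sum>i<k. card (colour_class c i \<inter> U \<times> U) + 1)"
    using ge gt eF col by (intro sum_strict_mono_ex1) (auto simp: colouring_def)
  then have "k * card U < card (F \<inter> U \<times> U) + k"
    using card_colour_classes[OF col, of "U \<times> U"] by (simp only: sum.distrib) simp
  moreover have "card (F \<inter> U \<times> U) + k \<le> k * card U"
    using sparse UV eU by (auto simp: sparse_def)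
  ultimately show False by simp
qed

end

text \<open>An optimal colouring consists of \<open>k\<close> forests with at most
  \<open>card V - 1\<close> edges each. Tightness makes the total \<open>k\<close> times this bound,
  so each forest attains it and is a spanning tree.\<close>

theorem tree_packing:
  assumes "finite V" "V \<noteq> {}" "sparse k V F" "tight k F V"
  obtains c where "\<And>e. e \<in> F \<Longrightarrow> c e < k" "\<And>i. i < k \<Longrightarrow> V \<times> V \<subseteq> conn {e \<in> F. c e = i}"
proof -
  interpret colour_exchange V F k
    using assms(1,3) by unfold_locales (auto simp: sparse_def)
  have FV: "F \<inter> V \<times> V = F" using F_subset by blast
  \<comment> \<open>For \<open>k = 0\<close> there is no colour to start with, but then tightness
    leaves no edge to be coloured.\<close>
  have "colouring (\<lambda>_. 0)"
  proof (cases "k = 0")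
    case True
    then have "card F = 0" using assms(4) FV by (simp add: tight_def)
    then have "F = {}" using finite_F by simp
    then show ?thesis unfolding colouring_def by blast
  qed (simp add: colouring_def)
  then obtain c where c: "optimal c" using ex_optimal by blast
  then have col: "colouring c" by (simp add: optimal_def)
  have acyc: "\<forall>e\<in>colour_class c i. e \<notin> conn (colour_class c i - {e})" for i
    using optimal_no_redundant[OF assms(3) c] by (auto simp: redundant_def colour_class_def)
  have sub: "colour_class c i \<subseteq> V \<times> V" for i using F_subset by (auto simp: colour_class_def)
  have le: "card (colour_class c i) + 1 \<le> card V" for i
    using acyclic_card[OF assms(1) finite_colour_class sub acyc assms(2)] .
  have "card (F \<inter> UNIV) + k = k * card V" using assms(4) FV by (simp add: tight_def)
  then have "(\<Sum>i<k. card (colour_class c i) + 1) = (\<Sum>i<k. card V)"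
    using card_colour_classes[OF col, of UNIV] by (simp only: sum.distrib) simp
  then have "card (colour_class c i) + 1 = card V" if "i < k" for i
    using sum_mono_inv[of "\<lambda>i. card (colour_class c i) + 1" "{..<k}" "\<lambda>_. card V" i] le that by simp
  then have "V \<times> V \<subseteq> conn (colour_class c i)" if "i < k" for i
    using acyclic_connected[OF assms(1) finite_colour_class sub acyc] that by simp
  then show thesis using that[of c] col by (simp add: colouring_def colour_class_def)
qed

section \<open>Tight sets and the lower bound for augmentations\<close>

lemma tight_Un:
  assumes "finite V" "sparse k V F" "X \<subseteq> V" "Y \<subseteq> V" "X \<inter> Y \<noteq> {}" "tight k F X" "tight k F Y"
  shows "tight k F (X \<union> Y)"
proof -
  have "F \<subseteq> V \<times> V" using assms(2) by (simp add: sparse_def)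
  then have fin: "finite F" "finite X" "finite Y" using assms finite_subset by blast+
  let ?n = "\<lambda>X. card (F \<inter> X \<times> X)"
  have "?n X + ?n Y = card (F \<inter> X \<times> X \<union> F \<inter> Y \<times> Y) + card ((F \<inter> X \<times> X) \<inter> (F \<inter> Y \<times> Y))"
    using fin by (intro card_Un_Int) auto
  also have "(F \<inter> X \<times> X) \<inter> (F \<inter> Y \<times> Y) = F \<inter> (X \<inter> Y) \<times> (X \<inter> Y)" by auto
  also have "card (F \<inter> X \<times> X \<union> F \<inter> Y \<times> Y) \<le> ?n (X \<union> Y)"
    using fin by (intro card_mono) auto
  \<comment> \<open>Supermodularity of the number of induced edges. Sparsity bounds the terms of the
    union and of the nonempty intersection from above, so tightness of \<open>X\<close> and
    \<open>Y\<close> forces equality in both.\<close>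
  finally have le: "?n X + ?n Y \<le> ?n (X \<union> Y) + ?n (X \<inter> Y)" by simp
  have "?n (X \<inter> Y) + k \<le> k * card (X \<inter> Y)"
    using assms(2,3,5) unfolding sparse_def by (meson le_infI1)
  moreover have "X \<union> Y \<subseteq> V" "X \<union> Y \<noteq> {}" using assms by auto
  then have "?n (X \<union> Y) + k \<le> k * card (X \<union> Y)"
    using assms(2) unfolding sparse_def by blast
  moreover have "k * card X + k * card Y = k * card (X \<union> Y) + k * card (X \<inter> Y)"
    using card_Un_Int[OF fin(2,3)] by (metis add_mult_distrib2)
  ultimately show ?thesis using le assms(6,7) unfolding tight_def by linarith
qed

lemma tight_Union:
  assumes "finite V" "sparse k V F" "finite \<X>" "\<X> \<noteq> {}"
    "\<And>X. X \<in> \<X> \<Longrightarrow> X \<subseteq> V \<and> x \<in> X \<and> tight k F X"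
  shows "tight k F (\<Union>\<X>)"
  using assms(3-5)
proof (induction rule: finite_ne_induct)
  case (insert X \<X>)
  obtain Y where "Y \<in> \<X>" using insert.hyps by blast
  then have "x \<in> \<Union>\<X>" using insert.prems by blast
  moreover have "\<Union>\<X> \<subseteq> V" "X \<subseteq> V" "x \<in> X" "tight k F X" using insert.prems by blast+
  moreover have "tight k F (\<Union>\<X>)" using insert by blast
  ultimately show ?case using tight_Un[OF assms(1,2), of X "\<Union>\<X>"] by auto
qed simp

text \<open>Contracting the maximal tight sets leaves the edges of \<open>F\<close> between different sets, and these
  include all edges of \<open>A\<close> between different sets.\<close>

lemma augmentation_lower_bound:
  fixes H :: "nat \<Rightarrow> ('v \<times> 'v) set"
  assumes V: "finite V" and F: "sparse k V F"
    and A: "\<And>x y. (x, y) \<in> A \<Longrightarrow> (x, y) \<in> F \<or> (\<exists>X\<subseteq>V. x \<in> X \<and> y \<in> X \<and> tight k F X)"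
    and B: "finite B" and H: "\<And>i. i < k \<Longrightarrow> H i \<subseteq> (A \<union> B) \<inter> V \<times> V"
    and conn: "\<And>i. i < k \<Longrightarrow> V \<times> V \<subseteq> conn (H i)"
    and disj: "\<And>i j. i < k \<Longrightarrow> j < k \<Longrightarrow> i \<noteq> j \<Longrightarrow> H i \<inter> H j = {}"
  shows "k * card V \<le> card B + card F + k"
proof -
  have FV: "F \<subseteq> V \<times> V" using F by (simp add: sparse_def)
  then have finF: "finite F" using V finite_subset by blast
  \<comment> \<open>\<open>block x\<close> will be the largest tight set containing
    \<open>x\<close>. Singletons are tight because sparse sets have no loops, and the union of tight
    sets that meet is tight, so the blocks partition \<open>V\<close>.\<close>
  define family where "family x = {X. X \<subseteq> V \<and> x \<in> X \<and> tight k F X}" for x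
  define block where "block x = \<Union>(family x)" for x
  have sing: "{x} \<in> family x" if "x \<in> V" for x
  proof -
    have "card (F \<inter> {x} \<times> {x}) + k \<le> k * card {x}" using F that unfolding sparse_def by blast
    then show ?thesis using that by (simp add: family_def tight_def)
  qed
  have finfam: "finite (family x)" for x
    unfolding family_def using V by (auto intro: finite_subset[of _ "Pow V"])
  have block: "block x \<in> family x" if "x \<in> V" for x
  proof -
    have "tight k F (block x)" unfolding block_def
      by (rule tight_Union[OF V F finfam, of _ x]) (use sing[OF that] in \<open>auto simp: family_def\<close>)
    moreover have "x \<in> block x" using sing[OF that] by (auto simp: block_def)
    moreover have "block x \<subseteq> V" by (auto simp: block_def family_def)
    ultimately show ?thesis by (simp add: family_def)
  qed
  have sub_block: "X \<subseteq> block x" if "X \<in> family x" for X x using that by (auto simp: block_def)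
  have same: "block x = block y" if xy: "x \<in> V" "y \<in> V" "block x \<inter> block y \<noteq> {}" for x y
  proof -
    have b: "block x \<in> family x" "block y \<in> family y" using block xy by auto
    then have "tight k F (block x \<union> block y)"
      using tight_Un[OF V F, of "block x" "block y"] xy(3) by (auto simp: family_def)
    then have "block x \<union> block y \<in> family x" "block x \<union> block y \<in> family y"
      using b by (auto simp: family_def)
    then show ?thesis using sub_block[of _ x] sub_block[of _ y] by blast
  qed
  define \<B> where "\<B> = block ` V"
  define Q where "Q = {e \<in> F. block (fst e) \<noteq> block (snd e)}"
  have \<B>: "finite \<B>" "\<Union>\<B> = V" "\<And>C. C \<in> \<B> \<Longrightarrow> finite C \<and> tight k F C"
    using V block finite_subset[OF _ V] by (auto simp: \<B>_def family_def)
  have pd: "pairwise disjnt \<B>"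
    unfolding \<B>_def pairwise_def disjnt_def using same by blast
  have in_block: "block x = C" if C: "x \<in> C" "C \<in> \<B>" for x C
  proof -
    obtain y where y: "y \<in> V" "C = block y" using C(2) by (auto simp: \<B>_def)
    moreover have x: "x \<in> V" using C \<B>(2) by blast
    moreover have "x \<in> block x" using block[OF x] by (simp add: family_def)
    ultimately show ?thesis using same[of x y] C(1) by blast
  qed
  have inner: "F - Q = (\<Union>C\<in>\<B>. F \<inter> C \<times> C)"
  proof (intro set_eqI iffI)
    fix e assume e: "e \<in> F - Q"
    then have "fst e \<in> V" "snd e \<in> V" "block (fst e) = block (snd e)" using FV by (auto simp: Q_def)
    then show "e \<in> (\<Union>C\<in>\<B>. F \<inter> C \<times> C)"
      using e block[of "fst e"] block[of "snd e"] by (auto simp: \<B>_def family_def mem_Times_iff)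
  next
    fix e assume "e \<in> (\<Union>C\<in>\<B>. F \<inter> C \<times> C)"
    then show "e \<in> F - Q" using in_block by (fastforce simp: Q_def)
  qed
  have "card (F - Q) = (\<Sum>C\<in>\<B>. card (F \<inter> C \<times> C))"
    unfolding inner using \<B>(1) finF pd
    by (intro card_UN_disjoint) (auto simp: pairwise_def disjnt_def)
  then have "card F = card Q + (\<Sum>C\<in>\<B>. card (F \<inter> C \<times> C))"
    using card_Diff_subset[of Q F] card_mono[OF finF, of Q] finF by (auto simp: Q_def)
  moreover have "(\<Sum>C\<in>\<B>. card (F \<inter> C \<times> C) + k) = (\<Sum>C\<in>\<B>. k * card C)"
    using \<B>(3) by (intro sum.cong) (auto simp: tight_def)
  moreover have "(\<Sum>C\<in>\<B>. card C) = card V"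
    using card_Union_disjoint[of \<B>] pd \<B> by auto
  \<comment> \<open>Each block \<open>C\<close> carries exactly \<open>k * (card C - 1)\<close>
    edges of \<open>F\<close>; summed over the partition, what remains of \<open>F\<close> is
    \<open>Q\<close>, the edges between blocks.\<close>
  ultimately have cardF: "card F + k * card \<B> = card Q + k * card V"
    by (simp add: sum.distrib sum_distrib_left[symmetric] mult.commute)
  define K where "K i = {e \<in> H i. block (fst e) \<noteq> block (snd e)}" for i
  \<comment> \<open>A pair of \<open>A\<close> outside \<open>F\<close> has both ends in a tight
    set, which lies inside one block. So only edges of \<open>Q\<close> and \<open>B\<close> can run
    between blocks.\<close>
  have KQB: "K i \<subseteq> Q \<union> B" if "i < k" for i
  proof
    fix e assume e: "e \<in> K i"
    show "e \<in> Q \<union> B"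
    proof (cases "e \<in> F \<or> e \<in> B")
      case False
      then have "(fst e, snd e) \<in> A" "fst e \<in> V" using e H[OF that] by (auto simp: K_def)
      then obtain X where X: "X \<subseteq> V" "fst e \<in> X" "snd e \<in> X" "tight k F X"
        using A[of "fst e" "snd e"] False by auto
      then have "snd e \<in> block (fst e)" "snd e \<in> V" using sub_block[of X "fst e"] by (auto simp: family_def)
      then have "block (fst e) = block (snd e)"
        using in_block[of "snd e" "block (fst e)"] \<open>fst e \<in> V\<close> by (simp add: \<B>_def)
      then show ?thesis using e by (simp add: K_def)
    qed (use e in \<open>auto simp: K_def Q_def\<close>)
  qed
  have finQB: "finite (Q \<union> B)" using B finF by (simp add: Q_def)
  then have finK: "finite (K i)" if "i < k" for i using KQB[OF that] finite_subset by blast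
  have ge: "card \<B> \<le> card (K i) + 1" if i: "i < k" for i
  proof -
    \<comment> \<open>\<open>S\<close> is \<open>H i\<close> after contraction of the blocks,
      without loops. It inherits connectivity, so at least \<open>card \<B> - 1\<close> edges of
      \<open>H i\<close> run between blocks.\<close>
    define S where "S = (\<lambda>e. (block (fst e), block (snd e))) ` K i"
    have "S \<subseteq> \<B> \<times> \<B>" using H[OF i] by (auto simp: S_def K_def \<B>_def)
    moreover have "\<B> \<times> \<B> \<subseteq> conn S"
    proof -
      have "(block x, block y) \<in> conn S" if "x \<in> V" "y \<in> V" for x y
      proof -
        have "(x, y) \<in> (H i \<union> (H i)\<inverse>)\<^sup>*" using conn[OF i] that by (auto simp: conn_def)
        then show ?thesis
        proof induction
          case (step y z)
          have edge: "(block a, block b) \<in> conn S" if "(a, b) \<in> H i" for a b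
          proof (cases "block a = block b")
            case False
            then have "(block a, block b) \<in> S" using that by (force simp: S_def K_def)
            then show ?thesis by (rule conn_edge)
          qed simp
          have "(block y, block z) \<in> conn S"
            using step.hyps(2) edge[of y z] conn_sym[OF edge[of z y]] by auto
          with step.IH show ?case by (rule conn_trans)
        qed simp
      qed
      then show ?thesis by (auto simp: \<B>_def)
    qed
    moreover have "finite S" using finK[OF i] by (simp add: S_def)
    ultimately have "card \<B> \<le> card S + 1" using \<B>(1) by (intro connected_card)
    also have "card S \<le> card (K i)" unfolding S_def using finK[OF i] by (rule card_image_le)
    finally show ?thesis by simp
  qed
  have "(\<Sum>i<k. card \<B>) \<le> (\<Sum>i<k. card (K i) + 1)" using ge by (intro sum_mono) auto
  then have "k * card \<B> \<le> (\<Sum>i<k. card (K i)) + k" by (simp only: sum.distrib) simp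
  also have "(\<Sum>i<k. card (K i)) = card (\<Union>i<k. K i)"
    using finK disj by (intro card_UN_disjoint[symmetric]) (auto simp: K_def)
  also have "\<dots> \<le> card (Q \<union> B)" using KQB finQB by (intro card_mono) auto
  also have "\<dots> \<le> card Q + card B" by (rule card_Un_le)
  finally show ?thesis using cardF by linarith
qed

section \<open>The bipartite representation\<close>

definition arc_pairs :: "nat \<Rightarrow> (nat, 'b) pre_digraph \<Rightarrow> (nat \<times> nat) set" where
  "arc_pairs n G = (\<lambda>e. (tail G e, n + head G e)) ` arcs G"

text \<open>A forward step leads from the tail side to the head side and a backward step leads back,
  so alternation is what keeps the walk inside the bipartite graph. The first direction determines
  the side on which it starts.\<close>

lemma trail_imp_conn:
  assumes "underlying_walk G x p y" "successively (\<lambda>s s'. fst s \<noteq> fst s') p" "p \<noteq> []" "fst (last p)"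
  shows "(if fst (hd p) then x else n + x, n + y) \<in> conn (arc_pairs n G)"
  using assms
proof (induction p arbitrary: x)
  case (Cons s p)
  obtain d e where s: "s = (d, e)" by fastforce
  have "e \<in> arcs G" using Cons.prems s by simp
  then have edge: "(tail G e, n + head G e) \<in> conn (arc_pairs n G)"
    by (intro conn_edge) (auto simp: arc_pairs_def)
  show ?case
  proof (cases p)
    case Nil
    then show ?thesis using Cons.prems s edge by simp
  next
    case (Cons s' p')
    let ?z = "step_to G s"
    have "(if fst (hd p) then ?z else n + ?z, n + y) \<in> conn (arc_pairs n G)"
      using Cons.IH[of ?z] Cons.prems Cons by simp
    moreover have "fst s' \<noteq> d" using Cons.prems Cons s by simp
    moreover have "step_from G s = x" using Cons.prems by simp
    ultimately show ?thesis
      using s Cons edge conn_sym[OF edge] conn_trans[of _ _ "arc_pairs n G" "n + y"]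
      by (cases d) auto
  qed
qed simp

text \<open>Antistrength directly joins only a tail copy and a head copy of different vertices. Two
  tail copies are joined through the head copy of a third vertex, which is where at least three
  vertices enter; each head copy is then joined to some tail copy.\<close>

lemma antistrong_imp_conn:
  assumes "verts G = {..<n}" "antistrong G"
  shows "{..<2 * n} \<times> {..<2 * n} \<subseteq> conn (arc_pairs n G)"
proof -
  let ?C = "conn (arc_pairs n G)"
  have n: "3 \<le> n" using assms by (simp add: antistrong_def)
  have LR: "(x, n + y) \<in> ?C" if "x < n" "y < n" "x \<noteq> y" for x y
  proof -
    obtain p where "forward_antidirected_trail G x p y"
      using assms \<open>x < n\<close> \<open>y < n\<close> \<open>x \<noteq> y\<close> unfolding antistrong_def by blast
    then show ?thesis using trail_imp_conn[of G x p y n]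
      by (auto simp: forward_antidirected_trail_def antidirected_trail_def)
  qed
  have L: "(x, 0) \<in> ?C" if "x < n" for x
  proof -
    have "card {x, 0} \<le> 2" by (cases "x = 0") auto
    then have "\<exists>y<n. y \<notin> {x, 0}"
      using n card_mono[of "{x, 0}" "{..<n}"] by (auto simp: subset_iff)
    then obtain y where y: "y < n" "y \<noteq> x" "y \<noteq> 0" by blast
    then show ?thesis using LR[of x y] conn_sym[OF LR[of 0 y]] that conn_trans by simp
  qed
  have R: "(n + y, 0) \<in> ?C" if "y < n" for y
  proof -
    have "\<exists>x<n. x \<noteq> y" using n by (intro exI[of _ "if y = 0 then 1 else 0"]) auto
    then obtain x where "x < n" "x \<noteq> y" by blast
    then show ?thesis using conn_trans[OF conn_sym[OF LR[of x y]] L[of x]] that by simp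
  qed
  have all: "(a, 0) \<in> ?C" if "a < 2 * n" for a
    using L[of a] R[of "a - n"] that by (cases "a < n") auto
  show ?thesis using conn_trans[OF all conn_sym[OF all]] by auto
qed

lemma underlying_walk_suffix: "underlying_walk G x (p @ q) y \<Longrightarrow> \<exists>z. underlying_walk G z q y"
  by (induction p arbitrary: x) auto

text \<open>A trail in the bipartite representation: \<open>d\<close> tells on which side the trail starts; it ends
  on the side of the heads.\<close>

definition bip_trail :: "('a, 'b) pre_digraph \<Rightarrow> bool \<Rightarrow> 'a \<Rightarrow> (bool \<times> 'b) list \<Rightarrow> 'a \<Rightarrow> bool" where
  "bip_trail G d x p y \<longleftrightarrow> antidirected_trail G x p y \<and>
     (if p = [] then \<not> d else fst (hd p) = d \<and> fst (last p))"

lemma bip_trail_suffix: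
  assumes "bip_trail G d x (p @ s # q) y"
  shows "bip_trail G (fst s) (step_from G s) (s # q) y"
    and "bip_trail G (\<not> fst s) (step_to G s) q y"
proof -
  have succ: "successively (\<lambda>s s'. fst s \<noteq> fst s') (s # q)" "distinct (map snd (s # q))" "fst (last (s # q))"
    using assms by (auto simp: bip_trail_def antidirected_trail_def successively_append_iff)
  obtain z where z: "underlying_walk G z (s # q) y"
    using assms underlying_walk_suffix by (fastforce simp: bip_trail_def antidirected_trail_def)
  then have "z = step_from G s" by simp
  with z succ show "bip_trail G (fst s) (step_from G s) (s # q) y"
    by (auto simp: bip_trail_def antidirected_trail_def)
  show "bip_trail G (\<not> fst s) (step_to G s) q y"
    using z succ by (cases q) (auto simp: bip_trail_def antidirected_trail_def)
qed

text \<open>If \<open>e\<close> already occurs on \<open>p\<close>, the trail is cut there instead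
  of being extended. If it occurs in direction \<open>d\<close>, the part from \<open>e\<close> on
  starts at the required vertex and side; if in the other direction, the part after \<open>e\<close>
  does.\<close>

lemma bip_trail_extend:
  assumes "e \<in> arcs G" "bip_trail G (\<not> d) (step_to G (d, e)) p y"
  shows "\<exists>q. bip_trail G d (step_from G (d, e)) q y"
proof (cases "e \<in> snd ` set p")
  case False
  then have "bip_trail G d (step_from G (d, e)) ((d, e) # p) y"
    using assms by (cases p) (auto simp: bip_trail_def antidirected_trail_def)
  then show ?thesis by blast
next
  case True
  then obtain d' where "(d', e) \<in> set p" by force
  then obtain p1 p2 where p: "p = p1 @ (d', e) # p2" by (metis split_list)
  have "bip_trail G d' (step_from G (d', e)) ((d', e) # p2) y"
    "bip_trail G (\<not> d') (step_to G (d', e)) p2 y"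
    using bip_trail_suffix[of G "\<not> d" _ p1 "(d', e)" p2 y] assms(2) p by auto
  then show ?thesis by (cases "d' = d"; cases d) auto
qed

text \<open>The path is read from its end: the empty trail stands for the head copy of
  \<open>y\<close>, and earlier edges are put in front one at a time. A node \<open>a\<close> is on
  the tail side iff \<open>a < n\<close>.\<close>

lemma conn_imp_trail:
  assumes "(a, n + y) \<in> conn (arc_pairs n G)" "wf_digraph G" "verts G = {..<n}" "y < n"
  shows "\<exists>p. bip_trail G (a < n) (if a < n then a else a - n) p y"
proof -
  interpret wf_digraph G by fact
  from assms(1) have "(a, n + y) \<in> (arc_pairs n G \<union> (arc_pairs n G)\<inverse>)\<^sup>*" by (simp add: conn_def)
  then show ?thesis
  proof (induction rule: converse_rtrancl_induct)
    case base
    have "bip_trail G False y [] y"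
      using assms(3,4) by (simp add: bip_trail_def antidirected_trail_def)
    then show ?case by auto
  next
    case (step a b)
    from step.hyps(1) obtain e where e: "e \<in> arcs G"
      "a = tail G e \<and> b = n + head G e \<or> b = tail G e \<and> a = n + head G e"
      by (auto simp: arc_pairs_def)
    have "tail G e < n" using tail_in_verts[OF e(1)] assms(3) by simp
    then show ?case using e(2) step.IH bip_trail_extend[OF e(1), of True] bip_trail_extend[OF e(1), of False]
      by auto
  qed
qed

lemma conn_imp_antistrong:
  assumes "wf_digraph G" "verts G = {..<n}" "3 \<le> n" "{..<2 * n} \<times> {..<2 * n} \<subseteq> conn (arc_pairs n G)"
  shows "antistrong G"
proof -
  have "\<exists>p. forward_antidirected_trail G x p y" if "x < n" "y < n" for x y
  proof -
    have "(x, n + y) \<in> conn (arc_pairs n G)" using assms(4) that by auto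
    then have "\<exists>p. bip_trail G (x < n) (if x < n then x else x - n) p y"
      using assms(1,2) that(2) by (intro conn_imp_trail)
    with that(1) obtain p where "bip_trail G True x p y" by auto
    then show ?thesis
      by (auto simp: bip_trail_def forward_antidirected_trail_def split: if_splits)
  qed
  then show ?thesis using assms(2,3) by (simp add: antistrong_def)
qed

definition bip_pairs :: "nat \<Rightarrow> (nat \<times> nat) set \<Rightarrow> (nat \<times> nat) set" where
  "bip_pairs n A = (\<lambda>(u, v). (u, n + v)) ` A"

lemma inj_bip: "inj (\<lambda>(u, v). (u, n + v :: nat))"
  by (auto simp: inj_on_def)

lemma add_new_arcs_digraph_of:
  "verts (add_new_arcs (digraph_of n es) B) = {..<n}"
  "arcs (add_new_arcs (digraph_of n es) B) = {..<length es} <+> B"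
  "arc_to_ends (add_new_arcs (digraph_of n es) B) = case_sum (nth es) id"
  by (auto simp: add_new_arcs_def digraph_of_def arc_to_ends_def fun_eq_iff split: sum.splits)

lemma arc_pairs_eq: "arc_pairs n G = bip_pairs n (arc_to_ends G ` arcs G)"
  by (auto simp: arc_pairs_def bip_pairs_def arc_to_ends_def image_image)

lemma image_ends_add_new_arcs:
  "arc_to_ends (add_new_arcs (digraph_of n es) B) ` arcs (add_new_arcs (digraph_of n es) B) = set es \<union> B"
  unfolding add_new_arcs_digraph_of by (auto simp: Plus_def image_Un image_image set_conv_nth)

text \<open>Without parallel arcs \<open>arc_to_ends\<close> is injective, so vertex pairs determine
  arcs and arc-disjoint subdigraphs yield disjoint sets of pairs.\<close>

lemma admissible_imp_conn:
  assumes "admissible_augmentation k (digraph_of n es) B"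
  shows "distinct es" "finite B" "set es \<union> B \<subseteq> {..<n} \<times> {..<n}" "\<forall>(u, v) \<in> set es \<union> B. u \<noteq> v"
    "\<exists>H. (\<forall>i<k. H i \<subseteq> bip_pairs n (set es \<union> B) \<and> {..<2 * n} \<times> {..<2 * n} \<subseteq> conn (H i)) \<and>
      (\<forall>i<k. \<forall>j<k. i \<noteq> j \<longrightarrow> H i \<inter> H j = {})"
proof -
  let ?G = "add_new_arcs (digraph_of n es) B"
  interpret digraph ?G using assms by (simp add: admissible_augmentation_def)
  note G = add_new_arcs_digraph_of[of n es B]
  have inj: "inj_on (arc_to_ends ?G) (arcs ?G)" using no_multi_arcs by (auto simp: inj_on_def)
  show "distinct es"
    unfolding distinct_conv_nth
  proof (intro allI impI notI)
    fix i j assume "i < length es" "j < length es" "i \<noteq> j" "es ! i = es ! j"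
    then show False using inj_onD[OF inj, of "Inl i" "Inl j"] by (auto simp: G)
  qed
  show "finite B" using finite_arcs unfolding G(2) by (simp add: finite_Plus_iff)
  have ends: "arc_to_ends ?G e \<in> {..<n} \<times> {..<n}" "fst (arc_to_ends ?G e) \<noteq> snd (arc_to_ends ?G e)" if "e \<in> arcs ?G" for e
    using that tail_in_verts[OF that] head_in_verts[OF that] no_loops[OF that] G(1)
    by (auto simp: arc_to_ends_def)
  then show "set es \<union> B \<subseteq> {..<n} \<times> {..<n}" "\<forall>(u, v) \<in> set es \<union> B. u \<noteq> v"
    unfolding image_ends_add_new_arcs[of n es B, symmetric] by force+
  obtain H where H: "\<And>i. i < k \<Longrightarrow> spanning (H i) ?G \<and> antistrong (H i)"
      "\<And>i j. i < k \<Longrightarrow> j < k \<Longrightarrow> i \<noteq> j \<Longrightarrow> arcs (H i) \<inter> arcs (H j) = {}"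
    using assms unfolding admissible_augmentation_def has_disjoint_antistrong_spanning_def by metis
  have ap: "arc_pairs n (H i) = bip_pairs n (arc_to_ends ?G ` arcs (H i))" "arcs (H i) \<subseteq> arcs ?G"
    "verts (H i) = {..<n}" if "i < k" for i
    using H(1)[OF that] G(1)
    by (auto simp: spanning_def subgraph_def compatible_def arc_pairs_eq arc_to_ends_def)
  show "\<exists>H. (\<forall>i<k. H i \<subseteq> bip_pairs n (set es \<union> B) \<and> {..<2 * n} \<times> {..<2 * n} \<subseteq> conn (H i)) \<and>
      (\<forall>i<k. \<forall>j<k. i \<noteq> j \<longrightarrow> H i \<inter> H j = {})"
  proof (intro exI conjI allI impI)
    fix i assume i: "i < k"
    show "arc_pairs n (H i) \<subseteq> bip_pairs n (set es \<union> B)"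
      unfolding ap(1)[OF i] image_ends_add_new_arcs[of n es B, symmetric] bip_pairs_def
      by (intro image_mono ap(2)[OF i])
    show "{..<2 * n} \<times> {..<2 * n} \<subseteq> conn (arc_pairs n (H i))"
      using antistrong_imp_conn ap(3)[OF i] H(1)[OF i] by blast
    fix j assume j: "j < k" "i \<noteq> j"
    have "arc_to_ends ?G ` arcs (H i) \<inter> arc_to_ends ?G ` arcs (H j) = {}"
      using inj_on_image_Int[OF inj ap(2)[OF i] ap(2)[OF j(1)]] H(2)[OF i j] by simp
    then show "arc_pairs n (H i) \<inter> arc_pairs n (H j) = {}"
      unfolding ap(1)[OF i] ap(1)[OF j(1)] bip_pairs_def
      by (simp add: image_Int[OF inj_bip, symmetric])
  qed
qed

lemma conn_imp_admissible:
  fixes H :: "nat \<Rightarrow> (nat \<times> nat) set"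
  assumes "3 \<le> n" "distinct es" "finite B" "set es \<union> B \<subseteq> {..<n} \<times> {..<n}" "set es \<inter> B = {}"
    "\<And>u v. (u, v) \<in> set es \<union> B \<Longrightarrow> u \<noteq> v"
    and H: "\<And>i. i < k \<Longrightarrow> H i \<subseteq> bip_pairs n (set es \<union> B)"
      "\<And>i. i < k \<Longrightarrow> {..<2 * n} \<times> {..<2 * n} \<subseteq> conn (H i)"
      "\<And>i j. i < k \<Longrightarrow> j < k \<Longrightarrow> i \<noteq> j \<Longrightarrow> H i \<inter> H j = {}"
  shows "admissible_augmentation k (digraph_of n es) B"
proof -
  let ?G = "add_new_arcs (digraph_of n es) B"
  note G = add_new_arcs_digraph_of[of n es B]
  have ends: "arc_to_ends ?G e \<in> set es \<union> B" if "e \<in> arcs ?G" for e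
    using that image_ends_add_new_arcs[of n es B] by blast
  have te: "tail ?G e = fst (arc_to_ends ?G e)" "head ?G e = snd (arc_to_ends ?G e)" for e
    by (auto simp: arc_to_ends_def)
  have tail: "tail ?G e < n" and head: "head ?G e < n" and loop: "tail ?G e \<noteq> head ?G e" if "e \<in> arcs ?G" for e
    using ends[OF that] assms(4) assms(6)[of "tail ?G e" "head ?G e"] unfolding te by auto
  have multi: "e = f" if "e \<in> arcs ?G" "f \<in> arcs ?G" "arc_to_ends ?G e = arc_to_ends ?G f" for e f
  proof (cases e; cases f)
    fix i j assume "e = Inl i" "f = Inl j"
    then show ?thesis using that assms(2) by (auto simp: G nth_eq_iff_index_eq)
  next
    fix i b assume "e = Inl i" "f = Inr b"
    then have "i < length es" "es ! i \<in> B" using that by (auto simp: G)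
    then show ?thesis using assms(5) nth_mem by blast
  next
    fix i b assume "e = Inr b" "f = Inl i"
    then have "i < length es" "es ! i \<in> B" using that by (auto simp: G)
    then show ?thesis using assms(5) nth_mem by blast
  qed (use that in \<open>simp add: G\<close>)
  interpret digraph ?G
    by unfold_locales (use tail head loop multi assms(3) in \<open>auto simp: G(1,2)\<close>)
  define K where "K i = ?G\<lparr>arcs := {e \<in> arcs ?G. (tail ?G e, n + head ?G e) \<in> H i}\<rparr>" for i
  have wf: "wf_digraph (K i)" for i
    by unfold_locales (auto simp: K_def)
  have "spanning (K i) ?G" for i
    using wf[of i] wf_digraph by (auto simp: spanning_def subgraph_def compatible_def K_def)
  moreover have "antistrong (K i)" if "i < k" for i
  proof (rule conn_imp_antistrong[OF wf _ assms(1)])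
    have "H i \<subseteq> arc_pairs n ?G" using H(1)[OF that] by (simp add: arc_pairs_eq image_ends_add_new_arcs)
    then have "arc_pairs n (K i) = H i" by (auto simp: arc_pairs_def K_def)
    then show "{..<2 * n} \<times> {..<2 * n} \<subseteq> conn (arc_pairs n (K i))" using H(2)[OF that] by simp
  qed (simp add: K_def G)
  moreover have "arcs (K i) \<inter> arcs (K j) = {}" if "i < k" "j < k" "i \<noteq> j" for i j
    using H(3)[OF that] by (auto simp: K_def)
  ultimately have "has_disjoint_antistrong_spanning k ?G"
    unfolding has_disjoint_antistrong_spanning_def by blast
  moreover have "digraph ?G" by unfold_locales
  ultimately show ?thesis by (simp add: admissible_augmentation_def)
qed

section \<open>Running times of programs\<close>

fun writes :: "com \<Rightarrow> vname set" where
  "writes Skip = {}"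
| "writes (Assign x e f) = {x}"
| "writes (Seq c d) = writes c \<union> writes d"
| "writes (If e c d) = writes c \<union> writes d"
| "writes (While e c) = writes c"

lemma runs_frame: "runs c s t s' \<Longrightarrow> x \<notin> writes c \<Longrightarrow> s' x = s x"
  by (induction rule: runs.induct) auto

text \<open>As \<open>runs\<close> is deterministic, the existence of such a run describes the only
  run there is.\<close>

definition terminates :: "com \<Rightarrow> state \<Rightarrow> nat \<Rightarrow> (state \<Rightarrow> bool) \<Rightarrow> bool" where
  "terminates c s b Q \<longleftrightarrow> (\<exists>t s'. runs c s t s' \<and> t \<le> b \<and> Q s')"

lemma terminates_frame:
  assumes "terminates c s b Q"
    and "\<And>s'. (\<And>x. x \<notin> writes c \<Longrightarrow> s' x = s x) \<Longrightarrow> Q s' \<Longrightarrow> R s'" and "b \<le> b'"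
  shows "terminates c s b' R"
  using assms runs_frame unfolding terminates_def by (meson le_trans)

lemma terminates_mono:
  assumes "terminates c s b Q" "\<And>s'. Q s' \<Longrightarrow> R s'" "b \<le> b'"
  shows "terminates c s b' R"
  using terminates_frame assms by blast

lemma terminates_Seq:
  assumes "terminates c s b (\<lambda>s'. terminates d s' b' Q)"
  shows "terminates (Seq c d) s (b + b') Q"
  using assms unfolding terminates_def by (meson runs.Seq add_mono)

text \<open>The bounds of the branches are added rather than compared, so that all time bounds are
  built from sums and products alone.\<close>

lemma terminates_If:
  assumes "val e s \<noteq> 0 \<Longrightarrow> terminates c s b Q" "val e s = 0 \<Longrightarrow> terminates d s b' Q"
  shows "terminates (If e c d) s (1 + cost e + b + b') Q"
proof (cases "val e s = 0")
  case True
  then obtain t s' where "runs d s t s'" "t \<le> b'" "Q s'" using assms(2) by (auto simp: terminates_def)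
  then show ?thesis using runs.IfFalse[OF True] unfolding terminates_def
    by (intro exI[of _ "1 + cost e + t"] exI[of _ s']) auto
next
  case False
  then obtain t s' where "runs c s t s'" "t \<le> b" "Q s'" using assms(1) by (auto simp: terminates_def)
  then show ?thesis using runs.IfTrue[OF False] unfolding terminates_def
    by (intro exI[of _ "1 + cost e + t"] exI[of _ s']) auto
qed

text \<open>The measure bounds the number of rounds; the additional \<open>1\<close> pays for the
  final, failing test.\<close>

lemma terminates_While:
  fixes \<mu> :: "state \<Rightarrow> nat"
  assumes "I s"
    and "\<And>s. I s \<Longrightarrow> val e s \<noteq> 0 \<Longrightarrow> terminates c s b (\<lambda>s'. I s' \<and> \<mu> s' < \<mu> s)"
  shows "terminates (While e c) s ((\<mu> s + 1) * (1 + cost e + b)) (\<lambda>s'. I s' \<and> val e s' = 0)"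
  using assms(1)
proof (induction "\<mu> s" arbitrary: s rule: less_induct)
  case less
  show ?case
  proof (cases "val e s = 0")
    case True
    then show ?thesis using less.prems runs.WhileFalse[OF True]
      unfolding terminates_def by (intro exI[of _ "1 + cost e"] exI[of _ s]) auto
  next
    case False
    then obtain t s' where s': "runs c s t s'" "t \<le> b" "I s'" "\<mu> s' < \<mu> s"
      using assms(2) less.prems unfolding terminates_def by metis
    then obtain t' s'' where s'': "runs (While e c) s' t' s''"
        "t' \<le> (\<mu> s' + 1) * (1 + cost e + b)" "I s''" "val e s'' = 0"
      using less.hyps[of s'] unfolding terminates_def by metis
    have "(\<mu> s' + 1) * (1 + cost e + b) \<le> \<mu> s * (1 + cost e + b)"
      using s'(4) by (intro mult_right_mono) auto
    then have "1 + cost e + t + t' \<le> (\<mu> s + 1) * (1 + cost e + b)"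
      using s'(2) s''(2) by simp
    then show ?thesis using runs.WhileTrue[OF False s'(1) s''(1)] s''(3,4)
      unfolding terminates_def by blast
  qed
qed

text \<open>\<open>sem\<close> and \<open>time\<close> are junk on loops.\<close>

fun loop_free :: "com \<Rightarrow> bool" where
  "loop_free (Seq c d) \<longleftrightarrow> loop_free c \<and> loop_free d"
| "loop_free (If e c d) \<longleftrightarrow> loop_free c \<and> loop_free d"
| "loop_free (While e c) \<longleftrightarrow> False"
| "loop_free c \<longleftrightarrow> True"

fun sem :: "com \<Rightarrow> state \<Rightarrow> state" where
  "sem Skip s = s"
| "sem (Assign x e f) s = s(x := (s x)(val e s := val f s))"
| "sem (Seq c d) s = sem d (sem c s)"
| "sem (If e c d) s = (if val e s \<noteq> 0 then sem c s else sem d s)"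
| "sem (While e c) s = s"

fun time :: "com \<Rightarrow> nat" where
  "time Skip = 1"
| "time (Assign x e f) = 1 + cost e + cost f"
| "time (Seq c d) = time c + time d"
| "time (If e c d) = 1 + cost e + time c + time d"
| "time (While e c) = 0"

lemma terminates_sem: "loop_free c \<Longrightarrow> terminates c s (time c) (\<lambda>s'. s' = sem c s)"
proof (induction c arbitrary: s)
  case (Seq c d)
  then show ?case
    using terminates_Seq[OF terminates_mono[OF Seq.IH(1), of s _ "time c"], of d "time d" "\<lambda>s'. s' = sem d (sem c s)"]
    by simp
next
  case (If e c d)
  then show ?case using terminates_If[of e s c "time c" _ d "time d"] by simp
next
  case Skip
  then show ?case using runs.Skip by (auto simp: terminates_def)
next
  case (Assign x e f)
  show ?case unfolding terminates_def time.simps sem.simps using runs.Assign by blast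
qed simp

lemma terminates_loop_free:
  assumes "loop_free c" "Q (sem c s)" "time c \<le> b"
  shows "terminates c s b Q"
  using terminates_mono[OF terminates_sem[OF assms(1)]] assms(2,3) by blast

section \<open>The pebble game\<close>

text \<open>\<open>P i\<close> and \<open>Q i\<close> are the start and the end of the edge
  \<open>e i\<close> in the current orientation, so the last clause says that the pebbles on a
  vertex and its outdegree add up to \<open>k\<close>. Edges are indexed by their position in the
  list of candidates.\<close>

definition pebbling ::
  "nat \<Rightarrow> nat \<Rightarrow> nat set \<Rightarrow> (nat \<Rightarrow> nat \<times> nat) \<Rightarrow> (nat \<Rightarrow> nat) \<Rightarrow> (nat \<Rightarrow> nat) \<Rightarrow> (nat \<Rightarrow> nat) \<Rightarrow> bool" where
  "pebbling N k I e P Q peb \<longleftrightarrow> finite I \<and> inj_on e I \<and>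
     (\<forall>i\<in>I. P i < N \<and> Q i < N \<and> {P i, Q i} = {fst (e i), snd (e i)}) \<and>
     (\<forall>v<N. peb v + card {i \<in> I. P i = v} = k)"

lemma pebbling_sum:
  assumes "pebbling N k I e P Q peb" "X \<subseteq> {..<N}"
  shows "(\<Sum>x\<in>X. peb x) + card {i \<in> I. P i \<in> X} = k * card X"
proof -
  have fin: "finite I" "finite X" using assms finite_subset by (auto simp: pebbling_def)
  have "{i \<in> I. P i \<in> X} = (\<Union>x\<in>X. {i \<in> I. P i = x})" by auto
  also have "card \<dots> = (\<Sum>x\<in>X. card {i \<in> I. P i = x})"
    using fin by (intro card_UN_disjoint) auto
  finally have "(\<Sum>x\<in>X. peb x) + card {i \<in> I. P i \<in> X} = (\<Sum>x\<in>X. peb x + card {i \<in> I. P i = x})"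
    by (simp add: sum.distrib)
  also have "\<dots> = (\<Sum>x\<in>X. k)"
    using assms by (intro sum.cong) (auto simp: pebbling_def)
  finally show ?thesis by simp
qed

lemma pebbling_card_induced:
  assumes "pebbling N k I e P Q peb"
  shows "card (e ` I \<inter> X \<times> X) = card {i \<in> I. P i \<in> X \<and> Q i \<in> X}"
proof -
  have "P i \<in> X \<and> Q i \<in> X \<longleftrightarrow> e i \<in> X \<times> X" if "i \<in> I" for i
  proof -
    have "{P i, Q i} = {fst (e i), snd (e i)}" using assms that by (simp add: pebbling_def)
    then have "{P i, Q i} \<subseteq> X \<longleftrightarrow> {fst (e i), snd (e i)} \<subseteq> X" by simp
    then show ?thesis by (simp add: mem_Times_iff)
  qed
  then have "{i \<in> I. P i \<in> X \<and> Q i \<in> X} = {i \<in> I. e i \<in> X \<times> X}"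
    by (intro Collect_cong conj_cong refl)
  moreover have "e ` I \<inter> Y = e ` {i \<in> I. e i \<in> Y}" for Y by auto
  ultimately have "e ` I \<inter> X \<times> X = e ` {i \<in> I. P i \<in> X \<and> Q i \<in> X}" by simp
  moreover have "inj_on e {i \<in> I. P i \<in> X \<and> Q i \<in> X}"
    using assms by (auto simp: pebbling_def inj_on_def)
  ultimately show ?thesis by (simp add: card_image)
qed

text \<open>No edge leaves \<open>X\<close>, so the edges starting in \<open>X\<close> are exactly
  the induced ones. They number \<open>k * card X\<close> minus the pebbles in \<open>X\<close>,
  which are at most \<open>k\<close>; sparsity gives the opposite inequality.\<close>

lemma pebbling_stuck_tight:
  assumes peb: "pebbling N k I e P Q peb" and "sparse k {..<N} (e ` I)"
    and X: "X \<subseteq> {..<N}" "u \<in> X" "v \<in> X" "u \<noteq> v"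
    and closed: "\<And>i. i \<in> I \<Longrightarrow> P i \<in> X \<Longrightarrow> Q i \<in> X"
    and zero: "\<And>x. x \<in> X \<Longrightarrow> x \<noteq> u \<Longrightarrow> x \<noteq> v \<Longrightarrow> peb x = 0"
    and le: "peb u + peb v \<le> k"
  shows "tight k (e ` I) X"
proof -
  have "finite X" using X(1) finite_subset by blast
  then have "(\<Sum>x\<in>X. peb x) = (\<Sum>x\<in>{u, v}. peb x)"
    using X zero by (intro sum.mono_neutral_right) auto
  moreover have "{i \<in> I. P i \<in> X} = {i \<in> I. P i \<in> X \<and> Q i \<in> X}" using closed by auto
  ultimately have "peb u + peb v + card (e ` I \<inter> X \<times> X) = k * card X"
    using pebbling_sum[OF peb X(1)] pebbling_card_induced[OF peb, of X] X(4) by simp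
  moreover have "card (e ` I \<inter> X \<times> X) + k \<le> k * card X"
    using assms(2) X by (auto simp: sparse_def)
  ultimately show ?thesis using le by (simp add: tight_def)
qed

text \<open>If \<open>X\<close> contains both ends, their more than \<open>k\<close> pebbles leave
  fewer than \<open>k * card X - k + 1\<close> edges starting in \<open>X\<close>, which leaves room
  for one more edge under the bound.\<close>

lemma pebbling_insert_sparse:
  assumes peb: "pebbling N k I e P Q peb" and sp: "sparse k {..<N} (e ` I)"
    and uv: "u < N" "v < N" "u \<noteq> v" "k < peb u + peb v"
  shows "sparse k {..<N} (insert (u, v) (e ` I))"
  unfolding sparse_def
proof (intro conjI allI impI)
  show "insert (u, v) (e ` I) \<subseteq> {..<N} \<times> {..<N}"
    using sp uv by (auto simp: sparse_def)
  fix X assume X: "X \<subseteq> {..<N}" "X \<noteq> {}"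
  have finI: "finite I" using peb by (simp add: pebbling_def)
  show "card (insert (u, v) (e ` I) \<inter> X \<times> X) + k \<le> k * card X"
  proof (cases "u \<in> X \<and> v \<in> X")
    case True
    have "finite X" using X(1) finite_subset by blast
    then have "(\<Sum>x\<in>{u, v}. peb x) \<le> (\<Sum>x\<in>X. peb x)"
      using True by (intro sum_mono2) auto
    moreover have "card {i \<in> I. P i \<in> X \<and> Q i \<in> X} \<le> card {i \<in> I. P i \<in> X}"
      using finI by (intro card_mono) auto
    ultimately have "peb u + peb v + card (e ` I \<inter> X \<times> X) \<le> k * card X"
      using pebbling_sum[OF peb X(1)] pebbling_card_induced[OF peb, of X] uv(3) by simp
    moreover have "card (insert (u, v) (e ` I) \<inter> X \<times> X) \<le> card (insert (u, v) (e ` I \<inter> X \<times> X))"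
      using finI by (intro card_mono) auto
    moreover have "card (insert (u, v) (e ` I \<inter> X \<times> X)) \<le> Suc (card (e ` I \<inter> X \<times> X))"
      by (rule card_insert_le_m1) auto
    \<comment> \<open>The strict inequality \<open>k < peb u + peb v\<close> supplies the one unit
      consumed by the new edge.\<close>
    ultimately show ?thesis using uv(4) by linarith
  next
    case False
    then have "insert (u, v) (e ` I) \<inter> X \<times> X = e ` I \<inter> X \<times> X" by auto
    then show ?thesis using sp X by (simp add: sparse_def)
  qed
qed

lemma pebbling_insert:
  assumes peb: "pebbling N k I e P Q peb" and "j \<notin> I" "e j \<notin> e ` I"
    and ab: "{a, b} = {fst (e j), snd (e j)}" "a < N" "b < N" "peb a > 0"
  shows "pebbling N k (insert j I) e (P(j := a)) (Q(j := b)) (peb(a := peb a - 1))"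
proof -
  have fin: "finite I" and out: "\<And>v. v < N \<Longrightarrow> peb v + card {i \<in> I. P i = v} = k"
    using peb by (auto simp: pebbling_def)
  have "(peb(a := peb a - 1)) v + card {i \<in> insert j I. (P(j := a)) i = v} = k" if "v < N" for v
  proof -
    have "{i \<in> insert j I. (P(j := a)) i = v} = (if v = a then insert j {i \<in> I. P i = v} else {i \<in> I. P i = v})"
      using assms(2) by auto
    then show ?thesis using out[OF that] assms(2) fin ab(4) by auto
  qed
  moreover have "inj_on e (insert j I)"
    using peb assms(2,3) by (auto simp: pebbling_def)
  ultimately show ?thesis using peb assms(2) ab fin by (auto simp: pebbling_def)
qed

text \<open>Reversing an edge lowers the outdegree of its start and raises that of its end by one,
  so a pebble passes from the end to the start.\<close>

lemma pebbling_flip: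
  assumes peb: "pebbling N k I e P Q peb" and i: "i \<in> I" "P i \<noteq> Q i" "peb (Q i) > 0"
  shows "pebbling N k I e (P(i := Q i)) (Q(i := P i)) (peb(Q i := peb (Q i) - 1, P i := peb (P i) + 1))"
proof -
  have fin: "finite I" and out: "\<And>v. v < N \<Longrightarrow> peb v + card {i \<in> I. P i = v} = k"
    using peb by (auto simp: pebbling_def)
  have "(peb(Q i := peb (Q i) - 1, P i := peb (P i) + 1)) v + card {i' \<in> I. (P(i := Q i)) i' = v} = k" if "v < N" for v
  proof -
    have "{i' \<in> I. (P(i := Q i)) i' = v} =
        (if v = Q i then insert i {i' \<in> I. P i' = v} else {i' \<in> I. P i' = v} - {i})"
      using i by auto
    then show ?thesis using out[OF that] fin i card_Suc_Diff1[of "{i' \<in> I. P i' = v}" i]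
      by (auto simp: card_Diff_singleton_if)
  qed
  then show ?thesis using peb i by (auto simp: pebbling_def insert_commute)
qed

lemma pebbling_le: "pebbling N k I e P Q peb \<Longrightarrow> v < N \<Longrightarrow> peb v \<le> k"
  by (metis le_add1 pebbling_def)

text \<open>A vertex lacks at most one pebble per edge, whatever \<open>k\<close> is. This keeps the
  number of searches independent of \<open>k\<close>.\<close>

lemma pebbling_ge:
  assumes "pebbling N k I e P Q peb" "v < N" "I \<subseteq> {..<j}"
  shows "k \<le> peb v + j"
proof -
  have "card {i \<in> I. P i = v} \<le> card {..<j}" using assms(3) by (intro card_mono) auto
  moreover have "peb v + card {i \<in> I. P i = v} = k" using assms by (simp add: pebbling_def)
  ultimately show ?thesis by simp
qed

text \<open>A tight set has no room for further edges, so a rejection stays justified while the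
  sparse set grows.\<close>

lemma tight_mono:
  assumes "tight k F X" "F \<subseteq> F'" "finite V" "sparse k V F'" "X \<subseteq> V" "X \<noteq> {}"
  shows "tight k F' X"
proof -
  have "finite F'" using assms(3,4) finite_subset by (fastforce simp: sparse_def)
  then have "card (F \<inter> X \<times> X) \<le> card (F' \<inter> X \<times> X)" using assms(2) by (intro card_mono) auto
  moreover have "card (F' \<inter> X \<times> X) + k \<le> k * card X" using assms by (simp add: sparse_def)
  ultimately show ?thesis using assms(1) by (simp add: tight_def)
qed

section \<open>The algorithm\<close>

abbreviation Var :: "vname \<Rightarrow> expr" where
  "Var x \<equiv> Elem x (Const 0)"

abbreviation Set :: "vname \<Rightarrow> expr \<Rightarrow> com" where
  "Set x e \<equiv> Assign x (Const 0) e"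

abbreviation Incr :: "vname \<Rightarrow> com" where
  "Incr x \<equiv> Set x (Plus (Var x) (Const 1))"

notation Seq (infixr ";;" 60)

text \<open>With truncated subtraction, \<open>mark x - base\<close> is nonzero iff \<open>x\<close>
  is marked. When an accepted edge leads out of the marked set, its end is marked and the sweep
  restarts at \<open>0\<close>; if that end holds a pebble, setting \<open>i\<close> to
  \<open>j\<close> ends the loop instead.\<close>

definition scan_step :: com where
  "scan_step =
     If (Elem ''acc'' (Var ''i''))
       (If (Minus (Elem ''mark'' (Elem ''P'' (Var ''i''))) (Var ''base''))
         (If (Minus (Elem ''mark'' (Elem ''Q'' (Var ''i''))) (Var ''base''))
           (Incr ''i'')
           (Incr ''cnt'';;
            Assign ''mark'' (Elem ''Q'' (Var ''i'')) (Var ''cnt'');;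
            Assign ''par'' (Elem ''Q'' (Var ''i'')) (Var ''i'');;
            If (Elem ''peb'' (Elem ''Q'' (Var ''i'')))
              (Set ''found'' (Const 1);; Set ''w'' (Elem ''Q'' (Var ''i''));; Set ''i'' (Var ''j''))
              (Set ''i'' (Const 0))))
         (Incr ''i''))
       (Incr ''i'')"

definition search_init :: com where
  "search_init =
     Set ''base'' (Var ''cnt'');; Incr ''cnt'';;
     Assign ''mark'' (Var ''u'') (Var ''cnt'');; Assign ''mark'' (Var ''v'') (Var ''cnt'');;
     Set ''found'' (Const 0);; Set ''i'' (Const 0)"

definition scan :: com where
  "scan = While (Minus (Var ''j'') (Var ''i'')) scan_step"

text \<open>\<open>w\<close> holds a free pebble, and \<open>par w\<close> is the edge by which the
  search reached \<open>w\<close>. Its reversal passes the pebble to its start, one step closer to a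
  root.\<close>

definition flip_step :: com where
  "flip_step =
     Set ''i'' (Elem ''par'' (Var ''w''));; Set ''x'' (Elem ''P'' (Var ''i''));;
     Assign ''P'' (Var ''i'') (Var ''w'');; Assign ''Q'' (Var ''i'') (Var ''x'');;
     Assign ''peb'' (Var ''w'') (Minus (Elem ''peb'' (Var ''w'')) (Const 1));;
     Assign ''peb'' (Var ''x'') (Plus (Elem ''peb'' (Var ''x'')) (Const 1));;
     Set ''w'' (Var ''x'')"

text \<open>Among the marked vertices only the two roots carry the stamp \<open>base + 1\<close>, so
  the loop stops when the pebble has arrived at one of them.\<close>

definition flip :: com where
  "flip = While (Minus (Elem ''mark'' (Var ''w'')) (Plus (Var ''base'') (Const 1))) flip_step"

text \<open>The two ends hold more than \<open>k\<close> pebbles together, so if \<open>u\<close>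
  has none, then \<open>v\<close> can pay for the edge. Positions from \<open>m\<close> on are not
  arcs of the input and go to the output.\<close>

definition accept :: com where
  "accept =
     Set ''go'' (Const 0);; Assign ''acc'' (Var ''j'') (Const 1);;
     Set ''free'' (Minus (Var ''free'') (Const 1));;
     If (Elem ''peb'' (Var ''u''))
       (Assign ''P'' (Var ''j'') (Var ''u'');; Assign ''Q'' (Var ''j'') (Var ''v'');;
        Assign ''peb'' (Var ''u'') (Minus (Elem ''peb'' (Var ''u'')) (Const 1)))
       (Assign ''P'' (Var ''j'') (Var ''v'');; Assign ''Q'' (Var ''j'') (Var ''u'');;
        Assign ''peb'' (Var ''v'') (Minus (Elem ''peb'' (Var ''v'')) (Const 1)));;
     If (Minus (Var ''m'') (Var ''j'')) Skip
       (Assign ''newtail'' (Var ''newcount'') (Elem ''tail'' (Var ''j''));;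
        Assign ''newhead'' (Var ''newcount'') (Elem ''head'' (Var ''j''));;
        Incr ''newcount'')"

definition gather_step :: com where
  "gather_step =
     If (Minus (Plus (Elem ''peb'' (Var ''u'')) (Elem ''peb'' (Var ''v''))) (Var ''k''))
       accept
       (search_init;; scan;; If (Var ''found'') flip (Set ''go'' (Const 0)))"

definition gather :: com where
  "gather = While (Var ''go'') gather_step"

text \<open>Every search starts by raising \<open>base\<close> to the largest stamp in use, so that the marks of earlier
  searches need not be erased: \<open>x\<close> is marked iff \<open>base < mark x\<close>. The stamps decrease towards
  the two roots.\<close>

definition search_forest ::
  "nat \<Rightarrow> nat set \<Rightarrow> (nat \<Rightarrow> nat) \<Rightarrow> (nat \<Rightarrow> nat) \<Rightarrow> nat \<Rightarrow> nat \<Rightarrow> nat \<Rightarrow> (nat \<Rightarrow> nat) \<Rightarrow> (nat \<Rightarrow> nat) \<Rightarrow> nat \<Rightarrow> bool"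
where
  "search_forest N I P Q u v base mark par b \<longleftrightarrow> mark u = base + 1 \<and> mark v = base + 1 \<and>
     (\<forall>x<N. base < mark x \<longrightarrow> mark x \<le> b \<longrightarrow> x \<noteq> u \<longrightarrow> x \<noteq> v \<longrightarrow>
        par x \<in> I \<and> Q (par x) = x \<and> base < mark (P (par x)) \<and> mark (P (par x)) < mark x)"

section \<open>Searching for a free pebble and moving it to a root\<close>

definition scan_inv ::
  "nat \<Rightarrow> nat \<Rightarrow> (nat \<Rightarrow> nat) \<Rightarrow> (nat \<Rightarrow> nat) \<Rightarrow> (nat \<Rightarrow> nat) \<Rightarrow> (nat \<Rightarrow> nat) \<Rightarrow> nat \<Rightarrow> nat \<Rightarrow> nat \<Rightarrow> state \<Rightarrow> bool"
where
  "scan_inv N j acc P Q peb u v base s \<longleftrightarrow>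
     s ''j'' 0 = j \<and> s ''acc'' = acc \<and> s ''P'' = P \<and> s ''Q'' = Q \<and> s ''peb'' = peb \<and> s ''base'' 0 = base \<and>
     (\<forall>x. s ''mark'' x \<le> s ''cnt'' 0) \<and> base < s ''cnt'' 0 \<and> s ''i'' 0 \<le> j \<and>
     search_forest N {i. i < j \<and> acc i \<noteq> 0} P Q u v base (s ''mark'') (s ''par'') (s ''cnt'' 0) \<and>
     (if s ''found'' 0 = 0 then
        (\<forall>i<s ''i'' 0. acc i \<noteq> 0 \<longrightarrow> base < s ''mark'' (P i) \<longrightarrow> base < s ''mark'' (Q i)) \<and>
        (\<forall>x<N. base < s ''mark'' x \<longrightarrow> x \<noteq> u \<longrightarrow> x \<noteq> v \<longrightarrow> peb x = 0)
      else s ''i'' 0 = j \<and> s ''w'' 0 < N \<and> base < s ''mark'' (s ''w'' 0) \<and>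
        s ''w'' 0 \<noteq> u \<and> s ''w'' 0 \<noteq> v \<and> 0 < peb (s ''w'' 0))"

text \<open>Lexicographic in the number of unmarked vertices and the rest of the sweep: marking a
  vertex gains \<open>j + 1\<close>, and the restart gives back at most \<open>j\<close>.\<close>

definition scan_measure :: "nat \<Rightarrow> nat \<Rightarrow> nat \<Rightarrow> state \<Rightarrow> nat" where
  "scan_measure N j base s = card {x. x < N \<and> s ''mark'' x \<le> base} * (j + 1) + (j - s ''i'' 0)"

lemma scan_step_correct:
  assumes inv: "scan_inv N j acc P Q peb u v base s" and i: "s ''i'' 0 < j"
    and PQ: "\<And>i. i < j \<Longrightarrow> acc i \<noteq> 0 \<Longrightarrow> P i < N \<and> Q i < N"
  shows "terminates scan_step s (time scan_step)
    (\<lambda>s'. scan_inv N j acc P Q peb u v base s' \<and> scan_measure N j base s' < scan_measure N j base s)"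
proof (rule terminates_loop_free)
  show "loop_free scan_step" by (simp add: scan_step_def)
  let ?s = "sem scan_step s" and ?i = "s ''i'' 0" and ?mark = "s ''mark''" and ?cnt = "s ''cnt'' 0"
  note simps = inv[unfolded scan_inv_def]
  have found: "s ''found'' 0 = 0" using simps i by (auto split: if_splits)
  show "scan_inv N j acc P Q peb u v base ?s \<and> scan_measure N j base ?s < scan_measure N j base s"
  proof (cases "acc ?i \<noteq> 0 \<and> base < ?mark (P ?i) \<and> \<not> base < ?mark (Q ?i)")
    case False
    then have s': "?s = s(''i'' := (s ''i'')(0 := ?i + 1))"
      using simps by (auto simp: scan_step_def)
    show ?thesis
    proof
      show "scan_measure N j base ?s < scan_measure N j base s"
        using i by (simp add: s' scan_measure_def)
      show "scan_inv N j acc P Q peb u v base ?s"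
        unfolding scan_inv_def s' using simps found i False by (auto simp: less_Suc_eq)
    qed
  next
    case True
    let ?q = "Q ?i"
    define mark' where "mark' = ?mark(?q := ?cnt + 1)"
    define par' where "par' = (s ''par'')(?q := ?i)"
    have q: "?q < N" "?q \<noteq> u" "?q \<noteq> v" "P ?i \<noteq> ?q"
      using PQ[OF i] True simps by (auto simp: search_forest_def)
    have mark': "mark' x \<le> ?cnt + 1" "base < mark' x \<longleftrightarrow> x = ?q \<or> base < ?mark x" for x
      using simps by (auto simp: mark'_def le_Suc_eq)
    have forest: "search_forest N {i. i < j \<and> acc i \<noteq> 0} P Q u v base mark' par' (?cnt + 1)"
      unfolding search_forest_def
    proof (intro conjI allI impI)
      show "mark' u = base + 1" "mark' v = base + 1"
        using simps q by (auto simp: mark'_def search_forest_def)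
      fix x assume x: "x < N" "base < mark' x" "x \<noteq> u" "x \<noteq> v"
      have old: "s ''par'' x \<in> {i. i < j \<and> acc i \<noteq> 0} \<and> Q (s ''par'' x) = x \<and> base < ?mark (P (s ''par'' x)) \<and>
          ?mark (P (s ''par'' x)) < ?mark x" if "x \<noteq> ?q"
        using simps x that mark'(2)[of x] by (auto simp: search_forest_def)
      show "par' x \<in> {i. i < j \<and> acc i \<noteq> 0}" "Q (par' x) = x"
        using old i True by (auto simp: par'_def)
      show "base < mark' (P (par' x))"
        using old True mark'(2) by (cases "x = ?q") (auto simp: par'_def)
      have "?mark y < ?cnt + 1" for y using simps by (simp add: le_imp_less_Suc)
      moreover have "P (s ''par'' x) \<noteq> ?q" if "x \<noteq> ?q" using old[OF that] True by auto
      ultimately show "mark' (P (par' x)) < mark' x"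
        using old q(4) by (cases "x = ?q") (auto simp: par'_def mark'_def)
    qed
    have "{x. x < N \<and> mark' x \<le> base} = {x. x < N \<and> ?mark x \<le> base} - {?q}"
      using mark'(2) by (auto simp: not_less[symmetric])
    moreover have "card ({x. x < N \<and> ?mark x \<le> base} - {?q}) < card {x. x < N \<and> ?mark x \<le> base}"
      using q True by (intro card_Diff1_less) auto
    ultimately have "card {x. x < N \<and> mark' x \<le> base} + 1 \<le> card {x. x < N \<and> ?mark x \<le> base}" by simp
    then have card: "card {x. x < N \<and> mark' x \<le> base} * (j + 1) + (j + 1) \<le> card {x. x < N \<and> ?mark x \<le> base} * (j + 1)"
      using mult_le_mono1[of _ _ "j + 1"] by fastforce
    show ?thesis
    proof (cases "peb ?q = 0")
      case peb: True
      then have s': "?s = s(''cnt'' := (s ''cnt'')(0 := ?cnt + 1), ''mark'' := mark', ''par'' := par',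
          ''i'' := (s ''i'')(0 := 0))"
        using True simps by (auto simp: scan_step_def mark'_def par'_def)
      show ?thesis
      proof
        show "scan_measure N j base ?s < scan_measure N j base s"
          using i card by (simp add: s' scan_measure_def)
        show "scan_inv N j acc P Q peb u v base ?s"
          unfolding scan_inv_def s' using simps found forest mark' peb by simp
      qed
    next
      case peb: False
      then have s': "?s = s(''cnt'' := (s ''cnt'')(0 := ?cnt + 1), ''mark'' := mark', ''par'' := par',
          ''found'' := (s ''found'')(0 := 1), ''w'' := (s ''w'')(0 := ?q), ''i'' := (s ''i'')(0 := j))"
        using True simps by (auto simp: scan_step_def mark'_def par'_def)
      show ?thesis
      proof
        show "scan_measure N j base ?s < scan_measure N j base s"
          using i card by (simp add: s' scan_measure_def)
        show "scan_inv N j acc P Q peb u v base ?s"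
          unfolding scan_inv_def s' using simps forest mark' peb q by simp
      qed
    qed
  qed
qed simp

definition scan_time :: "nat \<Rightarrow> nat \<Rightarrow> nat" where
  "scan_time N M = (N * (M + 1) + M + 1) * (6 + time scan_step)"

lemma scan_correct:
  assumes inv: "scan_inv N j acc P Q peb u v base s" and "j \<le> M"
    and PQ: "\<And>i. i < j \<Longrightarrow> acc i \<noteq> 0 \<Longrightarrow> P i < N \<and> Q i < N"
  shows "terminates scan s (scan_time N M)
    (\<lambda>s'. scan_inv N j acc P Q peb u v base s' \<and> s' ''i'' 0 = j)"
  unfolding scan_def
proof (rule terminates_mono)
  show "terminates (While (Minus (Var ''j'') (Var ''i'')) scan_step) s
    ((scan_measure N j base s + 1) * (1 + cost (Minus (Var ''j'') (Var ''i'')) + time scan_step))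
    (\<lambda>s'. scan_inv N j acc P Q peb u v base s' \<and> val (Minus (Var ''j'') (Var ''i'')) s' = 0)"
  proof (rule terminates_While)
    show "scan_inv N j acc P Q peb u v base s" by (fact inv)
    fix s assume s: "scan_inv N j acc P Q peb u v base s" "val (Minus (Var ''j'') (Var ''i'')) s \<noteq> 0"
    then have "s ''i'' 0 < j" by (simp add: scan_inv_def)
    with s(1) PQ show "terminates scan_step s (time scan_step)
      (\<lambda>s'. scan_inv N j acc P Q peb u v base s' \<and> scan_measure N j base s' < scan_measure N j base s)"
      by (intro scan_step_correct)
  qed
next
  have "card {x. x < N \<and> s ''mark'' x \<le> base} \<le> card {..<N}" by (intro card_mono) auto
  then have "card {x. x < N \<and> s ''mark'' x \<le> base} * (j + 1) \<le> N * (M + 1)"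
    using assms(2) by (intro mult_le_mono) auto
  then have "scan_measure N j base s + 1 \<le> N * (M + 1) + M + 1"
    using assms(2) by (simp add: scan_measure_def)
  then show "(scan_measure N j base s + 1) * (1 + cost (Minus (Var ''j'') (Var ''i'')) + time scan_step) \<le> scan_time N M"
    unfolding scan_time_def by (intro mult_le_mono) auto
qed (auto simp: scan_inv_def)

text \<open>\<open>b\<close> counts the pebbles on both roots before the reversal. The forest need
  only be intact up to the stamp of \<open>w\<close>: edges already reversed belonged to vertices
  with larger stamps.\<close>

definition flip_inv ::
  "nat \<Rightarrow> nat \<Rightarrow> nat set \<Rightarrow> (nat \<Rightarrow> nat \<times> nat) \<Rightarrow> nat \<Rightarrow> nat \<Rightarrow> nat \<Rightarrow> (nat \<Rightarrow> nat) \<Rightarrow> (nat \<Rightarrow> nat) \<Rightarrow> nat \<Rightarrow> state \<Rightarrow> bool"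
where
  "flip_inv N k I e u v base mark par b s \<longleftrightarrow>
     s ''mark'' = mark \<and> s ''par'' = par \<and> s ''base'' 0 = base \<and>
     pebbling N k I e (s ''P'') (s ''Q'') (s ''peb'') \<and>
     search_forest N I (s ''P'') (s ''Q'') u v base mark par (mark (s ''w'' 0)) \<and>
     s ''w'' 0 < N \<and> base < mark (s ''w'' 0) \<and> 0 < s ''peb'' (s ''w'' 0) \<and>
     s ''peb'' u + s ''peb'' v = b + (if s ''w'' 0 = u \<or> s ''w'' 0 = v then 1 else 0)"

definition flip_measure :: "nat \<Rightarrow> (nat \<Rightarrow> nat) \<Rightarrow> state \<Rightarrow> nat" where
  "flip_measure N mark s = card {x. x < N \<and> mark x < mark (s ''w'' 0)}"

lemma flip_step_correct:
  assumes inv: "flip_inv N k I e u v base mark par b s" and w: "base + 1 < mark (s ''w'' 0)" and "u \<noteq> v"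
  shows "terminates flip_step s (time flip_step)
    (\<lambda>s'. flip_inv N k I e u v base mark par b s' \<and> flip_measure N mark s' < flip_measure N mark s)"
proof (rule terminates_loop_free)
  show "loop_free flip_step" by (simp add: flip_step_def)
  note simps = inv[unfolded flip_inv_def]
  define w where "w = s ''w'' 0"
  define i where "i = par w"
  define x where "x = s ''P'' i"
  have wuv: "w \<noteq> u" "w \<noteq> v" using w simps by (auto simp: w_def search_forest_def)
  then have i: "i \<in> I" "s ''Q'' i = w" "base < mark x" "mark x < mark w"
    using simps by (auto simp: search_forest_def w_def i_def x_def)
  have xw: "x \<noteq> w" using i by auto
  have xN: "x < N" using simps i(1) by (auto simp: pebbling_def x_def)
  define P' where "P' = (s ''P'')(i := w)"
  define Q' where "Q' = (s ''Q'')(i := x)"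
  define peb' where "peb' = (s ''peb'')(w := s ''peb'' w - 1, x := s ''peb'' x + 1)"
  have s': "sem flip_step s = s(''i'' := (s ''i'')(0 := i), ''x'' := (s ''x'')(0 := x),
      ''P'' := P', ''Q'' := Q', ''peb'' := peb', ''w'' := (s ''w'')(0 := x))"
    using simps xw by (simp add: flip_step_def w_def i_def x_def P'_def Q'_def peb'_def)
  have "pebbling N k I e P' Q' peb'"
    using pebbling_flip[of N k I e "s ''P''" "s ''Q''" "s ''peb''" i] simps i xw
    by (simp add: P'_def Q'_def peb'_def x_def[symmetric] w_def[symmetric])
  moreover have "search_forest N I P' Q' u v base mark par (mark x)"
    unfolding search_forest_def
  proof (intro conjI allI impI)
    show "mark u = base + 1" "mark v = base + 1" using simps by (auto simp: search_forest_def)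
    fix y assume y: "y < N" "base < mark y" "mark y \<le> mark x" "y \<noteq> u" "y \<noteq> v"
    then have old: "par y \<in> I" "s ''Q'' (par y) = y" "base < mark (s ''P'' (par y))" "mark (s ''P'' (par y)) < mark y"
      using simps i(4) by (auto simp: search_forest_def w_def)
    have "par y \<noteq> i" using old(2) i(2,4) y(3) by auto
    then show "par y \<in> I" "Q' (par y) = y" "base < mark (P' (par y))" "mark (P' (par y)) < mark y"
      using old by (auto simp: P'_def Q'_def)
  qed
  moreover have "peb' u + peb' v = b + (if x = u \<or> x = v then 1 else 0)"
    using simps wuv assms(3) by (auto simp: peb'_def w_def[symmetric])
  moreover have "0 < peb' x" by (simp add: peb'_def)
  ultimately have "flip_inv N k I e u v base mark par b (sem flip_step s)"
    unfolding flip_inv_def s' using simps xN i(3) by simp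
  moreover have "{y. y < N \<and> mark y < mark x} \<subset> {y. y < N \<and> mark y < mark w}"
    using i(4) xN by auto
  then have "flip_measure N mark (sem flip_step s) < flip_measure N mark s"
    unfolding flip_measure_def s' by (simp add: w_def[symmetric] psubset_card_mono)
  ultimately show "flip_inv N k I e u v base mark par b (sem flip_step s) \<and>
    flip_measure N mark (sem flip_step s) < flip_measure N mark s" ..
qed simp

definition flip_time :: "nat \<Rightarrow> nat" where
  "flip_time N = (N + 1) * (10 + time flip_step)"

lemma flip_correct:
  assumes inv: "flip_inv N k I e u v base mark par b s" and "u \<noteq> v"
  shows "terminates flip s (flip_time N) (\<lambda>s'. pebbling N k I e (s' ''P'') (s' ''Q'') (s' ''peb'') \<and>
    s' ''peb'' u + s' ''peb'' v = b + 1)"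
  unfolding flip_def
proof (rule terminates_mono)
  let ?e = "Minus (Elem ''mark'' (Var ''w'')) (Plus (Var ''base'') (Const 1))"
  show "terminates (While ?e flip_step) s ((flip_measure N mark s + 1) * (1 + cost ?e + time flip_step))
    (\<lambda>s'. flip_inv N k I e u v base mark par b s' \<and> val ?e s' = 0)"
  proof (rule terminates_While)
    show "flip_inv N k I e u v base mark par b s" by (fact inv)
    fix s assume s: "flip_inv N k I e u v base mark par b s" "val ?e s \<noteq> 0"
    then have "base + 1 < mark (s ''w'' 0)" by (simp add: flip_inv_def)
    with s(1) assms(2) show "terminates flip_step s (time flip_step)
      (\<lambda>s'. flip_inv N k I e u v base mark par b s' \<and> flip_measure N mark s' < flip_measure N mark s)"
      by (intro flip_step_correct)
  qed
  have "flip_measure N mark s \<le> card {..<N}"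
    unfolding flip_measure_def by (intro card_mono) auto
  then show "(flip_measure N mark s + 1) * (1 + cost ?e + time flip_step) \<le> flip_time N"
    unfolding flip_time_def by (intro mult_le_mono) auto
  fix s' assume s': "flip_inv N k I e u v base mark par b s' \<and> val ?e s' = 0"
  have "s' ''w'' 0 = u \<or> s' ''w'' 0 = v"
  proof (rule ccontr)
    assume "\<not> ?thesis"
    then have "base < mark (s' ''P'' (par (s' ''w'' 0)))" "mark (s' ''P'' (par (s' ''w'' 0))) < mark (s' ''w'' 0)"
      using s' by (auto simp: flip_inv_def search_forest_def)
    then show False using s' by (auto simp: flip_inv_def)
  qed
  then show "pebbling N k I e (s' ''P'') (s' ''Q'') (s' ''peb'') \<and> s' ''peb'' u + s' ''peb'' v = b + 1"
    using s' by (auto simp: flip_inv_def)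
qed

section \<open>Processing the candidates\<close>

definition dup_step :: com where
  "dup_step =
     If (Plus (Plus (Minus (Elem ''tail'' (Var ''i'')) (Elem ''tail'' (Var ''j'')))
                    (Minus (Elem ''tail'' (Var ''j'')) (Elem ''tail'' (Var ''i''))))
              (Plus (Minus (Elem ''head'' (Var ''i'')) (Elem ''head'' (Var ''j'')))
                    (Minus (Elem ''head'' (Var ''j'')) (Elem ''head'' (Var ''i'')))))
       Skip (Set ''dup'' (Const 1));;
     Incr ''i''"

definition dup_check :: com where
  "dup_check = Set ''dup'' (Const 0);; Set ''i'' (Const 0);; While (Minus (Var ''j'') (Var ''i'')) dup_step"

text \<open>The sum of both truncated differences of two numbers is their distance, which serves as
  a test for inequality here and in \<open>dup_step\<close>. A repeated pair is an error only among
  the arcs of the input; later repetitions and loops are skipped.\<close>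

definition process :: com where
  "process =
     dup_check;;
     If (Var ''dup'')
       (If (Minus (Var ''m'') (Var ''j'')) (Set ''bad'' (Const 1)) Skip)
       (If (Plus (Minus (Elem ''tail'' (Var ''j'')) (Elem ''head'' (Var ''j'')))
                 (Minus (Elem ''head'' (Var ''j'')) (Elem ''tail'' (Var ''j''))))
         ((Set ''u'' (Elem ''tail'' (Var ''j''));;
           Set ''v'' (Plus (Var ''n'') (Elem ''head'' (Var ''j'')));;
           Set ''go'' (Const 1));; gather)
         Skip)"

definition main_loop :: com where
  "main_loop = While (Minus (Var ''M'') (Var ''j'')) (process;; Incr ''j'')"

definition gather_step_time :: "nat \<Rightarrow> nat \<Rightarrow> nat" where
  "gather_step_time N M = 11 + time accept + (time search_init +
     (scan_time N M + (3 + flip_time N + time (Set ''go'' (Const 0)))))"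

definition gather_time :: "nat \<Rightarrow> nat \<Rightarrow> nat" where
  "gather_time N M = (2 * M + 2) * (3 + gather_step_time N M)"

definition dup_time :: "nat \<Rightarrow> nat" where
  "dup_time M = 6 + (M + 1) * (10 + time dup_step)"

definition accepted :: "(nat \<Rightarrow> nat) \<Rightarrow> nat \<Rightarrow> nat set" where
  "accepted acc j = {i. i < j \<and> acc i \<noteq> 0}"

locale pebble_game =
  fixes n m k M :: nat and T H :: "nat \<Rightarrow> nat"
  assumes m_le: "m \<le> M" and T_less: "i < M \<Longrightarrow> T i < n" and H_less: "i < M \<Longrightarrow> H i < n"
begin

abbreviation N :: nat where
  "N \<equiv> 2 * n"

definition ends :: "nat \<Rightarrow> nat \<times> nat" where
  "ends i = (T i, n + H i)"

definition input :: "state \<Rightarrow> bool" where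
  "input s \<longleftrightarrow> s ''n'' 0 = n \<and> s ''m'' 0 = m \<and> s ''k'' 0 = k \<and> s ''M'' 0 = M \<and>
     s ''tail'' = T \<and> s ''head'' = H"

definition unchanged :: "state \<Rightarrow> state \<Rightarrow> bool" where
  "unchanged s s' \<longleftrightarrow> s' ''acc'' = s ''acc'' \<and> s' ''free'' = s ''free'' \<and> output_arcs s' = output_arcs s"

definition pebbled :: "state \<Rightarrow> nat set \<Rightarrow> bool" where
  "pebbled s I \<longleftrightarrow> pebbling N k I ends (s ''P'') (s ''Q'') (s ''peb'') \<and> (\<forall>x. s ''mark'' x \<le> s ''cnt'' 0)"

definition was_rejected :: "nat \<Rightarrow> state \<Rightarrow> state \<Rightarrow> bool" where
  "was_rejected j s s' \<longleftrightarrow> unchanged s s' \<and> pebbled s' (accepted (s ''acc'') j) \<and>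
     (\<exists>X\<subseteq>{..<N}. T j \<in> X \<and> n + H j \<in> X \<and> tight k (ends ` accepted (s ''acc'') j) X)"

definition was_accepted :: "nat \<Rightarrow> state \<Rightarrow> state \<Rightarrow> bool" where
  "was_accepted j s s' \<longleftrightarrow> s' ''acc'' = (s ''acc'')(j := 1) \<and> s' ''free'' 0 = s ''free'' 0 - 1 \<and>
     output_arcs s' = output_arcs s @ (if j < m then [] else [(T j, H j)]) \<and>
     pebbled s' (insert j (accepted (s ''acc'') j)) \<and>
     sparse k {..<N} (ends ` insert j (accepted (s ''acc'') j))"

definition gather_inv :: "nat \<Rightarrow> state \<Rightarrow> state \<Rightarrow> bool" where
  "gather_inv j s s' \<longleftrightarrow> input s' \<and> s' ''j'' 0 = j \<and> s' ''u'' 0 = T j \<and> s' ''v'' 0 = n + H j \<and>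
     (if s' ''go'' 0 \<noteq> 0 then unchanged s s' \<and> pebbled s' (accepted (s ''acc'') j)
      else was_rejected j s s' \<or> was_accepted j s s')"

text \<open>A successful search brings one more pebble to the two ends, and neither can hold more
  than \<open>k\<close>. The extra \<open>1\<close> makes the round that clears \<open>go\<close>
  count as progress.\<close>

definition gather_measure :: "nat \<Rightarrow> state \<Rightarrow> nat" where
  "gather_measure j s = (if s ''go'' 0 = 0 then 0 else 1 + (2 * k - (s ''peb'' (T j) + s ''peb'' (n + H j))))"

lemma accept_correct:
  assumes inv: "gather_inv j s0 s" and go: "s ''go'' 0 \<noteq> 0" and j: "j < M"
    and sp: "sparse k {..<N} (ends ` accepted (s0 ''acc'') j)"
    and new: "ends j \<notin> ends ` accepted (s0 ''acc'') j"
    and peb: "k < s ''peb'' (T j) + s ''peb'' (n + H j)"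
  shows "gather_inv j s0 (sem accept s) \<and> sem accept s ''go'' 0 = 0"
proof -
  let ?s = "sem accept s" and ?I = "accepted (s0 ''acc'') j" and ?u = "T j" and ?v = "n + H j"
  have inp: "input s" "unchanged s0 s" "pebbled s ?I" "s ''u'' 0 = ?u" "s ''v'' 0 = ?v" "s ''j'' 0 = j"
    using inv go by (auto simp: gather_inv_def)
  have pb: "pebbling N k ?I ends (s ''P'') (s ''Q'') (s ''peb'')" using inp by (simp add: pebbled_def)
  define a where "a = (if s ''peb'' ?u \<noteq> 0 then ?u else ?v)"
  define b where "b = (if s ''peb'' ?u \<noteq> 0 then ?v else ?u)"
  have ab: "{a, b} = {fst (ends j), snd (ends j)}" "a < N" "b < N" "s ''peb'' a > 0"
    using peb T_less[OF j] H_less[OF j] by (auto simp: a_def b_def ends_def)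
  have s: "?s ''acc'' = (s ''acc'')(j := 1)" "?s ''free'' 0 = s ''free'' 0 - 1" "?s ''go'' 0 = 0"
    "?s ''P'' = (s ''P'')(j := a)" "?s ''Q'' = (s ''Q'')(j := b)"
    "?s ''peb'' = (s ''peb'')(a := s ''peb'' a - 1)" "?s ''mark'' = s ''mark''" "?s ''cnt'' = s ''cnt''"
    "?s ''u'' = s ''u''" "?s ''v'' = s ''v''" "?s ''j'' = s ''j''" "input ?s"
    using inp by (auto simp: accept_def a_def b_def input_def)
  have "output_arcs ?s = output_arcs s @ (if j < m then [] else [(T j, H j)])"
    using inp by (auto simp: accept_def input_def output_arcs_def)
  moreover have "j \<notin> ?I" by (simp add: accepted_def)
  then have "pebbling N k (insert j ?I) ends ((s ''P'')(j := a)) ((s ''Q'')(j := b)) ((s ''peb'')(a := s ''peb'' a - 1))"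
    using pebbling_insert[OF pb _ new ab] by simp
  then have "pebbled ?s (insert j ?I)" using s inp by (simp add: pebbled_def)
  moreover have "sparse k {..<N} (insert (?u, ?v) (ends ` ?I))"
    using pebbling_insert_sparse[OF pb sp _ _ _ peb] T_less[OF j] H_less[OF j] by simp
  ultimately have "was_accepted j s0 ?s"
    using inp s by (simp add: was_accepted_def unchanged_def ends_def)
  then show ?thesis using s inp by (simp add: gather_inv_def)
qed

lemma search_init_scan_inv:
  assumes "input s" "pebbled s I" "s ''u'' 0 = u" "s ''v'' 0 = v" "s ''j'' 0 = j" "I = accepted (s ''acc'') j"
  shows "scan_inv N j (s ''acc'') (s ''P'') (s ''Q'') (s ''peb'') u v (s ''cnt'' 0) (sem search_init s)"
proof -
  have le: "s ''mark'' x \<le> s ''cnt'' 0" for x using assms by (simp add: pebbled_def)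
  then have "\<not> s ''cnt'' 0 < s ''mark'' x" "s ''mark'' x \<le> Suc (s ''cnt'' 0)" for x
    by (auto simp: not_less le_SucI)
  then show ?thesis
    using assms by (simp add: search_init_def scan_inv_def search_forest_def)
qed

lemma gather_step_correct:
  assumes inv: "gather_inv j s0 s" and go: "s ''go'' 0 \<noteq> 0" and j: "j < M"
    and sp: "sparse k {..<N} (ends ` accepted (s0 ''acc'') j)"
    and new: "ends j \<notin> ends ` accepted (s0 ''acc'') j"
  shows "terminates gather_step s (gather_step_time N M)
    (\<lambda>s'. gather_inv j s0 s' \<and> gather_measure j s' < gather_measure j s)"
    (is "terminates _ _ _ ?post")
proof -
  let ?I = "accepted (s0 ''acc'') j" and ?u = "T j" and ?v = "n + H j"
  let ?e = "Minus (Plus (Elem ''peb'' (Var ''u'')) (Elem ''peb'' (Var ''v''))) (Var ''k'')"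
  have inp: "input s" "unchanged s0 s" "pebbled s ?I" "s ''u'' 0 = ?u" "s ''v'' 0 = ?v" "s ''j'' 0 = j"
    using inv go by (auto simp: gather_inv_def)
  have pb: "pebbling N k ?I ends (s ''P'') (s ''Q'') (s ''peb'')" using inp by (simp add: pebbled_def)
  have uv: "?u < N" "?v < N" "?u \<noteq> ?v" using T_less[OF j] H_less[OF j] by auto
  have acc: "s ''acc'' = s0 ''acc''" using inp by (simp add: unchanged_def)
  have I: "?I = {i. i < j \<and> s ''acc'' i \<noteq> 0}" by (simp add: accepted_def acc)
  have eval: "val ?e s = s ''peb'' ?u + s ''peb'' ?v - k" using inp by (simp add: input_def)
  have m: "gather_measure j s = 1 + (2 * k - (s ''peb'' ?u + s ''peb'' ?v))"
    using go by (simp add: gather_measure_def)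
  have "terminates gather_step s (1 + cost ?e + time accept + (time search_init +
     (scan_time N M + (1 + cost (Var ''found'') + flip_time N + time (Set ''go'' (Const 0)))))) ?post"
    unfolding gather_step_def
  proof (rule terminates_If)
    assume "val ?e s \<noteq> 0"
    then have "k < s ''peb'' ?u + s ''peb'' ?v" unfolding eval by simp
    then have "gather_inv j s0 (sem accept s) \<and> sem accept s ''go'' 0 = 0"
      using accept_correct[OF inv go j sp new] by simp
    then show "terminates accept s (time accept) ?post"
      using go by (intro terminates_loop_free) (simp add: accept_def, simp_all add: gather_measure_def)
  next
    assume "val ?e s = 0"
    then have few: "s ''peb'' ?u + s ''peb'' ?v \<le> k" unfolding eval by simp
    let ?s1 = "sem search_init s" and ?base = "s ''cnt'' 0"
    have s1: "?s1 x = s x" if "x \<notin> {''base'', ''cnt'', ''mark'', ''found'', ''i''}" for x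
      using that by (simp add: search_init_def)
    have scan: "scan_inv N j (s ''acc'') (s ''P'') (s ''Q'') (s ''peb'') ?u ?v ?base ?s1"
      using search_init_scan_inv[OF inp(1,3-6)] acc by simp
    have PQ: "s ''P'' i < N \<and> s ''Q'' i < N" if "i < j" "s ''acc'' i \<noteq> 0" for i
      using pb that by (simp add: pebbling_def I)
    have jM: "j \<le> M" using j by simp
    have "terminates scan ?s1 (scan_time N M)
      (\<lambda>s'. scan_inv N j (s ''acc'') (s ''P'') (s ''Q'') (s ''peb'') ?u ?v ?base s' \<and> s' ''i'' 0 = j)"
      by (rule scan_correct[OF scan jM]) (rule PQ)
    note scanned = this
    show "terminates (search_init;; scan;; If (Var ''found'') flip (Set ''go'' (Const 0))) s
      (time search_init + (scan_time N M + (1 + cost (Var ''found'') + flip_time N + time (Set ''go'' (Const 0))))) ?post"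
    proof (rule terminates_Seq, rule terminates_loop_free, simp add: search_init_def,
        rule terminates_Seq, rule terminates_frame[OF scanned])
      fix s2 assume frame: "\<And>x. x \<notin> writes scan \<Longrightarrow> s2 x = ?s1 x"
        and post: "scan_inv N j (s ''acc'') (s ''P'') (s ''Q'') (s ''peb'') ?u ?v ?base s2 \<and> s2 ''i'' 0 = j"
      have s2: "s2 x = s x" if "x \<notin> {''base'', ''cnt'', ''mark'', ''found'', ''i'', ''par'', ''w''}" for x
        using that frame[of x] s1[of x] by (simp add: scan_def scan_step_def)
      have st: "input s2" "unchanged s0 s2" "s2 ''u'' 0 = ?u" "s2 ''v'' 0 = ?v" "s2 ''j'' 0 = j"
        using inp by (simp_all add: s2 input_def unchanged_def output_arcs_def)
      have marks: "\<forall>x. s2 ''mark'' x \<le> s2 ''cnt'' 0" using post by (simp add: scan_inv_def)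
      have pb2: "pebbled s2 ?I" using pb marks by (simp add: pebbled_def s2)
      show "terminates (If (Var ''found'') flip (Set ''go'' (Const 0))) s2
        (1 + cost (Var ''found'') + flip_time N + time (Set ''go'' (Const 0))) ?post"
      proof (rule terminates_If)
        assume "val (Var ''found'') s2 \<noteq> 0"
        then have found: "s2 ''found'' 0 \<noteq> 0" by simp
        let ?w = "s2 ''w'' 0"
        have w: "?w < N" "?base < s2 ''mark'' ?w" "?w \<noteq> ?u" "?w \<noteq> ?v" "0 < s ''peb'' ?w"
          using post found by (auto simp: scan_inv_def)
        have "search_forest N ?I (s ''P'') (s ''Q'') ?u ?v ?base (s2 ''mark'') (s2 ''par'') (s2 ''cnt'' 0)"
          using post by (simp add: scan_inv_def I)
        then have "search_forest N ?I (s ''P'') (s ''Q'') ?u ?v ?base (s2 ''mark'') (s2 ''par'') (s2 ''mark'' ?w)"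
          using marks by (fastforce simp: search_forest_def intro: order_trans)
        then have "flip_inv N k ?I ends ?u ?v ?base (s2 ''mark'') (s2 ''par'') (s ''peb'' ?u + s ''peb'' ?v) s2"
          using post w pb by (simp add: flip_inv_def s2 scan_inv_def)
        from flip_correct[OF this uv(3)] show "terminates flip s2 (flip_time N) ?post"
        proof (rule terminates_frame)
          fix s3 assume frame: "\<And>x. x \<notin> writes flip \<Longrightarrow> s3 x = s2 x"
            and post: "pebbling N k ?I ends (s3 ''P'') (s3 ''Q'') (s3 ''peb'') \<and>
              s3 ''peb'' ?u + s3 ''peb'' ?v = s ''peb'' ?u + s ''peb'' ?v + 1"
          have s3: "s3 x = s2 x" if "x \<notin> {''i'', ''x'', ''P'', ''Q'', ''peb'', ''w''}" for x
            using frame[of x] that by (simp add: flip_def flip_step_def)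
          have "input s3" "unchanged s0 s3" "s3 ''u'' 0 = ?u" "s3 ''v'' 0 = ?v" "s3 ''j'' 0 = j" "s3 ''go'' = s ''go''"
            using st by (simp_all add: s2 s3 input_def unchanged_def output_arcs_def)
          moreover have "pebbled s3 ?I" using post marks by (simp add: pebbled_def s3)
          moreover have "s3 ''peb'' ?u \<le> k" "s3 ''peb'' ?v \<le> k"
            using post pebbling_le uv by blast+
          then have "2 * k - (s3 ''peb'' ?u + s3 ''peb'' ?v) < 2 * k - (s ''peb'' ?u + s ''peb'' ?v)"
            using post by linarith
          ultimately show "?post s3" using go by (simp add: gather_inv_def gather_measure_def)
        qed simp
      next
        assume "val (Var ''found'') s2 = 0"
        then have found: "s2 ''found'' 0 = 0" by simp
        \<comment> \<open>An unsuccessful search has swept past all accepted edges, so the marked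
          set is closed under the orientation and holds pebbles only at \<open>?u\<close> and
          \<open>?v\<close>. This is the tight set that justifies the rejection.\<close>
        let ?X = "{x. x < N \<and> ?base < s2 ''mark'' x}"
        have X: "?u \<in> ?X" "?v \<in> ?X" "?X \<subseteq> {..<N}"
          using post uv by (auto simp: scan_inv_def search_forest_def)
        have "tight k (ends ` ?I) ?X"
        proof (rule pebbling_stuck_tight[OF pb sp X(3,1,2) uv(3) _ _ few])
          fix i assume "i \<in> ?I" "s ''P'' i \<in> ?X"
          then show "s ''Q'' i \<in> ?X" using post found PQ by (auto simp: I scan_inv_def)
        qed (use post found in \<open>auto simp: scan_inv_def\<close>)
        then have "was_rejected j s0 s2"
          unfolding was_rejected_def using st pb2 X by blast
        then have "was_rejected j s0 (s2(''go'' := (s2 ''go'')(0 := 0)))"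
          by (simp add: was_rejected_def unchanged_def output_arcs_def pebbled_def)
        then show "terminates (Set ''go'' (Const 0)) s2 (time (Set ''go'' (Const 0))) ?post"
          using st m by (intro terminates_loop_free) (simp_all add: gather_inv_def gather_measure_def input_def)
      qed
    qed simp_all
  qed
  then show ?thesis by (rule terminates_mono) (simp_all add: gather_step_time_def)
qed

lemma gather_correct:
  assumes inv: "gather_inv j s s" and go: "s ''go'' 0 \<noteq> 0" and j: "j < M"
    and sp: "sparse k {..<N} (ends ` accepted (s ''acc'') j)"
    and new: "ends j \<notin> ends ` accepted (s ''acc'') j"
  shows "terminates gather s (gather_time N M) (\<lambda>s'. was_rejected j s s' \<or> was_accepted j s s')"
  unfolding gather_def
proof (rule terminates_mono)
  show "terminates (While (Var ''go'') gather_step) s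
    ((gather_measure j s + 1) * (1 + cost (Var ''go'') + gather_step_time N M))
    (\<lambda>s'. gather_inv j s s' \<and> val (Var ''go'') s' = 0)"
  proof (rule terminates_While)
    show "gather_inv j s s" by (fact inv)
    fix s' assume s': "gather_inv j s s'" "val (Var ''go'') s' \<noteq> 0"
    then have "s' ''go'' 0 \<noteq> 0" by simp
    with s'(1) j sp new show "terminates gather_step s' (gather_step_time N M)
      (\<lambda>s''. gather_inv j s s'' \<and> gather_measure j s'' < gather_measure j s')"
      by (intro gather_step_correct)
  qed
  have "pebbling N k (accepted (s ''acc'') j) ends (s ''P'') (s ''Q'') (s ''peb'')"
    using inv go by (simp add: gather_inv_def pebbled_def)
  moreover have "accepted (s ''acc'') j \<subseteq> {..<M}" using j by (auto simp: accepted_def)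
  \<comment> \<open>Each end lacks at most \<open>M\<close> pebbles, so at most \<open>2 * M\<close>
    successful searches are possible even for huge \<open>k\<close>.\<close>
  ultimately have "k \<le> s ''peb'' (T j) + M" "k \<le> s ''peb'' (n + H j) + M"
    using pebbling_ge T_less[OF j] H_less[OF j] by force+
  then have "2 * k - (s ''peb'' (T j) + s ''peb'' (n + H j)) \<le> 2 * M" by linarith
  then have "gather_measure j s + 1 \<le> 2 * M + 2" by (simp add: gather_measure_def)
  then show "(gather_measure j s + 1) * (1 + cost (Var ''go'') + gather_step_time N M) \<le> gather_time N M"
    unfolding gather_time_def by (intro mult_le_mono) auto
qed (simp add: gather_inv_def)

lemma dup_check_correct:
  assumes "input s" "s ''j'' 0 = j" "j < M"
  shows "terminates dup_check s (dup_time M) (\<lambda>s'. s' ''dup'' 0 \<noteq> 0 \<longleftrightarrow> ends j \<in> ends ` {..<j})"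
proof -
  let ?init = "Set ''dup'' (Const 0);; Set ''i'' (Const 0)"
  let ?e = "Minus (Var ''j'') (Var ''i'')"
  define I where "I s \<longleftrightarrow> s ''tail'' = T \<and> s ''head'' = H \<and> s ''j'' 0 = j \<and> s ''i'' 0 \<le> j \<and>
    (s ''dup'' 0 \<noteq> 0 \<longleftrightarrow> ends j \<in> ends ` {..<s ''i'' 0})" for s :: state
  define \<mu> where "\<mu> s = j - s ''i'' 0" for s :: state
  have loop: "terminates (While ?e dup_step) s ((\<mu> s + 1) * (1 + cost ?e + time dup_step))
    (\<lambda>s'. I s' \<and> val ?e s' = 0)" if "I s" for s
  proof (rule terminates_While)
    show "I s" by (fact that)
    fix s assume s: "I s" "val ?e s \<noteq> 0"
    then have i: "s ''i'' 0 < j" by (simp add: I_def)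
    have "ends j = ends i \<longleftrightarrow> T i = T j \<and> H i = H j" for i by (auto simp: ends_def)
    then have "I (sem dup_step s)" "sem dup_step s ''i'' 0 = s ''i'' 0 + 1"
      using s i by (auto simp: dup_step_def I_def lessThan_Suc)
    then show "terminates dup_step s (time dup_step) (\<lambda>s'. I s' \<and> \<mu> s' < \<mu> s)"
      using i by (intro terminates_loop_free) (simp_all add: \<mu>_def dup_step_def)
  qed
  let ?s = "s(''dup'' := (s ''dup'')(0 := 0), ''i'' := (s ''i'')(0 := 0))"
  have "I ?s" using assms by (simp add: I_def input_def)
  then have while: "terminates (While ?e dup_step) ?s ((M + 1) * (10 + time dup_step))
    (\<lambda>s'. s' ''dup'' 0 \<noteq> 0 \<longleftrightarrow> ends j \<in> ends ` {..<j})"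
  proof (rule terminates_mono[OF loop])
    show "(\<mu> ?s + 1) * (1 + cost ?e + time dup_step) \<le> (M + 1) * (10 + time dup_step)"
      using assms(3) by (intro mult_le_mono) (simp_all add: \<mu>_def)
  next
    fix s' assume "I s' \<and> val ?e s' = 0"
    then have "s' ''i'' 0 = j" "I s'" by (auto simp: I_def)
    then show "s' ''dup'' 0 \<noteq> 0 \<longleftrightarrow> ends j \<in> ends ` {..<j}" unfolding I_def by simp
  qed
  have "terminates dup_check s (3 + (3 + (M + 1) * (10 + time dup_step)))
    (\<lambda>s'. s' ''dup'' 0 \<noteq> 0 \<longleftrightarrow> ends j \<in> ends ` {..<j})"
    unfolding dup_check_def
    by (rule terminates_Seq, rule terminates_loop_free, simp, rule terminates_Seq,
        rule terminates_loop_free, simp, use while in simp, simp_all)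
  then show ?thesis by (simp add: dup_time_def)
qed

end

section \<open>The invariant of the greedy insertion\<close>

definition process_time :: "nat \<Rightarrow> nat \<Rightarrow> nat" where
  "process_time N M = dup_time M + (gather_time N M + 60)"

lemma accepted_simps:
  "acc j = 0 \<Longrightarrow> accepted acc (Suc j) = accepted acc j"
  "accepted (acc(j := 1)) (Suc j) = insert j (accepted acc j)"
  "i \<le> j \<Longrightarrow> accepted (acc(j := c)) i = accepted acc i"
  "finite (accepted acc j)"
  by (auto simp: accepted_def less_Suc_eq)

lemma accepted_mono: "i \<le> j \<Longrightarrow> accepted acc i \<subseteq> accepted acc j"
  by (auto simp: accepted_def)

context pebble_game
begin

definition spanned :: "(nat \<Rightarrow> nat) \<Rightarrow> nat \<Rightarrow> nat \<Rightarrow> bool" where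
  "spanned acc i j \<longleftrightarrow> ends i \<in> ends ` accepted acc j \<or>
     (\<exists>X\<subseteq>{..<N}. T i \<in> X \<and> n + H i \<in> X \<and> tight k (ends ` accepted acc j) X)"

definition main_inv :: "nat \<Rightarrow> state \<Rightarrow> bool" where
  "main_inv j s \<longleftrightarrow> input s \<and> j \<le> M \<and> (\<forall>i\<ge>j. s ''acc'' i = 0) \<and>
     pebbled s (accepted (s ''acc'') j) \<and> sparse k {..<N} (ends ` accepted (s ''acc'') j) \<and>
     (\<forall>i\<in>accepted (s ''acc'') j. T i \<noteq> H i \<and> ends i \<notin> ends ` {..<i}) \<and>
     (\<forall>i<j. T i \<noteq> H i \<longrightarrow> spanned (s ''acc'') i (Suc i)) \<and>
     s ''free'' 0 + card (accepted (s ''acc'') j) = k * N \<and>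
     (s ''bad'' 0 = 0 \<longleftrightarrow> inj_on ends ({..<j} \<inter> {..<m})) \<and>
     output_arcs s = map (\<lambda>i. (T i, H i)) (filter (\<lambda>i. s ''acc'' i \<noteq> 0) [m..<j])"

lemma main_inv_cong:
  assumes "main_inv j s" "\<And>x. x \<notin> {''i'', ''j'', ''dup'', ''u'', ''v'', ''go'', ''N'', ''a'', ''b''} \<Longrightarrow> s' x = s x"
  shows "main_inv j s'"
  using assms by (simp add: main_inv_def input_def pebbled_def output_arcs_def)

lemma spanned_mono:
  assumes "spanned acc i j" "j \<le> j'" "sparse k {..<N} (ends ` accepted acc j')"
  shows "spanned acc i j'"
proof -
  have sub: "ends ` accepted acc j \<subseteq> ends ` accepted acc j'" using accepted_mono[OF assms(2)] by blast
  then show ?thesis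
    using assms(1) tight_mono[OF _ sub _ assms(3)] unfolding spanned_def by blast
qed

lemma inj_on_ends_Suc:
  "inj_on ends ({..<Suc j} \<inter> {..<m}) \<longleftrightarrow>
    inj_on ends ({..<j} \<inter> {..<m}) \<and> (j < m \<longrightarrow> ends j \<notin> ends ` {..<j})"
proof (cases "j < m")
  case True
  then have "{..<Suc j} \<inter> {..<m} = insert j {..<j}" "{..<j} \<inter> {..<m} = {..<j}" by auto
  then show ?thesis using True by simp
next
  case False
  then have "{..<Suc j} \<inter> {..<m} = {..<j} \<inter> {..<m}" by auto
  then show ?thesis using False by simp
qed

lemma main_inv_reject:
  assumes inv: "main_inv j s" and j: "j < M" and s': "input s'" "unchanged s s'" "pebbled s' (accepted (s ''acc'') j)"
    and span: "T j \<noteq> H j \<Longrightarrow> spanned (s ''acc'') j j"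
    and bad: "s' ''bad'' 0 = 0 \<longleftrightarrow> inj_on ends ({..<Suc j} \<inter> {..<m})"
  shows "main_inv (Suc j) s'"
proof -
  have acc: "s' ''acc'' = s ''acc''" "s ''acc'' j = 0" using inv s' by (auto simp: main_inv_def unchanged_def)
  have "filter (\<lambda>i. s ''acc'' i \<noteq> 0) [m..<Suc j] = filter (\<lambda>i. s ''acc'' i \<noteq> 0) [m..<j]"
    using acc by simp
  moreover have "spanned (s ''acc'') j (Suc j)" if "T j \<noteq> H j"
    using span[OF that] acc by (simp add: spanned_def accepted_simps)
  ultimately show ?thesis
    using inv j s' acc bad by (simp add: main_inv_def accepted_simps unchanged_def less_Suc_eq)
qed

lemma main_inv_accept:
  assumes inv: "main_inv j s" and j: "j < M" and s': "input s'" "was_accepted j s s'" "s' ''bad'' = s ''bad''"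
    and new: "T j \<noteq> H j" "ends j \<notin> ends ` {..<j}"
  shows "main_inv (Suc j) s'"
proof -
  let ?acc = "s ''acc''" and ?I = "accepted (s ''acc'') j"
  have acc: "s' ''acc'' = ?acc(j := 1)" using s' by (simp add: was_accepted_def)
  have I: "accepted (s' ''acc'') (Suc j) = insert j ?I" by (simp only: acc accepted_simps)
  have sp: "sparse k {..<N} (ends ` insert j ?I)" and pb: "pebbled s' (insert j ?I)"
    using s' by (auto simp: was_accepted_def)
  have inj: "inj_on ends (insert j ?I)" using pb by (simp add: pebbled_def pebbling_def)
  \<comment> \<open>Sparsity on the whole vertex set bounds the number of accepted edges, so
    \<open>free\<close> was positive and its truncated decrement is exact.\<close>
  have "card (insert j ?I) = card (ends ` insert j ?I \<inter> {..<N} \<times> {..<N})"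
    using sp by (simp add: sparse_def Int_absorb2 card_image[OF inj, symmetric])
  also have "\<dots> \<le> k * N"
  proof -
    have "{..<N} \<noteq> {}" using T_less[OF j] by (simp add: lessThan_empty_iff)
    then have "card (ends ` insert j ?I \<inter> {..<N} \<times> {..<N}) + k \<le> k * card {..<N}"
      using sp unfolding sparse_def by blast
    then show ?thesis by simp
  qed
  finally have "card (insert j ?I) \<le> k * N" .
  moreover have cI: "card (insert j ?I) = Suc (card ?I)"
    by (intro card_insert_disjoint) (auto simp: accepted_def)
  moreover have "s ''free'' 0 + card ?I = k * N" using inv by (simp add: main_inv_def)
  moreover have "s' ''free'' 0 = s ''free'' 0 - 1" using s'(2) by (simp add: was_accepted_def)
  ultimately have free: "s' ''free'' 0 + card (accepted (s' ''acc'') (Suc j)) = k * N"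
    unfolding I by linarith
  have "[m..<Suc j] = [m..<j] @ (if j < m then [] else [j])" by simp
  moreover have "filter (\<lambda>i. (?acc(j := 1)) i \<noteq> 0) [m..<j] = filter (\<lambda>i. ?acc i \<noteq> 0) [m..<j]"
    by (rule filter_cong) auto
  ultimately have out: "output_arcs s' = map (\<lambda>i. (T i, H i)) (filter (\<lambda>i. s' ''acc'' i \<noteq> 0) [m..<Suc j])"
    using inv s'(2) by (simp add: acc main_inv_def was_accepted_def del: upt_Suc fun_upd_apply) (simp del: upt_Suc)
  have "spanned (s' ''acc'') i (Suc i)" if "i < Suc j" "T i \<noteq> H i" for i
  proof (cases "i = j")
    case True
    then show ?thesis by (simp add: spanned_def I)
  next
    case False
    then have "i < j" using that by simp
    then show ?thesis using inv that(2) by (simp add: acc spanned_def main_inv_def accepted_simps)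
  qed
  moreover have "s' ''bad'' 0 = 0 \<longleftrightarrow> inj_on ends ({..<Suc j} \<inter> {..<m})"
    using inv s'(3) new(2) unfolding inj_on_ends_Suc by (simp add: main_inv_def)
  moreover have "\<forall>i\<ge>Suc j. s' ''acc'' i = 0" using inv by (simp add: acc main_inv_def)
  moreover have "\<forall>i\<in>insert j ?I. T i \<noteq> H i \<and> ends i \<notin> ends ` {..<i}"
    using inv new by (simp add: main_inv_def)
  ultimately show ?thesis
    using j s'(1) free out sp pb unfolding main_inv_def I by simp
qed

lemma process_correct:
  assumes inv: "main_inv j s" and j: "s ''j'' 0 = j" "j < M"
  shows "terminates process s (process_time N M) (\<lambda>s'. main_inv (Suc j) s' \<and> s' ''j'' 0 = j)"
    (is "terminates _ _ _ ?post")
proof -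
  let ?e = "Plus (Minus (Elem ''tail'' (Var ''j'')) (Elem ''head'' (Var ''j'')))
    (Minus (Elem ''head'' (Var ''j'')) (Elem ''tail'' (Var ''j'')))"
  let ?sets = "Set ''u'' (Elem ''tail'' (Var ''j''));; Set ''v'' (Plus (Var ''n'') (Elem ''head'' (Var ''j'')));;
    Set ''go'' (Const 1)"
  have inp: "input s" using inv by (simp add: main_inv_def)
  have "terminates process s (dup_time M +
    (1 + cost (Var ''dup'') + time (If (Minus (Var ''m'') (Var ''j'')) (Set ''bad'' (Const 1)) Skip) +
      (1 + cost ?e + (time ?sets + gather_time N M) + time Skip))) ?post"
    unfolding process_def
  proof (rule terminates_Seq, rule terminates_frame[OF dup_check_correct[OF inp j]])
    fix s1 assume frame: "\<And>x. x \<notin> writes dup_check \<Longrightarrow> s1 x = s x"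
      and dup: "s1 ''dup'' 0 \<noteq> 0 \<longleftrightarrow> ends j \<in> ends ` {..<j}"
    have s1: "s1 x = s x" if "x \<notin> {''i'', ''dup''}" for x
      using that frame[of x] by (simp add: dup_check_def dup_step_def)
    have inv1: "main_inv j s1" using inv by (rule main_inv_cong) (simp add: s1)
    then have inp1: "input s1" and sp: "sparse k {..<N} (ends ` accepted (s1 ''acc'') j)"
      and pb: "pebbled s1 (accepted (s1 ''acc'') j)" by (auto simp: main_inv_def)
    have j1: "s1 ''j'' 0 = j" using j by (simp add: s1)
    show "terminates (If (Var ''dup'') (If (Minus (Var ''m'') (Var ''j'')) (Set ''bad'' (Const 1)) Skip)
      (If ?e (?sets;; gather) Skip)) s1
      (1 + cost (Var ''dup'') + time (If (Minus (Var ''m'') (Var ''j'')) (Set ''bad'' (Const 1)) Skip) +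
        (1 + cost ?e + (time ?sets + gather_time N M) + time Skip)) ?post"
    proof (rule terminates_If)
      assume "val (Var ''dup'') s1 \<noteq> 0"
      then have "ends j \<in> ends ` {..<j}" using dup by simp
      then obtain i where i: "i < j" "ends j = ends i" by auto
      let ?c = "If (Minus (Var ''m'') (Var ''j'')) (Set ''bad'' (Const 1)) Skip"
      have "main_inv (Suc j) (sem ?c s1)"
      proof (rule main_inv_reject[OF inv1 j(2)])
        show "input (sem ?c s1)" "unchanged s1 (sem ?c s1)" "pebbled (sem ?c s1) (accepted (s1 ''acc'') j)"
          using inp1 pb by (auto simp: input_def unchanged_def output_arcs_def pebbled_def)
        \<comment> \<open>A repeated candidate inherits its justification from the earlier
          occurrence \<open>i\<close>.\<close>
        have "spanned (s1 ''acc'') i (Suc i)" if "T j \<noteq> H j"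
          using inv1 i that by (simp add: main_inv_def ends_def)
        then have "spanned (s1 ''acc'') i j" if "T j \<noteq> H j"
          using spanned_mono[OF _ _ sp] i(1) that by simp
        then show "spanned (s1 ''acc'') j j" if "T j \<noteq> H j"
          using i(2) that by (simp add: spanned_def ends_def)
        show "sem ?c s1 ''bad'' 0 = 0 \<longleftrightarrow> inj_on ends ({..<Suc j} \<inter> {..<m})"
          using inv1 inp1 j1 \<open>ends j \<in> ends ` {..<j}\<close> unfolding inj_on_ends_Suc
          by (auto simp: main_inv_def input_def)
      qed
      then show "terminates ?c s1 (time ?c) ?post"
        using j1 by (intro terminates_loop_free) auto
    next
      assume "val (Var ''dup'') s1 = 0"
      then have nodup: "ends j \<notin> ends ` {..<j}" using dup by simp
      then have badeq: "inj_on ends ({..<Suc j} \<inter> {..<m}) \<longleftrightarrow> inj_on ends ({..<j} \<inter> {..<m})"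
        by (simp add: inj_on_ends_Suc)
      have bad1: "s1 ''bad'' 0 = 0 \<longleftrightarrow> inj_on ends ({..<j} \<inter> {..<m})"
        using inv1 by (simp add: main_inv_def)
      show "terminates (If ?e (?sets;; gather) Skip) s1
        (1 + cost ?e + (time ?sets + gather_time N M) + time Skip) ?post"
      proof (rule terminates_If)
        assume "val ?e s1 = 0"
        then have "T j = H j" using inp1 j1 by (simp add: input_def)
        moreover have "main_inv (Suc j) s1" if "T j = H j"
          by (rule main_inv_reject[OF inv1 j(2) inp1 _ pb]) (use that bad1 badeq in \<open>simp_all add: unchanged_def\<close>)
        ultimately show "terminates Skip s1 (time Skip) ?post"
          using j1 by (intro terminates_loop_free) auto
      next
        assume "val ?e s1 \<noteq> 0"
        then have noloop: "T j \<noteq> H j" using inp1 j1 by (auto simp: input_def)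
        define s2 where "s2 = sem ?sets s1"
        have s2: "s2 x = s1 x" if "x \<notin> {''u'', ''v'', ''go''}" for x
          using that by (simp add: s2_def)
        have inv2: "main_inv j s2" using inv1 by (rule main_inv_cong) (simp add: s2)
        have uv: "s2 ''u'' 0 = T j" "s2 ''v'' 0 = n + H j" "s2 ''go'' 0 = 1" "s2 ''j'' 0 = j"
          using inp1 j1 by (simp_all add: s2_def input_def)
        have "gather_inv j s2 s2"
          using inv2 uv by (simp add: gather_inv_def unchanged_def main_inv_def)
        moreover have "ends j \<notin> ends ` accepted (s2 ''acc'') j"
          using nodup by (auto simp: accepted_def)
        ultimately have gathered: "terminates gather s2 (gather_time N M)
            (\<lambda>s'. was_rejected j s2 s' \<or> was_accepted j s2 s')"
          using gather_correct[of j s2] uv j(2) inv2 by (simp add: main_inv_def)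
        have "terminates gather s2 (gather_time N M) ?post"
        proof (rule terminates_frame[OF gathered])
          fix s' assume frame: "\<And>x. x \<notin> writes gather \<Longrightarrow> s' x = s2 x"
            and post: "was_rejected j s2 s' \<or> was_accepted j s2 s'"
          have s': "s' x = s2 x" if "x \<in> {''n'', ''m'', ''k'', ''M'', ''tail'', ''head'', ''bad'', ''j''}" for x
            using that frame[of x] by (auto simp: gather_def gather_step_def accept_def search_init_def
              scan_def scan_step_def flip_def flip_step_def)
          have inp': "input s'" using inv2 by (simp add: main_inv_def input_def s')
          have "main_inv (Suc j) s'"
          proof (cases "was_accepted j s2 s'")
            case True
            then show ?thesis using main_inv_accept[OF inv2 j(2) inp' True] noloop nodup s' by simp
          next
            case False
            then have rej: "was_rejected j s2 s'" using post by simp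
            show ?thesis
              by (rule main_inv_reject[OF inv2 j(2) inp'])
                (use rej bad1 badeq in \<open>auto simp: was_rejected_def spanned_def s' s2\<close>)
          qed
          then show "?post s'" using uv by (simp add: s')
        qed simp
        then show "terminates (?sets;; gather) s1 (time ?sets + gather_time N M) ?post"
          by (intro terminates_Seq[of ?sets] terminates_loop_free[of ?sets]) (simp_all add: s2_def)
      qed
    qed
  qed simp
  then show ?thesis by (rule terminates_mono) (simp_all add: process_time_def)
qed

lemma main_loop_correct:
  assumes "main_inv 0 s" "s ''j'' 0 = 0"
  shows "terminates main_loop s ((M + 1) * (15 + process_time N M)) (main_inv M)"
  unfolding main_loop_def
proof (rule terminates_mono)
  let ?e = "Minus (Var ''M'') (Var ''j'')"
  define I where "I s \<longleftrightarrow> main_inv (s ''j'' 0) s" for s :: state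
  define \<mu> where "\<mu> s = M - s ''j'' 0" for s :: state
  show "terminates (While ?e (process;; Incr ''j'')) s
    ((\<mu> s + 1) * (1 + cost ?e + (process_time N M + time (Incr ''j'')))) (\<lambda>s'. I s' \<and> val ?e s' = 0)"
  proof (rule terminates_While)
    show "I s" using assms by (simp add: I_def)
    fix s assume s: "I s" "val ?e s \<noteq> 0"
    let ?j = "s ''j'' 0"
    have inv: "main_inv ?j s" using s(1) by (simp add: I_def)
    then have "input s" by (simp add: main_inv_def)
    then have j: "?j < M" using s(2) by (simp add: input_def)
    show "terminates (process;; Incr ''j'') s (process_time N M + time (Incr ''j'')) (\<lambda>s'. I s' \<and> \<mu> s' < \<mu> s)"
    proof (rule terminates_Seq, rule terminates_mono[OF process_correct[OF inv refl j]])
      fix s' assume s': "main_inv (Suc ?j) s' \<and> s' ''j'' 0 = ?j"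
      have "main_inv (Suc ?j) (sem (Incr ''j'') s')"
        by (rule main_inv_cong[of _ s']) (use s' in auto)
      then show "terminates (Incr ''j'') s' (time (Incr ''j'')) (\<lambda>s'. I s' \<and> \<mu> s' < \<mu> s)"
        using s' j by (intro terminates_loop_free) (simp_all add: I_def \<mu>_def)
    qed simp
  qed
  show "(\<mu> s + 1) * (1 + cost ?e + (process_time N M + time (Incr ''j''))) \<le> (M + 1) * (15 + process_time N M)"
    by (intro mult_le_mono) (simp_all add: \<mu>_def)
  fix s' assume s': "I s' \<and> val ?e s' = 0"
  then have "s' ''j'' 0 = M" by (auto simp: I_def main_inv_def input_def)
  then show "main_inv M s'" using s' by (simp add: I_def)
qed

end

section \<open>Initialisation and the complete program\<close>

definition pebble_step :: com where
  "pebble_step =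
     Assign ''peb'' (Var ''i'') (Var ''k'');; Set ''free'' (Plus (Var ''free'') (Var ''k''));; Incr ''i''"

definition pair_step :: com where
  "pair_step =
     Assign ''tail'' (Var ''M'') (Var ''a'');; Assign ''head'' (Var ''M'') (Var ''b'');; Incr ''M'';; Incr ''b'';;
     If (Minus (Var ''n'') (Var ''b'')) Skip (Set ''b'' (Const 0);; Incr ''a'')"

definition decide :: com where
  "decide =
     If (Var ''bad'') (Set ''answer'' (Const 0))
       (If (Plus (Minus (Var ''free'') (Var ''k'')) (Minus (Var ''k'') (Var ''free'')))
         (Set ''answer'' (Const 0)) (Set ''answer'' (Const 1)))"

text \<open>The machine cannot multiply, so the total \<open>k * N\<close> of free pebbles is
  accumulated vertex by vertex. The counters \<open>i\<close>, \<open>a\<close>, \<open>b\<close>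
  and \<open>j\<close> start at \<open>0\<close> because the memory is \<open>0\<close> outside the
  input. The generated pairs include loops and repeat the input arcs; \<open>process\<close> passes
  over both.\<close>

definition augment :: com where
  "augment =
     Set ''N'' (Plus (Var ''n'') (Var ''n''));;
     While (Minus (Var ''N'') (Var ''i'')) pebble_step;;
     Set ''M'' (Var ''m'');;
     While (Minus (Var ''n'') (Var ''a'')) pair_step;;
     main_loop;; decide"

definition augment_time :: "nat \<Rightarrow> nat \<Rightarrow> nat" where
  "augment_time N M = 7 + ((N + 1) * (6 + time pebble_step) + (4 + ((M + 1) * (6 + time pair_step) +
     ((M + 1) * (15 + process_time N M) + time decide))))"

definition pebbles_ready :: "nat \<Rightarrow> (nat \<times> nat) list \<Rightarrow> nat \<Rightarrow> nat \<Rightarrow> state \<Rightarrow> bool" where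
  "pebbles_ready n es k i s \<longleftrightarrow> i \<le> 2 * n \<and> s ''i'' 0 = i \<and> s ''N'' 0 = 2 * n \<and>
     (\<forall>v<i. s ''peb'' v = k) \<and> s ''free'' 0 = k * i \<and>
     (\<forall>x. x \<notin> {''i'', ''N'', ''peb'', ''free''} \<longrightarrow> s x = input_state n es k x)"

lemma pebble_loop_correct:
  assumes "pebbles_ready n es k 0 s"
  shows "terminates (While (Minus (Var ''N'') (Var ''i'')) pebble_step) s
    ((2 * n + 1) * (6 + time pebble_step)) (pebbles_ready n es k (2 * n))"
proof (rule terminates_mono)
  let ?e = "Minus (Var ''N'') (Var ''i'')"
  define I where "I s \<longleftrightarrow> pebbles_ready n es k (s ''i'' 0) s" for s :: state
  define \<mu> where "\<mu> s = 2 * n - s ''i'' 0" for s :: state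
  show "terminates (While ?e pebble_step) s ((\<mu> s + 1) * (1 + cost ?e + time pebble_step))
    (\<lambda>s'. I s' \<and> val ?e s' = 0)"
  proof (rule terminates_While)
    show "I s" using assms by (simp add: I_def pebbles_ready_def)
    fix s assume s: "I s" "val ?e s \<noteq> 0"
    then have i: "s ''i'' 0 < 2 * n" by (simp add: I_def pebbles_ready_def)
    have k: "s ''k'' 0 = k" using s(1) by (simp add: I_def pebbles_ready_def input_state_def)
    have "I (sem pebble_step s)"
      using s(1) i k by (simp add: I_def pebbles_ready_def pebble_step_def less_Suc_eq)
    then show "terminates pebble_step s (time pebble_step) (\<lambda>s'. I s' \<and> \<mu> s' < \<mu> s)"
      using i by (intro terminates_loop_free) (simp_all add: \<mu>_def pebble_step_def)
  qed
  show "(\<mu> s + 1) * (1 + cost ?e + time pebble_step) \<le> (2 * n + 1) * (6 + time pebble_step)"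
    by (intro mult_le_mono) (simp_all add: \<mu>_def)
  fix s' assume s': "I s' \<and> val ?e s' = 0"
  then have "s' ''i'' 0 = 2 * n" by (auto simp: I_def pebbles_ready_def)
  then show "pebbles_ready n es k (2 * n) s'" using s' by (simp add: I_def)
qed

definition pairs_listed :: "nat \<Rightarrow> (nat \<times> nat) list \<Rightarrow> nat \<Rightarrow> nat \<Rightarrow> state \<Rightarrow> bool" where
  "pairs_listed n es a b s \<longleftrightarrow> s ''n'' 0 = n \<and> s ''M'' 0 = length es + a * n + b \<and>
     (\<forall>i<length es. (s ''tail'' i, s ''head'' i) = es ! i) \<and>
     (\<forall>i. length es \<le> i \<longrightarrow> i < s ''M'' 0 \<longrightarrow> s ''tail'' i < n \<and> s ''head'' i < n) \<and>
     (\<forall>x y. x < a \<or> x = a \<and> y < b \<longrightarrow> y < n \<longrightarrow>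
        (\<exists>i. length es \<le> i \<and> i < s ''M'' 0 \<and> s ''tail'' i = x \<and> s ''head'' i = y))"

lemma pairs_listed_add:
  assumes "pairs_listed n es a b s" "a < n" "b < n"
    and s': "s' ''n'' 0 = n" "s' ''M'' 0 = s ''M'' 0 + 1" "s' ''tail'' = (s ''tail'')(s ''M'' 0 := a)"
      "s' ''head'' = (s ''head'')(s ''M'' 0 := b)"
  shows "pairs_listed n es a (b + 1) s'"
  unfolding pairs_listed_def
proof (intro conjI allI impI)
  have M: "s ''M'' 0 = length es + a * n + b" using assms(1) by (simp add: pairs_listed_def)
  fix i assume "i < length es"
  then show "(s' ''tail'' i, s' ''head'' i) = es ! i"
    using assms(1) M by (simp add: pairs_listed_def s')
next
  fix x y assume xy: "x < a \<or> x = a \<and> y < b + 1" "y < n"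
  show "\<exists>i. length es \<le> i \<and> i < s' ''M'' 0 \<and> s' ''tail'' i = x \<and> s' ''head'' i = y"
  proof (cases "x = a \<and> y = b")
    case True
    then show ?thesis using assms(1) by (intro exI[of _ "s ''M'' 0"]) (simp add: s' pairs_listed_def)
  next
    case False
    then have "x < a \<or> x = a \<and> y < b" using xy by auto
    then obtain i where "length es \<le> i" "i < s ''M'' 0" "s ''tail'' i = x" "s ''head'' i = y"
      using assms(1) xy(2) unfolding pairs_listed_def by blast
    then show ?thesis by (intro exI[of _ i]) (simp add: s')
  qed
qed (use assms in \<open>auto simp: pairs_listed_def less_Suc_eq\<close>)

lemma pairs_listed_next_row: "pairs_listed n es a n s \<Longrightarrow> pairs_listed n es (a + 1) 0 s"
  by (auto simp: pairs_listed_def less_Suc_eq)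

lemma pair_loop_correct:
  assumes "pairs_listed n es 0 0 s" "s ''a'' 0 = 0" "s ''b'' 0 = 0" "0 < n"
  shows "terminates (While (Minus (Var ''n'') (Var ''a'')) pair_step) s
    ((n * n + 1) * (6 + time pair_step)) (pairs_listed n es n 0)"
proof (rule terminates_mono)
  let ?e = "Minus (Var ''n'') (Var ''a'')"
  \<comment> \<open>Pairs are listed row by row. A completed row wraps at once, so \<open>b\<close>
    stays below \<open>n\<close> and \<open>a * n + b\<close> counts the pairs listed so
    far.\<close>
  define I where "I s \<longleftrightarrow> s ''a'' 0 \<le> n \<and> s ''b'' 0 < n \<and> (s ''a'' 0 = n \<longrightarrow> s ''b'' 0 = 0) \<and>
    pairs_listed n es (s ''a'' 0) (s ''b'' 0) s" for s :: state
  define \<mu> where "\<mu> s = n * n - (s ''a'' 0 * n + s ''b'' 0)" for s :: state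
  show "terminates (While ?e pair_step) s ((\<mu> s + 1) * (1 + cost ?e + time pair_step))
    (\<lambda>s'. I s' \<and> val ?e s' = 0)"
  proof (rule terminates_While)
    show "I s" using assms by (simp add: I_def)
    fix s assume s: "I s" "val ?e s \<noteq> 0"
    let ?a = "s ''a'' 0" and ?b = "s ''b'' 0" and ?s = "sem pair_step s"
    have inv: "pairs_listed n es ?a ?b s" "?b < n" using s(1) by (auto simp: I_def)
    have a: "?a < n" using s inv by (simp add: pairs_listed_def)
    have n: "s ''n'' 0 = n" using inv by (simp add: pairs_listed_def)
    have added: "pairs_listed n es ?a (?b + 1) ?s"
      by (rule pairs_listed_add[OF inv(1) a inv(2)]) (simp_all add: pair_step_def n)
    have "?a * n + ?b < ?a * n + n" using inv(2) by simp
    also have "\<dots> = (?a + 1) * n" by simp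
    also have "\<dots> \<le> n * n" using a by (intro mult_right_mono) auto
    finally have less: "?a * n + ?b < n * n" .
    have "I ?s \<and> ?s ''a'' 0 * n + ?s ''b'' 0 = ?a * n + ?b + 1"
    proof (cases "?b + 1 < n")
      case True
      then have "?s ''a'' 0 = ?a" "?s ''b'' 0 = ?b + 1" by (simp_all add: pair_step_def n)
      then show ?thesis using True added a by (simp add: I_def)
    next
      case False
      then have b: "?b + 1 = n" using inv(2) by simp
      have "?s ''a'' 0 = ?a + 1" "?s ''b'' 0 = 0" using b by (simp_all add: pair_step_def n)
      then show ?thesis using pairs_listed_next_row[of n es ?a ?s] added a b by (auto simp: I_def)
    qed
    then show "terminates pair_step s (time pair_step) (\<lambda>s'. I s' \<and> \<mu> s' < \<mu> s)"
      using less by (intro terminates_loop_free) (simp add: pair_step_def, simp_all add: \<mu>_def)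
  qed
  show "(\<mu> s + 1) * (1 + cost ?e + time pair_step) \<le> (n * n + 1) * (6 + time pair_step)"
    by (intro mult_le_mono) (simp_all add: \<mu>_def)
  fix s' assume s': "I s' \<and> val ?e s' = 0"
  then have "s' ''a'' 0 = n" by (auto simp: I_def pairs_listed_def)
  moreover from this have "s' ''b'' 0 = 0" using s' by (simp add: I_def)
  moreover have "pairs_listed n es (s' ''a'' 0) (s' ''b'' 0) s'" using s' by (simp add: I_def)
  ultimately show "pairs_listed n es n 0 s'" by simp
qed

definition result_inv :: "nat \<Rightarrow> (nat \<times> nat) list \<Rightarrow> nat \<Rightarrow> state \<Rightarrow> bool" where
  "result_inv n es k s \<longleftrightarrow> (\<exists>M T H. pebble_game n (length es) M T H \<and>
     pebble_game.main_inv n (length es) k M T H M s \<and>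
     (\<forall>i<length es. (T i, H i) = es ! i) \<and> {..<n} \<times> {..<n} \<subseteq> (\<lambda>i. (T i, H i)) ` {..<M})"

lemma augment_correct:
  assumes n: "0 < n" and es: "\<And>u v. (u, v) \<in> set es \<Longrightarrow> u < n \<and> v < n"
  shows "terminates augment (input_state n es k) (augment_time (2 * n) (length es + n * n))
    (\<lambda>s'. \<exists>s. result_inv n es k s \<and> s' = sem decide s)"
proof -
  let ?M = "length es + n * n" and ?m = "length es"
  let ?s = "input_state n es k"
  have init: "pebbles_ready n es k 0 (sem (Set ''N'' (Plus (Var ''n'') (Var ''n''))) ?s)"
    by (auto simp: pebbles_ready_def) (simp_all add: input_state_def)
  have "terminates augment ?s (time (Set ''N'' (Plus (Var ''n'') (Var ''n''))) +
    ((2 * n + 1) * (6 + time pebble_step) + (time (Set ''M'' (Var ''m'')) +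
    ((n * n + 1) * (6 + time pair_step) + ((?M + 1) * (15 + process_time (2 * n) ?M) + time decide)))))
    (\<lambda>s'. \<exists>s. result_inv n es k s \<and> s' = sem decide s)"
    unfolding augment_def
  proof (rule terminates_Seq, rule terminates_loop_free, simp, rule terminates_Seq,
      rule terminates_mono[OF pebble_loop_correct[OF init]], rule terminates_Seq)
    fix s1 assume s1: "pebbles_ready n es k (2 * n) s1"
    let ?s1 = "sem (Set ''M'' (Var ''m'')) s1"
    have fresh: "s1 x = input_state n es k x" if "x \<notin> {''i'', ''N'', ''peb'', ''free''}" for x
      using s1 that by (simp add: pebbles_ready_def)
    have listed: "pairs_listed n es 0 0 ?s1"
      by (simp add: pairs_listed_def fresh) (simp add: input_state_def)
    have ab: "?s1 ''a'' 0 = 0" "?s1 ''b'' 0 = 0" by (simp_all add: fresh) (simp_all add: input_state_def)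
    show "terminates (Set ''M'' (Var ''m'')) s1 (time (Set ''M'' (Var ''m'')))
      (\<lambda>s'. terminates (While (Minus (Var ''n'') (Var ''a'')) pair_step;; main_loop;; decide) s'
        ((n * n + 1) * (6 + time pair_step) + ((?M + 1) * (15 + process_time (2 * n) ?M) + time decide))
        (\<lambda>s'. \<exists>s. result_inv n es k s \<and> s' = sem decide s))"
    proof (rule terminates_loop_free, simp, rule terminates_Seq,
        rule terminates_frame[OF pair_loop_correct[OF listed ab n]])
      fix s2 assume frame: "\<And>x. x \<notin> writes (While (Minus (Var ''n'') (Var ''a'')) pair_step) \<Longrightarrow> s2 x = ?s1 x"
        and s2: "pairs_listed n es n 0 s2"
      let ?T = "s2 ''tail''" and ?H = "s2 ''head''"
      have eq: "s2 x = s1 x" if "x \<notin> {''tail'', ''head'', ''M'', ''a'', ''b''}" for x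
        using frame[of x] that by (simp add: pair_step_def)
      have M: "s2 ''M'' 0 = ?M" using s2 by (simp add: pairs_listed_def)
      have esi: "\<forall>i<?m. (?T i, ?H i) = es ! i" using s2 by (simp add: pairs_listed_def)
      have less: "?T i < n \<and> ?H i < n" if "i < ?M" for i
      proof (cases "i < ?m")
        case True
        then show ?thesis using esi es[of "?T i" "?H i"] by simp
      next
        case False
        then show ?thesis using s2 that M by (simp add: pairs_listed_def)
      qed
      interpret pebble_game n ?m k ?M ?T ?H by unfold_locales (use less in auto)
      have acc: "accepted (s2 ''acc'') 0 = {}" by (simp add: accepted_def)
      have zero: "s2 x = (\<lambda>_. 0)" if "x \<in> {''acc'', ''mark'', ''cnt'', ''bad'', ''newcount'', ''j''}" for x
        using that by (auto simp: eq fresh) (simp_all add: input_state_def)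
      have inp: "input s2" using M by (simp add: input_def eq fresh) (simp add: input_state_def)
      have "sparse k {..<2 * n} {}"
        using card_gt_0_iff finite_subset unfolding sparse_def by (fastforce simp: Suc_le_eq)
      moreover have "pebbled s2 {}"
        using s1 by (simp add: pebbled_def pebbling_def zero) (simp add: eq pebbles_ready_def)
      moreover have "s2 ''free'' 0 = k * (2 * n)" using s1 by (simp add: eq pebbles_ready_def)
      ultimately have "main_inv 0 s2"
        unfolding main_inv_def acc using inp by (simp add: zero output_arcs_def)
      moreover have "{..<n} \<times> {..<n} \<subseteq> (\<lambda>i. (?T i, ?H i)) ` {..<?M}"
        using s2 M by (force simp: pairs_listed_def)
      then have "main_inv ?M s3 \<Longrightarrow> result_inv n es k s3" for s3
        unfolding result_inv_def using esi pebble_game_axioms by blast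
      ultimately have looped: "terminates main_loop s2 ((?M + 1) * (15 + process_time (2 * n) ?M)) (result_inv n es k)"
        using terminates_mono[OF main_loop_correct] by (simp add: zero)
      have "terminates decide s3 (time decide) (\<lambda>s'. \<exists>s. result_inv n es k s \<and> s' = sem decide s)"
        if "result_inv n es k s3" for s3
        using that by (rule_tac terminates_loop_free) (simp add: decide_def, blast, simp)
      from terminates_mono[OF looped this order_refl]
      show "terminates (main_loop;; decide) s2 ((?M + 1) * (15 + process_time (2 * n) ?M) + time decide)
        (\<lambda>s'. \<exists>s. result_inv n es k s \<and> s' = sem decide s)"
        by (rule terminates_Seq)
    qed simp_all
  qed simp_all
  moreover have "(n * n + 1) * (6 + time pair_step) \<le> (?M + 1) * (6 + time pair_step)"
    by (intro mult_le_mono) auto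
  ultimately show ?thesis
    by (rule_tac terminates_mono) (assumption, assumption, simp add: augment_time_def)
qed

context pebble_game
begin

text \<open>The edges accepted among the first \<open>J\<close> candidates are the greedy result for
  that prefix. The prefix of the input arcs, with the new arcs as \<open>B\<close>, will give
  minimality; the full list with empty \<open>B\<close> will give the feasibility test.\<close>

lemma main_inv_lower_bound:
  assumes inv: "main_inv j s" and J: "J \<le> j" and B: "finite B"
    and H: "\<And>i. i < k \<Longrightarrow> K i \<subseteq> (ends ` {i. i < J \<and> T i \<noteq> H i} \<union> B) \<inter> {..<N} \<times> {..<N}"
      "\<And>i. i < k \<Longrightarrow> {..<N} \<times> {..<N} \<subseteq> conn (K i)"
      "\<And>i i'. i < k \<Longrightarrow> i' < k \<Longrightarrow> i \<noteq> i' \<Longrightarrow> K i \<inter> K i' = {}"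
  shows "k * N \<le> card B + card (accepted (s ''acc'') J) + k"
proof -
  let ?I = "accepted (s ''acc'') J"
  have sub: "?I \<subseteq> accepted (s ''acc'') j" using accepted_mono[OF J] .
  have "inj_on ends (accepted (s ''acc'') j)" using inv by (simp add: main_inv_def pebbled_def pebbling_def)
  then have card: "card (ends ` ?I) = card ?I" using sub by (intro card_image) (rule inj_on_subset)
  have spj: "sparse k {..<N} (ends ` accepted (s ''acc'') j)" using inv by (simp add: main_inv_def)
  have sp: "sparse k {..<N} (ends ` ?I)"
    unfolding sparse_def
  proof (intro conjI allI impI)
    show "ends ` ?I \<subseteq> {..<N} \<times> {..<N}" using spj sub by (auto simp: sparse_def)
    fix X assume X: "X \<subseteq> {..<N}" "X \<noteq> {}"
    have "card (ends ` ?I \<inter> X \<times> X) \<le> card (ends ` accepted (s ''acc'') j \<inter> X \<times> X)"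
      using sub by (intro card_mono) (auto simp: accepted_simps)
    moreover have "card (ends ` accepted (s ''acc'') j \<inter> X \<times> X) + k \<le> k * card X"
      using spj X by (simp add: sparse_def)
    ultimately show "card (ends ` ?I \<inter> X \<times> X) + k \<le> k * card X" by simp
  qed
  have "k * card {..<N} \<le> card B + card (ends ` ?I) + k"
  proof (rule augmentation_lower_bound[OF _ sp _ B H])
    fix x y assume "(x, y) \<in> ends ` {i. i < J \<and> T i \<noteq> H i}"
    then obtain i where i: "i < J" "T i \<noteq> H i" "(x, y) = ends i" by auto
    then have "spanned (s ''acc'') i (Suc i)" using inv J by (simp add: main_inv_def)
    then have "spanned (s ''acc'') i J" using spanned_mono[OF _ _ sp] i(1) by simp
    then show "(x, y) \<in> ends ` ?I \<or> (\<exists>X\<subseteq>{..<N}. x \<in> X \<and> y \<in> X \<and> tight k (ends ` ?I) X)"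
      using i(3) by (simp add: spanned_def ends_def)
  qed simp_all
  then show ?thesis by (simp add: card)
qed

end

section \<open>Correctness of the answer and minimality of the output\<close>

lemma ends_eq_bip_pairs: "(\<lambda>i. (T i, n + H i)) ` A = bip_pairs n ((\<lambda>i. (T i, H i)) ` A)"
  by (auto simp: bip_pairs_def image_image)

lemma card_bip_pairs: "card (bip_pairs n A) = card A"
  unfolding bip_pairs_def by (rule card_image) (auto simp: inj_on_def)

lemma result_correct:
  assumes n: "3 \<le> n" and es: "\<And>u v. (u, v) \<in> set es \<Longrightarrow> u < n \<and> v < n \<and> u \<noteq> v"
    and res: "result_inv n es k s"
  shows "\<exists>A'. admissible_augmentation k (digraph_of n es) A' \<Longrightarrow>
      s ''bad'' 0 = 0 \<and> s ''free'' 0 = k"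
    and "s ''bad'' 0 = 0 \<Longrightarrow> s ''free'' 0 = k \<Longrightarrow>
      distinct (output_arcs s) \<and> minimum_augmentation k (digraph_of n es) (set (output_arcs s))"
proof -
  from res obtain M T H where game: "pebble_game n (length es) M T H"
    and inv: "pebble_game.main_inv n (length es) k M T H M s"
    and esi: "\<And>i. i < length es \<Longrightarrow> (T i, H i) = es ! i"
    and all: "{..<n} \<times> {..<n} \<subseteq> (\<lambda>i. (T i, H i)) ` {..<M}"
    by (auto simp: result_inv_def)
  let ?m = "length es"
  interpret pebble_game n ?m k M T H by fact
  let ?D = "digraph_of n es" and ?I = "accepted (s ''acc'') M" and ?J = "accepted (s ''acc'') ?m"
  let ?th = "\<lambda>i. (T i, H i)"
  have ends: "ends = (\<lambda>i. (T i, n + H i))" by (simp add: ends_def fun_eq_iff)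
  have ends_inj: "ends i = ends j \<longleftrightarrow> ?th i = ?th j" for i j by (simp add: ends_def)
  have esT: "set es = ?th ` {..<?m}"
    using esi by (auto simp: set_conv_nth image_iff)
  have noloop_es: "{i. i < ?m \<and> T i \<noteq> H i} = {..<?m}"
  proof -
    have "?th i \<in> set es" if "i < ?m" for i using esT that by blast
    then show ?thesis using es by blast
  qed
  have bad: "s ''bad'' 0 = 0 \<longleftrightarrow> distinct es"
  proof -
    have "{..<M} \<inter> {..<?m} = {..<?m}" using m_le by auto
    moreover have "inj_on ends {..<?m} \<longleftrightarrow> distinct es"
      using esi by (auto simp: inj_on_def ends_inj distinct_conv_nth)
    ultimately show ?thesis using inv by (simp add: main_inv_def)
  qed
  have pb: "pebbling N k ?I ends (s ''P'') (s ''Q'') (s ''peb'')"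
    and sp: "sparse k {..<N} (ends ` ?I)" and free: "s ''free'' 0 + card ?I = k * N"
    and new: "\<And>i. i \<in> ?I \<Longrightarrow> T i \<noteq> H i \<and> ends i \<notin> ends ` {..<i}"
    and out: "output_arcs s = map ?th (filter (\<lambda>i. s ''acc'' i \<noteq> 0) [?m..<M])"
    using inv by (auto simp: main_inv_def pebbled_def)
  have injI: "inj_on ends ?I" using pb by (simp add: pebbling_def)
  have lower: "k * N \<le> card B + card ?J + k" "k * N \<le> card ?I + k"
    if adm: "admissible_augmentation k ?D B" for B
  proof -
    note adm' = admissible_imp_conn[OF adm]
    obtain K where K: "\<And>i. i < k \<Longrightarrow> K i \<subseteq> bip_pairs n (set es \<union> B)"
        "\<And>i. i < k \<Longrightarrow> {..<N} \<times> {..<N} \<subseteq> conn (K i)"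
        "\<And>i j. i < k \<Longrightarrow> j < k \<Longrightarrow> i \<noteq> j \<Longrightarrow> K i \<inter> K j = {}"
      using adm'(5) by metis
    have V: "bip_pairs n (set es \<union> B) \<subseteq> {..<N} \<times> {..<N}"
      using adm'(3) by (auto simp: bip_pairs_def)
    have "k * N \<le> card (bip_pairs n B) + card ?J + k"
    proof (rule main_inv_lower_bound[OF inv m_le _ _ K(2,3)])
      show "finite (bip_pairs n B)" using adm'(2) by (simp add: bip_pairs_def)
      have "ends ` {..<?m} = bip_pairs n (set es)" by (simp add: ends ends_eq_bip_pairs esT)
      moreover have "bip_pairs n (set es \<union> B) = bip_pairs n (set es) \<union> bip_pairs n B"
        by (simp add: bip_pairs_def image_Un)
      ultimately show "K i \<subseteq> (ends ` {i. i < ?m \<and> T i \<noteq> H i} \<union> bip_pairs n B) \<inter> {..<N} \<times> {..<N}" if "i < k" for i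
        using K(1)[OF that] V unfolding noloop_es by blast
    qed
    then show "k * N \<le> card B + card ?J + k" by (simp add: card_bip_pairs)
    have "k * N \<le> card ({} :: (nat \<times> nat) set) + card ?I + k"
    proof (rule main_inv_lower_bound[OF inv order_refl _ _ K(2,3)])
      have "set es \<union> B \<subseteq> ?th ` {i. i < M \<and> T i \<noteq> H i}"
      proof
        fix e assume e: "e \<in> set es \<union> B"
        then have "e \<in> ?th ` {..<M}" using adm'(3) all by blast
        moreover have "fst e \<noteq> snd e" using adm'(4) e by (cases e) auto
        ultimately show "e \<in> ?th ` {i. i < M \<and> T i \<noteq> H i}" by auto
      qed
      then have "bip_pairs n (set es \<union> B) \<subseteq> ends ` {i. i < M \<and> T i \<noteq> H i}"
        unfolding ends ends_eq_bip_pairs by (simp add: bip_pairs_def image_mono)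
      then show "K i \<subseteq> (ends ` {i. i < M \<and> T i \<noteq> H i} \<union> {}) \<inter> {..<N} \<times> {..<N}" if "i < k" for i
        using K(1)[OF that] V by blast
    qed simp
    then show "k * N \<le> card ?I + k" by simp
  qed
  have ne: "{..<N} \<noteq> {}" using n by (simp add: lessThan_empty_iff)
  have "card (ends ` ?I \<inter> {..<N} \<times> {..<N}) + k \<le> k * card {..<N}"
    using sp ne unfolding sparse_def by blast
  moreover have FV: "ends ` ?I \<inter> {..<N} \<times> {..<N} = ends ` ?I" using sp by (auto simp: sparse_def)
  ultimately have upper: "card ?I + k \<le> k * N" by (simp add: card_image[OF injI])
  show "s ''bad'' 0 = 0 \<and> s ''free'' 0 = k" if "\<exists>A'. admissible_augmentation k ?D A'"
  proof -
    from that obtain B where B: "admissible_augmentation k ?D B" by blast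
    have "distinct es" using admissible_imp_conn(1)[OF B] .
    then show ?thesis using lower(2)[OF B] upper free bad by linarith
  qed
  assume "s ''bad'' 0 = 0" and k: "s ''free'' 0 = k"
  then have dist: "distinct es" using bad by simp
  let ?A = "set (output_arcs s)"
  have A: "?A = ?th ` (?I - ?J)" using out m_le by (auto simp: accepted_def)
  have th_inj: "inj_on ?th ?I" using injI by (simp add: inj_on_def ends_inj)
  have distA: "distinct (output_arcs s)"
    unfolding out distinct_map using th_inj by (auto simp: accepted_def inj_on_def)
  have cardA: "card ?A + card ?J = card ?I"
  proof -
    have "?J \<subseteq> ?I" using accepted_mono m_le by blast
    moreover have "card ?A = card (?I - ?J)" unfolding A using th_inj by (intro card_image) (auto simp: inj_on_def)
    ultimately show ?thesis using card_Diff_subset[of ?J ?I] card_mono[of ?I ?J] by (simp add: accepted_simps)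
  qed
  have "tight k (ends ` ?I) {..<N}"
    using FV free k by (simp add: tight_def card_image[OF injI])
  then obtain c where c: "\<And>e. e \<in> ends ` ?I \<Longrightarrow> c e < k"
      "\<And>i. i < k \<Longrightarrow> {..<N} \<times> {..<N} \<subseteq> conn {e \<in> ends ` ?I. c e = i}"
    using tree_packing[OF _ ne sp] by blast
  have sub: "ends ` ?I \<subseteq> bip_pairs n (set es \<union> ?A)"
  proof -
    have "?th i \<in> set es \<union> ?A" if "i \<in> ?I" for i
      using that by (cases "i < ?m") (auto simp: esT A accepted_def)
    then have "?th ` ?I \<subseteq> set es \<union> ?A" by blast
    then show ?thesis unfolding ends ends_eq_bip_pairs bip_pairs_def by (rule image_mono)
  qed
  have "admissible_augmentation k ?D ?A"
  proof (rule conn_imp_admissible[OF n dist, where H = "\<lambda>i. {e \<in> ends ` ?I. c e = i}"])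
    show "set es \<union> ?A \<subseteq> {..<n} \<times> {..<n}"
      using es T_less H_less by (auto simp: A accepted_def)
    show "set es \<inter> ?A = {}"
    proof -
      \<comment> \<open>A candidate accepted at a position from \<open>?m\<close> on passed the
        duplicate check, so it is not parallel to an old arc.\<close>
      have "?th i \<notin> ?th ` {..<?m}" if "i \<in> ?I - ?J" for i
      proof
        assume "?th i \<in> ?th ` {..<?m}"
        then obtain i' where "i' < ?m" "?th i = ?th i'" by auto
        moreover have "?m \<le> i" using that by (auto simp: accepted_def)
        ultimately have "ends i \<in> ends ` {..<i}" using ends_inj[of i i'] by force
        then show False using new[of i] that by simp
      qed
      then have "\<forall>e\<in>?th ` (?I - ?J). e \<notin> ?th ` {..<?m}" by simp
      then show ?thesis unfolding A esT by (meson disjoint_iff)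
    qed
    show "u \<noteq> v" if "(u, v) \<in> set es \<union> ?A" for u v
    proof (cases "(u, v) \<in> set es")
      case False
      then have "(u, v) \<in> ?th ` (?I - ?J)" using that unfolding A by blast
      then show ?thesis using new by auto
    qed (use es in blast)
    show "{e \<in> ends ` ?I. c e = i} \<subseteq> bip_pairs n (set es \<union> ?A)" for i using sub by blast
    show "{..<N} \<times> {..<N} \<subseteq> conn {e \<in> ends ` ?I. c e = i}" if "i < k" for i using c(2)[OF that] .
  qed auto
  \<comment> \<open>The output has \<open>card ?I - card ?J = k * N - k - card ?J\<close> arcs,
    which is the first lower bound.\<close>
  moreover have "card ?A \<le> card B" if "admissible_augmentation k ?D B" for B
    using lower(1)[OF that] upper free k cardA by linarith
  ultimately show "distinct (output_arcs s) \<and> minimum_augmentation k ?D ?A"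
    using distA by (simp add: minimum_augmentation_def)
qed

section \<open>The polynomial bound on the running time\<close>

definition poly_fun :: "(nat \<Rightarrow> nat) \<Rightarrow> bool" where
  "poly_fun f \<longleftrightarrow> (\<exists>p. \<forall>x. f x = poly p x)"

lemma poly_fun_intros:
  "poly_fun (\<lambda>x. x)" "poly_fun (\<lambda>x. c)"
  "poly_fun f \<Longrightarrow> poly_fun g \<Longrightarrow> poly_fun (\<lambda>x. f x + g x)"
  "poly_fun f \<Longrightarrow> poly_fun g \<Longrightarrow> poly_fun (\<lambda>x. f x * g x)"
proof -
  show "poly_fun (\<lambda>x. x)" unfolding poly_fun_def by (rule exI[of _ "[:0, 1:]"]) simp
  show "poly_fun (\<lambda>x. c)" unfolding poly_fun_def by (rule exI[of _ "[:c:]"]) simp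
  show "poly_fun f \<Longrightarrow> poly_fun g \<Longrightarrow> poly_fun (\<lambda>x. f x + g x)"
    unfolding poly_fun_def by (metis poly_add)
  show "poly_fun f \<Longrightarrow> poly_fun g \<Longrightarrow> poly_fun (\<lambda>x. f x * g x)"
    unfolding poly_fun_def by (metis poly_mult)
qed

lemmas augment_time_defs = augment_time_def process_time_def dup_time_def gather_time_def
  gather_step_time_def scan_time_def flip_time_def

lemma augment_time_mono: "N \<le> N' \<Longrightarrow> M \<le> M' \<Longrightarrow> augment_time N M \<le> augment_time N' M'"
  unfolding augment_time_defs by (intro add_mono mult_le_mono order_refl)

lemma poly_fun_augment_time: "poly_fun f \<Longrightarrow> poly_fun g \<Longrightarrow> poly_fun (\<lambda>x. augment_time (f x) (g x))"
  unfolding augment_time_defs by (intro poly_fun_intros)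

theorem theorem4p4:
  shows "\<exists>(c :: com) (p :: nat poly). \<forall>(n :: nat) (es :: (nat \<times> nat) list) (k :: nat).
    (let D = digraph_of n es in
      fin_digraph D \<and> loopfree_digraph D \<and> 3 \<le> card (verts D) \<longrightarrow>
      (\<exists>t s'. runs c (input_state n es k) t s' \<and>
         t \<le> poly p (input_size n es k) \<and>
         output_answer s' = (if \<exists>A'. admissible_augmentation k D A' then 1 else 0) \<and>
         ((\<exists>A'. admissible_augmentation k D A') \<longrightarrow>
            distinct (output_arcs s') \<and> minimum_augmentation k D (set (output_arcs s')))))"
proof -
  \<comment> \<open>With \<open>z\<close> the input size, \<open>n\<close> and the number of arcs
    are at most \<open>z\<close>, so there are at most \<open>2 * z\<close> bipartite vertices and
    \<open>z + z * z\<close> candidates. The value of \<open>k\<close> does not enter the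
    bound.\<close>
  have "poly_fun (\<lambda>z. augment_time (2 * z) (z + z * z))"
    by (intro poly_fun_augment_time poly_fun_intros)
  then obtain p where p: "\<And>z. augment_time (2 * z) (z + z * z) = poly p z"
    by (auto simp: poly_fun_def)
  show ?thesis
    unfolding Let_def
  proof (intro exI[of _ augment] exI[of _ p] allI impI)
    fix n es k
    let ?D = "digraph_of n es" and ?z = "input_size n es k"
    assume D: "fin_digraph ?D \<and> loopfree_digraph ?D \<and> 3 \<le> card (verts ?D)"
    then interpret loopfree_digraph ?D by simp
    have n: "3 \<le> n" using D by (simp add: digraph_of_def)
    have es: "u < n \<and> v < n \<and> u \<noteq> v" if "(u, v) \<in> set es" for u v
    proof -
      from that obtain i where "i < length es" "es ! i = (u, v)" by (auto simp: in_set_conv_nth)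
      then show ?thesis
        using tail_in_verts[of i] head_in_verts[of i] no_loops[of i] by (simp add: digraph_of_def)
    qed
    have "terminates augment (input_state n es k) (augment_time (2 * n) (length es + n * n))
        (\<lambda>s'. \<exists>s. result_inv n es k s \<and> s' = sem decide s)"
      using n es by (intro augment_correct) auto
    then obtain t s where run: "runs augment (input_state n es k) t (sem decide s)"
        "t \<le> augment_time (2 * n) (length es + n * n)" and res: "result_inv n es k s"
      by (auto simp: terminates_def)
    have "augment_time (2 * n) (length es + n * n) \<le> augment_time (2 * ?z) (?z + ?z * ?z)"
      by (intro augment_time_mono add_mono mult_le_mono) (simp_all add: input_size_def)
    then have time: "t \<le> poly p ?z" using run(2) p by simp
    have k: "s ''k'' 0 = k"
      using res by (auto simp: result_inv_def pebble_game.main_inv_def pebble_game.input_def)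
    have ans: "output_answer (sem decide s) = (if s ''bad'' 0 = 0 \<and> s ''free'' 0 = k then 1 else 0)"
      by (auto simp: decide_def output_answer_def k)
    have arcs: "output_arcs (sem decide s) = output_arcs s"
      by (auto simp: decide_def output_arcs_def)
    have iff: "(\<exists>A'. admissible_augmentation k ?D A') \<longleftrightarrow> s ''bad'' 0 = 0 \<and> s ''free'' 0 = k"
      using result_correct[OF n es res] unfolding minimum_augmentation_def by blast
    show "\<exists>t s'. runs augment (input_state n es k) t s' \<and> t \<le> poly p ?z \<and>
      output_answer s' = (if \<exists>A'. admissible_augmentation k ?D A' then 1 else 0) \<and>
      ((\<exists>A'. admissible_augmentation k ?D A') \<longrightarrow>
        distinct (output_arcs s') \<and> minimum_augmentation k ?D (set (output_arcs s')))"
      using run(1) time result_correct(2)[OF n es res] unfolding iff ans[symmetric] arcs[symmetric]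
      by (intro exI[of _ t] exI[of _ "sem decide s"]) (simp add: ans)
  qed
qed

end
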